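(* When the graph $G$ is a tree or a cycle, the following decision problem is solvable in polynomial time: given an instance $(G,T,d)$ and an integer $k$, decide whether there exists a covering placement $P$ with $|P|\le k$.
   Context: An instance consists of a finite undirected graph $G=(V,E)$ whose edges all have unit length, a set of target vertices $T\subseteq V$, and for each target $t\in T$ a penetration time $d(t)\in\mathbb{N}^+$ (a positive integer). For $u,v\in V$ let $\omega^*_{u,v}$ be the shortest-path distance (number of edges) between $u$ and $v$ in $G$. A covering placement is a set $P=\{p_1,\dots,p_m\}\subseteq V$ of pairwise distinct vertices such that for every target $t\in T$ there exists $p_i\in P$ with $\omega^*_{p_i,t}\le d(t)$. *)

theory Defs
  imports Main "HOL-Library.Extended_Nat"
begin

text \<open>An instance is (n, es, ts): vertices are 0..<n, the undirected edges are the
  pairs in es (read symmetrically), and ts lists the targets t together with their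
  penetration times d(t).\<close>

definition adj :: "(nat \<times> nat) list \<Rightarrow> nat \<Rightarrow> nat \<Rightarrow> bool" where
  "adj es u v \<longleftrightarrow> (u, v) \<in> set es \<or> (v, u) \<in> set es"

definition is_walk :: "(nat \<times> nat) list \<Rightarrow> nat list \<Rightarrow> nat \<Rightarrow> nat \<Rightarrow> bool" where
  "is_walk es p u v \<longleftrightarrow> p \<noteq> [] \<and> hd p = u \<and> last p = v \<and>
     (\<forall>i. Suc i < length p \<longrightarrow> adj es (p ! i) (p ! Suc i))"

text \<open>Shortest-path distance (number of edges); infinity if v is unreachable from u.\<close>
definition dist :: "(nat \<times> nat) list \<Rightarrow> nat \<Rightarrow> nat \<Rightarrow> enat" where
  "dist es u v = (INF p \<in> {p. is_walk es p u v}. enat (length p - 1))"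

definition wf_instance :: "nat \<Rightarrow> (nat \<times> nat) list \<Rightarrow> (nat \<times> nat) list \<Rightarrow> bool" where
  "wf_instance n es ts \<longleftrightarrow>
     (\<forall>(u, v) \<in> set es. u < n \<and> v < n \<and> u \<noteq> v) \<and>
     (\<forall>(t, d) \<in> set ts. t < n \<and> 0 < d) \<and>
     distinct (map fst ts)"

definition connected :: "nat \<Rightarrow> (nat \<times> nat) list \<Rightarrow> bool" where
  "connected n es \<longleftrightarrow> (\<forall>u<n. \<forall>v<n. \<exists>p. is_walk es p u v)"

definition has_cycle :: "(nat \<times> nat) list \<Rightarrow> bool" where
  "has_cycle es \<longleftrightarrow> (\<exists>c. length c \<ge> 3 \<and> distinct c \<and>
     (\<forall>i < length c. adj es (c ! i) (c ! ((Suc i) mod length c))))"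

definition is_tree :: "nat \<Rightarrow> (nat \<times> nat) list \<Rightarrow> bool" where
  "is_tree n es \<longleftrightarrow> 0 < n \<and> connected n es \<and> \<not> has_cycle es"

definition is_cycle_graph :: "nat \<Rightarrow> (nat \<times> nat) list \<Rightarrow> bool" where
  "is_cycle_graph n es \<longleftrightarrow> 3 \<le> n \<and> (\<exists>c. length c = n \<and> set c = {0..<n} \<and> distinct c \<and>
     (\<forall>u v. adj es u v \<longleftrightarrow> (\<exists>i<n. {u, v} = {c ! i, c ! (Suc i mod n)})))"

definition covering_placement ::
  "nat \<Rightarrow> (nat \<times> nat) list \<Rightarrow> (nat \<times> nat) list \<Rightarrow> nat set \<Rightarrow> bool" where
  "covering_placement n es ts P \<longleftrightarrow> P \<subseteq> {0..<n} \<and>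
     (\<forall>(t, d) \<in> set ts. \<exists>p \<in> P. dist es p t \<le> enat d)"

definition yes_instance :: "nat \<Rightarrow> (nat \<times> nat) list \<Rightarrow> (nat \<times> nat) list \<Rightarrow> nat \<Rightarrow> bool" where
  "yes_instance n es ts k \<longleftrightarrow> (\<exists>P. covering_placement n es ts P \<and> card P \<le> k)"

section \<open>Binary encoding of instances as words over {1,2,3} (0 is the blank)\<close>

fun bits :: "nat \<Rightarrow> nat list" where
  "bits m = (if m = 0 then [] else (m mod 2 + 1) # bits (m div 2))"

definition enc_nat :: "nat \<Rightarrow> nat list" where
  "enc_nat m = bits m @ [3]"

definition enc_pairs :: "(nat \<times> nat) list \<Rightarrow> nat list" where
  "enc_pairs xs = enc_nat (length xs) @ concat (map (\<lambda>(a, b). enc_nat a @ enc_nat b) xs)"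

definition encode :: "nat \<Rightarrow> (nat \<times> nat) list \<Rightarrow> (nat \<times> nat) list \<Rightarrow> nat \<Rightarrow> nat list" where
  "encode n es ts k = enc_nat n @ enc_pairs es @ enc_pairs ts @ enc_nat k"

datatype dir = Left | Right | Stay

text \<open>A machine is (Q, S, \<delta>): states 0..<Q (0 start, 1 accept, 2 reject, both halting),
  tape symbols 0..<S (0 blank), transition function \<delta>.\<close>
type_synonym tm = "nat \<times> nat \<times> (nat \<Rightarrow> nat \<Rightarrow> nat \<times> nat \<times> dir)"
type_synonym config = "nat \<times> int \<times> (int \<Rightarrow> nat)"

definition tm_wf :: "tm \<Rightarrow> bool" where
  "tm_wf M = (case M of (Q, S, \<delta>) \<Rightarrow> 3 \<le> Q \<and> 4 \<le> S \<and>
     (\<forall>q<Q. \<forall>a<S. case \<delta> q a of (q', b, _) \<Rightarrow> q' < Q \<and> b < S))"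

definition move :: "dir \<Rightarrow> int \<Rightarrow> int" where
  "move m i = (case m of Left \<Rightarrow> i - 1 | Right \<Rightarrow> i + 1 | Stay \<Rightarrow> i)"

definition tm_step :: "tm \<Rightarrow> config \<Rightarrow> config" where
  "tm_step M c = (case M of (Q, S, \<delta>) \<Rightarrow> case c of (q, i, tp) \<Rightarrow>
     if q = 1 \<or> q = 2 then c
     else (case \<delta> q (tp i) of (q', b, m) \<Rightarrow> (q', move m i, tp(i := b))))"

definition init_config :: "nat list \<Rightarrow> config" where
  "init_config w = (0, 0, \<lambda>i. if 0 \<le> i \<and> i < int (length w) then w ! nat i else 0)"

definition tm_run :: "tm \<Rightarrow> nat \<Rightarrow> nat list \<Rightarrow> config" where
  "tm_run M t w = (tm_step M ^^ t) (init_config w)"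

definition poly_time_decidable_on :: "(nat \<Rightarrow> (nat \<times> nat) list \<Rightarrow> bool) \<Rightarrow> bool" where
  "poly_time_decidable_on G \<longleftrightarrow> (\<exists>M c e. tm_wf M \<and>
     (\<forall>n es ts k. wf_instance n es ts \<and> G n es \<longrightarrow>
        (let w = encode n es ts k; q = fst (tm_run M (c * length w ^ e + c) w)
         in (q = 1 \<or> q = 2) \<and> (q = 1 \<longleftrightarrow> yes_instance n es ts k))))"

end

theory Submission
  imports Defs
begin

text \<open>A single machine serves both graph classes. For every vertex x it puts x into the
  placement, drops the balls (the sets of vertices that cover a fixed target) containing x, and
  then proceeds greedily: as long as some remaining ball is simplicial, meaning that all remaining
  balls meeting it share a point with it, it pays for one such point and drops all these balls.
  It accepts if for some x all balls are dropped at a total cost of at most k. An accepting run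
  exhibits a covering placement in any graph. Conversely, in any placement, the point hitting a
  simplicial ball hits only balls dropped together with it, so the greedy run never pays more than
  an optimal placement containing x, provided a simplicial ball always exists. In a tree, take the
  ball whose vertex closest to a root is deepest; in a cycle without x, where the balls are
  intervals, take the one with the smallest right end.

  The algorithm is written in a language whose only control structures are first-order tests on
  tape positions and loops over all tape positions, so that its running time is polynomial by
  construction. The input word is at least as long as the number of vertices, and hence vertices,
  distances and loop counters all fit on the cells of the input.\<close>

section \<open>Programs on sets of tape positions and their compilation\<close>

text \<open>All numbers are written in binary, so \<open>k\<close> and the penetration times may be
  exponentially large in the length of the input. The budget \<open>k\<close> is therefore never
  turned into a position; it stays a binary counter on the digit cells of its own slot. A radius may
  be cut off at the input length, because a ball stops growing within \<open>n\<close> steps. The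
  bound on \<open>n\<close> itself comes from the edge list: in a cycle, and in a tree with more
  than one vertex, every vertex occurs there as an endpoint. Testing for a simplicial ball, instead
  of following a fixed processing order, spares the machine from computing a root or a rotation of
  the cycle; such an order occurs only in the proof that a simplicial ball exists. Putting
  \<open>x\<close> into the placement is what cuts the cycle open, and trying all \<open>x\<close>
  suffices because one of them lies in a hypothetical solution.\<close>

text \<open>A store maps each track to a set of positions below the input length L. A tape symbol is
  the bit vector of the tracks containing its position. In a loop, the track x holds the
  singletons {0}, ..., {L - 1} in turn; the loop stops at the first iteration returning False.\<close>

type_synonym store = "nat \<Rightarrow> nat set"

datatype prog = Ret bool | TMeet nat nat | TPrec nat nat | PIncl nat nat | PExcl nat nat
  | Cond prog prog prog | Loop nat prog

fun loop :: "nat \<Rightarrow> (store \<Rightarrow> bool \<times> store) \<Rightarrow> nat list \<Rightarrow> store \<Rightarrow> bool \<times> store" where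
  "loop x f [] s = (True, s(x := {}))"
| "loop x f (k # ks) s = (case f (s(x := {k})) of (b, s') \<Rightarrow>
     if b then loop x f ks s' else (False, s'(x := {})))"

primrec run :: "nat \<Rightarrow> prog \<Rightarrow> store \<Rightarrow> bool \<times> store" where
  "run L (Ret b) s = (b, s)"
| "run L (TMeet x y) s = (s x \<inter> s y \<noteq> {}, s)"
| "run L (TPrec x y) s = ((\<exists>p\<in>s x. \<exists>q\<in>s y. p < q), s)"
| "run L (PIncl j x) s = (True, s(j := s j \<union> s x))"
| "run L (PExcl j x) s = (True, s(j := s j - s x))"
| "run L (Cond p q r) s = (case run L p s of (b, s') \<Rightarrow> if b then run L q s' else run L r s')"
| "run L (Loop x p) s = loop x (run L p) [0..<L] s"

primrec loop_vars :: "prog \<Rightarrow> nat set" where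
  "loop_vars (Ret b) = {}"
| "loop_vars (TMeet x y) = {}"
| "loop_vars (TPrec x y) = {}"
| "loop_vars (PIncl j x) = {}"
| "loop_vars (PExcl j x) = {}"
| "loop_vars (Cond p q r) = loop_vars p \<union> loop_vars q \<union> loop_vars r"
| "loop_vars (Loop x p) = insert x (loop_vars p)"

text \<open>Tracks 0 and 1 hold the input and are never written. Each of the symbols 1, 2, 3 has a bit
  on one of them, so the blank 0 marks both ends of the tape throughout the computation. The tracks
  2 to 29 hold data, the tracks 30 to 59 are loop variables and are empty outside their loop.\<close>

primrec wf_prog :: "prog \<Rightarrow> bool" where
  "wf_prog (Ret b) = True"
| "wf_prog (TMeet x y) = True"
| "wf_prog (TPrec x y) = True"
| "wf_prog (PIncl j x) = (2 \<le> j \<and> j < 30)"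
| "wf_prog (PExcl j x) = (2 \<le> j \<and> j < 30)"
| "wf_prog (Cond p q r) = (wf_prog p \<and> wf_prog q \<and> wf_prog r)"
| "wf_prog (Loop x p) = (30 \<le> x \<and> x < 60 \<and> x \<notin> loop_vars p \<and> wf_prog p)"

lemma loop_var_cleared: "snd (loop x f ks s) x = {}"
  by (induction ks arbitrary: s) (auto split: prod.split)

text \<open>Explicit writes go only to tracks below 30, so a track from 30 on can change only as the
  variable of a loop, which clears it on leaving. The disjunction accounts for loops that a
  conditional skips.\<close>

lemma run_frame:
  assumes "wf_prog p" "v \<ge> 30"
  shows "snd (run L p s) v = s v \<or> (v \<in> loop_vars p \<and> snd (run L p s) v = {})"
  using assms(1)
proof (induction p arbitrary: s)
  case (Cond p q r)
  show ?case
    using Cond.IH(1)[of s] Cond.IH(2)[of "snd (run L p s)"] Cond.IH(3)[of "snd (run L p s)"] Cond.prems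
    by (auto split: prod.splits)
next
  case (Loop x p)
  have *: "snd (loop x (run L p) ks s) v = s v \<or>
     (v \<in> insert x (loop_vars p) \<and> snd (loop x (run L p) ks s) v = {})" for ks
  proof (induction ks arbitrary: s)
    case (Cons k ks)
    obtain b s' where f: "run L p (s(x := {k})) = (b, s')" by fastforce
    show ?case
    proof (cases "v = x")
      case True
      then show ?thesis using loop_var_cleared[of x "run L p" "k # ks" s] by simp
    next
      case False
      then have "s' v = s v \<or> v \<in> loop_vars p \<and> s' v = {}"
        using Loop.IH[of "s(x := {k})"] Loop.prems f by (simp add: fun_upd_def)
      then show ?thesis using f False Cons.IH[of s'] by (cases b) auto
    qed
  qed auto
  show ?case using *[of "[0..<L]"] by simp
qed (use assms(2) in auto)

lemma run_loop_var:
  assumes "wf_prog p" "v \<ge> 30" "s v = {}"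
  shows "snd (run L p s) v = {}"
  using run_frame[OF assms(1,2), of L s] assms(3) by auto

lemma loop_vars_ge: "wf_prog p \<Longrightarrow> v \<in> loop_vars p \<Longrightarrow> v \<ge> 30"
  by (induction p) auto

section \<open>Machine code for programs\<close>

type_synonym row = "nat \<Rightarrow> nat \<times> nat \<times> dir"

text \<open>The walk to the left ends on the blank at position -1; the final \<open>Right\<close>
  brings the head to position 0.\<close>

definition rewind :: "nat \<Rightarrow> nat \<Rightarrow> row" where
  "rewind q r = (\<lambda>c. if c = 0 then (r, 0, Right) else (q, c, Left))"

primrec psize :: "prog \<Rightarrow> nat" where
  "psize (Ret b) = 1"
| "psize (TMeet x y) = 3"
| "psize (TPrec x y) = 4"
| "psize (PIncl j x) = 2"
| "psize (PExcl j x) = 2"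
| "psize (Cond p q r) = psize p + psize q + psize r"
| "psize (Loop x p) = psize p + 7"

text \<open>The code is placed at address a and exits to y or n with the head back on position 0,
  depending on the result. A loop puts a mark on its track at position 0 and moves it one cell to
  the right after each iteration.\<close>

primrec compile :: "prog \<Rightarrow> nat \<Rightarrow> nat \<Rightarrow> nat \<Rightarrow> row list" where
  "compile (Ret b) a y n = [\<lambda>c. (if b then y else n, c, Stay)]"
| "compile (TMeet x j) a y n =
    [\<lambda>c. if c = 0 then (a + 2, c, Left) else if bit c x \<and> bit c j then (a + 1, c, Left)
         else (a, c, Right),
     rewind (a + 1) y, rewind (a + 2) n]"
| "compile (TPrec x j) a y n =
    [\<lambda>c. if c = 0 then (a + 2, c, Left) else if bit c x then (a + 3, c, Right) else (a, c, Right),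
     rewind (a + 1) y, rewind (a + 2) n,
     \<lambda>c. if c = 0 then (a + 2, c, Left) else if bit c j then (a + 1, c, Left) else (a + 3, c, Right)]"
| "compile (PIncl j x) a y n =
    [\<lambda>c. if c = 0 then (a + 1, c, Left) else (a, if bit c x then set_bit j c else c, Right),
     rewind (a + 1) y]"
| "compile (PExcl j x) a y n =
    [\<lambda>c. if c = 0 then (a + 1, c, Left) else (a, if bit c x then unset_bit j c else c, Right),
     rewind (a + 1) y]"
| "compile (Cond p q r) a y n =
    compile p a (a + psize p) (a + psize p + psize q) @
    compile q (a + psize p) y n @ compile r (a + psize p + psize q) y n"
| "compile (Loop x p) a y n = (let e = a + 1 + psize p in
    [\<lambda>c. (a + 1, set_bit x c, Stay)] @ compile p (a + 1) e (e + 4) @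
    [\<lambda>c. if bit c x then (e + 1, unset_bit x c, Right) else (e, c, Right),
     \<lambda>c. if c = 0 then (e + 3, c, Left) else (e + 2, set_bit x c, Left),
     rewind (e + 2) (a + 1), rewind (e + 3) y,
     \<lambda>c. if bit c x then (e + 5, unset_bit x c, Left) else (e + 4, c, Right),
     rewind (e + 5) n])"

lemma length_compile [simp]: "length (compile p a y n) = psize p"
  by (induction p arbitrary: a y n) (auto simp: Let_def)

definition code_at :: "(nat \<Rightarrow> row) \<Rightarrow> nat \<Rightarrow> row list \<Rightarrow> bool" where
  "code_at \<delta> a rs \<longleftrightarrow> (\<forall>i < length rs. \<delta> (a + i) = rs ! i)"

lemma code_at_Nil [simp]: "code_at \<delta> a []"
  by (simp add: code_at_def)

lemma code_at_Cons [simp]: "code_at \<delta> a (r # rs) \<longleftrightarrow> \<delta> a = r \<and> code_at \<delta> (Suc a) rs"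
  by (auto simp: code_at_def less_Suc_eq_0_disj)

lemma code_at_append [simp]:
  "code_at \<delta> a (rs @ rs') \<longleftrightarrow> code_at \<delta> a rs \<and> code_at \<delta> (a + length rs) rs'"
  by (induction rs arbitrary: a) auto

definition reaches :: "tm \<Rightarrow> config \<Rightarrow> nat \<Rightarrow> config \<Rightarrow> bool" where
  "reaches M c T c' \<longleftrightarrow> (\<exists>t \<le> T. (tm_step M ^^ t) c = c')"

lemma reaches_trans:
  assumes "reaches M c T c'" "reaches M c' T' c''" "T + T' \<le> T''"
  shows "reaches M c T'' c''"
proof -
  obtain t t' where "t \<le> T" "t' \<le> T'" "(tm_step M ^^ t) c = c'" "(tm_step M ^^ t') c' = c''"
    using assms unfolding reaches_def by blast
  moreover from this have "(tm_step M ^^ (t' + t)) c = c''" by (simp add: funpow_add)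
  ultimately show ?thesis using assms(3) unfolding reaches_def
    by (intro exI[of _ "t' + t"]) auto
qed

lemma reaches_step: "tm_step M c = c' \<Longrightarrow> 1 \<le> T \<Longrightarrow> reaches M c T c'"
  unfolding reaches_def by (rule exI[of _ 1]) simp

lemma tm_step_eq:
  assumes "q \<ge> 3" "\<delta> q (tp i) = (q', b, d)"
  shows "tm_step (Q, S, \<delta>) (q, i, tp) = (q', move d i, tp(i := b))"
  using assms by (simp add: tm_step_def)

text \<open>The function \<open>f\<close> lets one lemma serve both the pure searches, where it is
  the identity, and the sweeps of \<open>PIncl\<close> and \<open>PExcl\<close>, which rewrite every
  cell.\<close>

lemma scan_right:
  assumes "q \<ge> 3" "\<And>p. i \<le> p \<Longrightarrow> p < i + int k \<Longrightarrow> \<delta> q (tp p) = (q, f (tp p), Right)"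
  shows "(tm_step (Q, S, \<delta>) ^^ k) (q, i, tp) =
    (q, i + int k, \<lambda>p. if i \<le> p \<and> p < i + int k then f (tp p) else tp p)"
  using assms(2)
proof (induction k)
  case (Suc k)
  let ?tp = "\<lambda>p. if i \<le> p \<and> p < i + int k then f (tp p) else tp p"
  have IH: "(tm_step (Q, S, \<delta>) ^^ k) (q, i, tp) = (q, i + int k, ?tp)"
    using Suc by simp
  have d: "\<delta> q (?tp (i + int k)) = (q, f (tp (i + int k)), Right)" using Suc.prems by simp
  have "(tm_step (Q, S, \<delta>) ^^ Suc k) (q, i, tp) = tm_step (Q, S, \<delta>) (q, i + int k, ?tp)"
    by (simp only: funpow.simps comp_def IH)
  also have "\<dots> = (q, move Right (i + int k), ?tp(i + int k := f (tp (i + int k))))"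
    using tm_step_eq[OF assms(1), of \<delta> ?tp, OF d] .
  also have "\<dots> = (q, i + int (Suc k), \<lambda>p. if i \<le> p \<and> p < i + int (Suc k) then f (tp p) else tp p)"
    by (auto simp: move_def fun_eq_iff)
  finally show ?case .
qed auto

lemma scan_left:
  assumes "q \<ge> 3" "\<And>p. i - int k < p \<Longrightarrow> p \<le> i \<Longrightarrow> \<delta> q (tp p) = (q, tp p, Left)"
  shows "(tm_step (Q, S, \<delta>) ^^ k) (q, i, tp) = (q, i - int k, tp)"
  using assms(2)
proof (induction k)
  case (Suc k)
  have IH: "(tm_step (Q, S, \<delta>) ^^ k) (q, i, tp) = (q, i - int k, tp)"
    using Suc by simp
  have "(tm_step (Q, S, \<delta>) ^^ Suc k) (q, i, tp) = tm_step (Q, S, \<delta>) (q, i - int k, tp)"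
    by (simp only: funpow.simps comp_def IH)
  then show ?case using tm_step_eq[OF assms(1), of \<delta> tp "i - int k"] Suc.prems
    by (simp add: move_def)
qed auto

section \<open>Tapes that represent stores, and correctness of the compiled code\<close>

definition enc :: "nat \<Rightarrow> store \<Rightarrow> (int \<Rightarrow> nat) \<Rightarrow> bool" where
  "enc L s tp \<longleftrightarrow> (\<forall>j. s j \<subseteq> {..<L}) \<and> s 0 \<union> s 1 = {..<L} \<and>
     (\<forall>i. i < 0 \<or> int L \<le> i \<longrightarrow> tp i = 0) \<and>
     (\<forall>p<L. \<forall>j. bit (tp (int p)) j \<longleftrightarrow> p \<in> s j)"

lemma enc_bit: "enc L s tp \<Longrightarrow> 0 \<le> i \<Longrightarrow> i < int L \<Longrightarrow> bit (tp i) j \<longleftrightarrow> nat i \<in> s j"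
  unfolding enc_def by (metis nat_0_le nat_less_iff)

lemma enc_nonblank:
  assumes "enc L s tp" "0 \<le> i" "i < int L"
  shows "tp i \<noteq> 0"
proof -
  have "nat i \<in> s 0 \<or> nat i \<in> s 1" using assms unfolding enc_def by auto
  then show ?thesis using enc_bit[OF assms] by (metis bit_0_eq bot_apply bot_bool_def)
qed

lemma enc_blank: "enc L s tp \<Longrightarrow> i < 0 \<or> int L \<le> i \<Longrightarrow> tp i = 0"
  unfolding enc_def by blast

text \<open>The head may start on -1, since a row that finds what it seeks at position 0 leaves that
  cell to the left.\<close>

lemma rewind_reaches:
  assumes "\<delta> q = rewind q r" "q \<ge> 3" "enc L s tp" "-1 \<le> i" "i < int L" "L + 1 \<le> T"
  shows "reaches (Q, S, \<delta>) (q, i, tp) T (r, 0, tp)"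
proof -
  have "(tm_step (Q, S, \<delta>) ^^ nat (i + 1)) (q, i, tp) = (q, i - int (nat (i + 1)), tp)"
    by (rule scan_left) (use assms enc_nonblank[OF assms(3)] in \<open>auto simp: rewind_def\<close>)
  then have 1: "reaches (Q, S, \<delta>) (q, i, tp) L (q, -1, tp)"
    using assms(4,5) unfolding reaches_def by (intro exI[of _ "nat (i + 1)"]) auto
  have tp: "tp (-1) = 0" using enc_blank[OF assms(3)] by simp
  have 2: "tm_step (Q, S, \<delta>) (q, -1, tp) = (r, 0, tp)"
    using tm_step_eq[OF assms(2), of \<delta> tp "-1"] assms(1) tp
    by (simp add: rewind_def move_def fun_eq_iff)
  show ?thesis by (rule reaches_trans[OF 1 reaches_step[OF 2 order.refl]]) (use assms in simp)
qed

lemma scan_right_id: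
  assumes "q \<ge> 3" "\<And>p. i \<le> p \<Longrightarrow> p < j \<Longrightarrow> \<delta> q (tp p) = (q, tp p, Right)" "i \<le> j" "nat (j - i) \<le> T"
  shows "reaches (Q, S, \<delta>) (q, i, tp) T (q, j, tp)"
proof -
  have "(tm_step (Q, S, \<delta>) ^^ nat (j - i)) (q, i, tp) = (q, j, tp)"
    using scan_right[OF assms(1), of i "nat (j - i)" \<delta> tp "\<lambda>x. x"] assms by simp
  then show ?thesis using assms(4) unfolding reaches_def by blast
qed

lemma find_right:
  assumes "q \<ge> 3" "i < int L" "0 \<le> i"
    "\<And>p. i \<le> p \<Longrightarrow> p < int L \<Longrightarrow> \<not> P (nat p) \<Longrightarrow> \<delta> q (tp p) = (q, tp p, Right)"
    "\<exists>p. nat i \<le> p \<and> p < L \<and> P p"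
  shows "\<exists>p. nat i \<le> p \<and> p < L \<and> P p \<and> (\<forall>p'. nat i \<le> p' \<longrightarrow> p' < p \<longrightarrow> \<not> P p') \<and>
     reaches (Q, S, \<delta>) (q, i, tp) (p - nat i) (q, int p, tp)"
proof -
  define p where "p = (LEAST p. nat i \<le> p \<and> p < L \<and> P p)"
  have p: "nat i \<le> p" "p < L" "P p" using LeastI_ex[OF assms(5)] unfolding p_def by auto
  have min: "\<forall>p'. nat i \<le> p' \<longrightarrow> p' < p \<longrightarrow> \<not> P p'"
    using not_less_Least[of _ "\<lambda>p. nat i \<le> p \<and> p < L \<and> P p"] p(2) unfolding p_def
    by (metis less_trans)
  have "reaches (Q, S, \<delta>) (q, i, tp) (p - nat i) (q, int p, tp)"
    by (rule scan_right_id[OF assms(1)]) (use assms p min in \<open>auto simp: nat_less_iff nat_le_iff\<close>)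
  then show ?thesis using p min by blast
qed

text \<open>The term \<open>2 * L + 4\<close> bounds one sweep to the right and the way back;
  \<open>2 * L + 6\<close> bounds the moving of the loop mark and the return to position 0. Both are
  rounded up generously, as only polynomial growth matters.\<close>

primrec cost :: "nat \<Rightarrow> prog \<Rightarrow> nat" where
  "cost L (Ret b) = 1"
| "cost L (TMeet x y) = 2 * L + 4"
| "cost L (TPrec x y) = 2 * L + 4"
| "cost L (PIncl j x) = 2 * L + 4"
| "cost L (PExcl j x) = 2 * L + 4"
| "cost L (Cond p q r) = cost L p + cost L q + cost L r"
| "cost L (Loop x p) = 1 + L * (cost L p + (2 * L + 6))"

lemma enc_set_bit:
  assumes "enc L s tp" "k < L" "x \<ge> 2" 
  shows "enc L (s(x := insert k (s x))) (tp(int k := set_bit x (tp (int k))))"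
  using assms unfolding enc_def by (auto simp: bit_set_bit_iff)

lemma enc_unset_bit:
  assumes "enc L s tp" "k < L" "x \<ge> 2" 
  shows "enc L (s(x := s x - {k})) (tp(int k := unset_bit x (tp (int k))))"
  using assms unfolding enc_def by (auto simp: bit_unset_bit_iff)

text \<open>The statement concerns the iterations from \<open>k\<close> on, with the mark already on
  cell \<open>k\<close>, so that induction on \<open>L - k\<close> applies. State \<open>b\<close>
  starts the body, which leaves to \<open>e\<close> or \<open>e + 4\<close>. From \<open>e\<close>
  the mark is found and erased, \<open>e + 1\<close> sets it on the next cell, \<open>e + 2\<close>
  returns to the body and \<open>e + 3\<close> leaves the finished loop; \<open>e + 4\<close> and
  \<open>e + 5\<close> handle the early exit.\<close>

lemma loop_reaches:
  assumes body: "\<And>s tp. enc L s tp \<Longrightarrow> \<forall>v\<in>loop_vars p. s v = {} \<Longrightarrow>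
      \<exists>tp'. reaches M (b, 0, tp) C (if fst (run L p s) then e else e + 4, 0, tp') \<and>
        enc L (snd (run L p s)) tp'"
    and M: "M = (Q, S, \<delta>)" and b: "b \<ge> 3" "e \<ge> 3"
    and wf: "wf_prog (Loop x p)"
    and rows: "\<delta> e = (\<lambda>c. if bit c x then (e + 1, unset_bit x c, Right) else (e, c, Right))"
     "\<delta> (e + 1) = (\<lambda>c. if c = 0 then (e + 3, c, Left) else (e + 2, set_bit x c, Left))"
     "\<delta> (e + 2) = rewind (e + 2) b" "\<delta> (e + 3) = rewind (e + 3) y"
     "\<delta> (e + 4) = (\<lambda>c. if bit c x then (e + 5, unset_bit x c, Left) else (e + 4, c, Right))"
     "\<delta> (e + 5) = rewind (e + 5) n"
    and "k < L" "enc L (s(x := {k})) tp" "\<forall>v\<in>loop_vars p. s v = {}"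
  shows "\<exists>tp'. reaches M (b, 0, tp) ((L - k) * (C + (2 * L + 6)))
      (if fst (loop x (run L p) [k..<L] s) then y else n, 0, tp') \<and>
      enc L (snd (loop x (run L p) [k..<L] s)) tp'"
  using assms(12-14)
proof (induction "L - k" arbitrary: k s tp)
  case (Suc m)
  have x: "30 \<le> x" "x \<notin> loop_vars p" "wf_prog p" using wf by auto
  let ?s = "s(x := {k})"
  obtain bb s' where r: "run L p ?s = (bb, s')" by fastforce
  have v0: "\<forall>v\<in>loop_vars p. ?s v = {}"
  proof
    fix v assume "v \<in> loop_vars p"
    then show "?s v = {}" using Suc.prems(3) x(2) by (cases "v = x") auto
  qed
  obtain tp1 where tp1: "reaches M (b, 0, tp) C (if bb then e else e + 4, 0, tp1)" "enc L s' tp1"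
    using body[OF Suc.prems(2) v0] r by (auto simp: fun_upd_def)
  have s'x: "s' x = {k}" using run_frame[OF x(3,1), of L ?s] x(2) r by simp
  have s'v: "\<forall>v\<in>loop_vars p. s' v = {}"
  proof
    fix v assume v: "v \<in> loop_vars p"
    then have "v \<ge> 30" using loop_vars_ge[OF x(3)] by blast
    then show "s' v = {}" using run_loop_var[OF x(3), of v ?s L] v0 v unfolding r by simp
  qed
  have bk: "bit (tp1 i) x \<longleftrightarrow> i = int k" if "0 \<le> i" "i < int L" for i
  proof -
    have "bit (tp1 i) x \<longleftrightarrow> nat i = k" using enc_bit[OF tp1(2) that, of x] unfolding s'x by simp
    also have "\<dots> \<longleftrightarrow> i = int k" using that(1) by linarith
    finally show ?thesis .
  qed
  define tp2 where "tp2 = tp1(int k := unset_bit x (tp1 (int k)))"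
  have tp2: "enc L (s'(x := {})) tp2"
    using enc_unset_bit[OF tp1(2) Suc.prems(1), of x] x(1) s'x unfolding tp2_def by simp
  have lk: "[k..<L] = k # [Suc k..<L]" using Suc.prems(1) by (simp add: upt_conv_Cons)
  have mul: "(L - k) * (C + (2 * L + 6)) = C + (2 * L + 6) + (L - Suc k) * (C + (2 * L + 6))"
  proof -
    have "L - k = Suc (L - Suc k)" using Suc.prems(1) by simp
    then show ?thesis by (simp only: mult_Suc)
  qed
  have M': "M = (Q, S, \<delta>)" by (fact M)
  show ?case
  proof (cases bb)
    case False
    have 1: "reaches M (e + 4, 0, tp1) k (e + 4, int k, tp1)" unfolding M
      by (rule scan_right_id) (use rows bk Suc.prems(1) in auto)
    have 2: "reaches M (e + 4, int k, tp1) 1 (e + 5, int k - 1, tp2)" unfolding M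
      by (rule reaches_step) (use rows(5) bk[of "int k"] Suc.prems(1) in
        \<open>simp_all add: tm_step_def move_def tp2_def\<close>)
    have 3: "reaches M (e + 5, int k - 1, tp2) (L + 1) (n, 0, tp2)" unfolding M
      by (rule rewind_reaches[where \<delta> = \<delta>, OF rows(6) _ tp2]) (use Suc.prems(1) b in auto)
    have 0: "reaches M (b, 0, tp) C (e + 4, 0, tp1)" using tp1(1) False by simp
    have "reaches M (b, 0, tp) ((L - k) * (C + (2 * L + 6))) (n, 0, tp2)"
      by (rule reaches_trans[OF 0 reaches_trans[OF 1 reaches_trans[OF 2 3 order.refl] order.refl]])
        (use mul Suc.prems(1) in auto)
    then show ?thesis using tp2 r lk False by auto
  next
    case True
    have 1: "reaches M (e, 0, tp1) k (e, int k, tp1)" unfolding M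
      by (rule scan_right_id) (use rows bk Suc.prems(1) b in auto)
    have 2: "reaches M (e, int k, tp1) 1 (e + 1, int k + 1, tp2)" unfolding M
      by (rule reaches_step) (use rows(1) bk[of "int k"] Suc.prems(1) b in
        \<open>simp_all add: tm_step_def move_def tp2_def\<close>)
    have 12: "reaches M (b, 0, tp) (C + k + 1) (e + 1, int k + 1, tp2)"
      using reaches_trans[OF tp1(1) reaches_trans[OF _ 2 order.refl] order.refl] 1 True by simp
    show ?thesis
    proof (cases "Suc k = L")
      case fin: True
      \<comment> \<open>The blank behind the input is how the machine notices that \<open>k\<close>
        was the last position.\<close>
      have "tp2 (int k + 1) = 0" using enc_blank[OF tp2, of "int k + 1"] fin by simp
      then have 3: "reaches M (e + 1, int k + 1, tp2) 1 (e + 3, int k, tp2)" unfolding M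
        by (intro reaches_step) (use rows(2) b in \<open>simp_all add: tm_step_def move_def fun_upd_idem\<close>)
      have 4: "reaches M (e + 3, int k, tp2) (L + 1) (y, 0, tp2)" unfolding M
        by (rule rewind_reaches[where \<delta> = \<delta>, OF rows(4) _ tp2]) (use Suc.prems(1) b in auto)
      have "reaches M (b, 0, tp) ((L - k) * (C + (2 * L + 6))) (y, 0, tp2)"
        by (rule reaches_trans[OF 12 reaches_trans[OF 3 4 order.refl]]) (use fin mul in auto)
      then show ?thesis using tp2 r lk True fin by auto
    next
      case False
      then have k: "Suc k < L" using Suc.prems(1) by simp
      define tp3 where "tp3 = tp2(int (Suc k) := set_bit x (tp2 (int (Suc k))))"
      have tp3: "enc L (s'(x := {Suc k})) tp3"
        using enc_set_bit[OF tp2 k, of x] x(1) unfolding tp3_def by simp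
      have "tp2 (int k + 1) \<noteq> 0" using enc_nonblank[OF tp2, of "int k + 1"] k by simp
      then have 3: "reaches M (e + 1, int k + 1, tp2) 1 (e + 2, int k, tp3)" unfolding M
        by (intro reaches_step) (use rows(2) b in \<open>simp_all add: tm_step_def move_def tp3_def add.commute\<close>)
      have 4: "reaches M (e + 2, int k, tp3) (L + 1) (b, 0, tp3)" unfolding M
        by (rule rewind_reaches[where \<delta> = \<delta>, OF rows(3) _ tp3]) (use Suc.prems(1) b in auto)
      obtain tp' where tp': "reaches M (b, 0, tp3) ((L - Suc k) * (C + (2 * L + 6)))
          (if fst (loop x (run L p) [Suc k..<L] s') then y else n, 0, tp')"
          "enc L (snd (loop x (run L p) [Suc k..<L] s')) tp'"
        using Suc.hyps(1)[OF _ k tp3 s'v] Suc.hyps(2) by (metis Suc_diff_Suc Suc.prems(1) Suc_inject)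
      have "reaches M (b, 0, tp) ((L - k) * (C + (2 * L + 6)))
        (if fst (loop x (run L p) [Suc k..<L] s') then y else n, 0, tp')"
        by (rule reaches_trans[OF 12 reaches_trans[OF 3 reaches_trans[OF 4 tp'(1) order.refl] order.refl]])
          (use k mul in auto)
      then show ?thesis using tp'(2) r lk True by auto
    qed
  qed
qed simp

lemma sweep_reaches:
  assumes rows: "\<delta> a = (\<lambda>c. if c = 0 then (a + 1, c, Left) else (a, f c, Right))"
      "\<delta> (a + 1) = rewind (a + 1) y"
    and "a \<ge> 3" and M: "M = (Q, S, \<delta>)" and e: "enc L s tp"
    and e': "enc L s' (\<lambda>p. if 0 \<le> p \<and> p < int L then f (tp p) else tp p)"
  shows "\<exists>tp'. reaches M (a, 0, tp) (2 * L + 4) (y, 0, tp') \<and> enc L s' tp'"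
proof -
  let ?tp = "\<lambda>p. if 0 \<le> p \<and> p < int L then f (tp p) else tp p"
  have "(tm_step M ^^ L) (a, 0, tp) = (a, int L, ?tp)"
    unfolding M using scan_right[OF assms(3), of 0 L \<delta> tp f Q S] rows(1) enc_nonblank[OF e] by simp
  then have 1: "reaches M (a, 0, tp) L (a, int L, ?tp)" unfolding reaches_def by blast
  have 2: "reaches M (a, int L, ?tp) 1 (a + 1, int L - 1, ?tp)" unfolding M
    by (rule reaches_step) (use rows assms(3) enc_blank[OF e, of "int L"] in
      \<open>auto simp: tm_step_def move_def fun_eq_iff\<close>)
  have 3: "reaches M (a + 1, int L - 1, ?tp) (L + 1) (y, 0, ?tp)" unfolding M
    by (rule rewind_reaches[where \<delta> = \<delta>, OF rows(2) _ e']) (use assms(3) in auto)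
  show ?thesis using reaches_trans[OF 1 reaches_trans[OF 2 3 order.refl], of "2 * L + 4"] e' by auto
qed

text \<open>Loop variables must be empty on entry because a loop merely adds the bit at position 0
  and relies on its track then being \<open>{0}\<close>; \<open>L \<ge> 1\<close> provides this
  cell. Addresses start at 3 since the states 0, 1, 2 have a fixed meaning.\<close>

lemma compile_correct:
  assumes "wf_prog p" "code_at \<delta> a (compile p a y n)" "a \<ge> 3" "enc L s tp" "L \<ge> 1"
    "\<forall>v\<in>loop_vars p. s v = {}" and M: "M = (Q, S, \<delta>)"
  shows "\<exists>tp'. reaches M (a, 0, tp) (cost L p) (if fst (run L p s) then y else n, 0, tp') \<and>
     enc L (snd (run L p s)) tp'"
  using assms(1-6)
proof (induction p arbitrary: a y n s tp)
  case (Ret b)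
  then show ?case unfolding M
    by (intro exI[of _ tp] conjI reaches_step) (auto simp: tm_step_def move_def)
next
  case (TMeet x j)
  let ?P = "\<lambda>p. p \<in> s x \<and> p \<in> s j"
  have rows: "\<delta> a = (\<lambda>c. if c = 0 then (a + 2, c, Left) else if bit c x \<and> bit c j then (a + 1, c, Left)
         else (a, c, Right))" "\<delta> (a + 1) = rewind (a + 1) y" "\<delta> (a + 2) = rewind (a + 2) n"
    using TMeet.prems(2) by auto
  note e = TMeet.prems(4)
  show ?case
  proof (cases "s x \<inter> s j = {}")
    case True
    have 1: "reaches M (a, 0, tp) L (a, int L, tp)" unfolding M
      by (rule scan_right_id)
        (use TMeet.prems(3) rows(1) enc_nonblank[OF e] enc_bit[OF e] True in auto)
    have 2: "reaches M (a, int L, tp) 1 (a + 2, int L - 1, tp)" unfolding M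
      by (rule reaches_step) (use TMeet.prems(3) rows(1) enc_blank[OF e] in
        \<open>auto simp: tm_step_def move_def fun_eq_iff\<close>)
    have 3: "reaches M (a + 2, int L - 1, tp) (L + 1) (n, 0, tp)" unfolding M
      by (rule rewind_reaches[where \<delta> = \<delta>, OF rows(3) _ e]) (use \<open>a \<ge> 3\<close> in auto)
    show ?thesis using reaches_trans[OF 1 reaches_trans[OF 2 3 order.refl], of "2 * L + 4"] e True by auto
  next
    case False
    then obtain p0 where p0: "p0 < L" "?P p0" using e unfolding enc_def by blast
    then have ex: "\<exists>p. nat 0 \<le> p \<and> p < L \<and> ?P p" by auto
    have c: "\<delta> a (tp p) = (a, tp p, Right)" if "0 \<le> p" "p < int L" "\<not> ?P (nat p)" for p
      using that rows(1) enc_nonblank[OF e] enc_bit[OF e] by auto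
    obtain p where p: "p < L" "?P p" "reaches M (a, 0, tp) p (a, int p, tp)"
      using find_right[of a 0 L ?P \<delta> tp Q S, OF _ _ _ c ex] TMeet.prems(3,5) unfolding M by auto
    have 2: "reaches M (a, int p, tp) 1 (a + 1, int p - 1, tp)" unfolding M
      by (rule reaches_step) (use p TMeet.prems(3) rows(1) enc_nonblank[OF e, of "int p"]
         enc_bit[OF e, of "int p"] in \<open>auto simp: tm_step_def move_def fun_eq_iff\<close>)
    have 3: "reaches M (a + 1, int p - 1, tp) (L + 1) (y, 0, tp)" unfolding M
      by (rule rewind_reaches[where \<delta> = \<delta>, OF rows(2) _ e]) (use p \<open>a \<ge> 3\<close> in auto)
    show ?thesis using reaches_trans[OF p(3) reaches_trans[OF 2 3 order.refl], of "2 * L + 4"] e False p(1)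
      by auto
  qed
next
  case (TPrec x j)
  have rows: "\<delta> a = (\<lambda>c. if c = 0 then (a + 2, c, Left) else if bit c x then (a + 3, c, Right) else (a, c, Right))"
    "\<delta> (a + 1) = rewind (a + 1) y" "\<delta> (a + 2) = rewind (a + 2) n"
    "\<delta> (a + 3) = (\<lambda>c. if c = 0 then (a + 2, c, Left) else if bit c j then (a + 1, c, Left)
       else (a + 3, c, Right))"
    using TPrec.prems(2) by (auto simp: numeral_eq_Suc)
  note e = TPrec.prems(4)
  have sub: "s x \<subseteq> {..<L}" "s j \<subseteq> {..<L}" using e unfolding enc_def by auto
  \<comment> \<open>The search for an element of \<open>s x\<close> and the subsequent search for an
    element of \<open>s j\<close> fail alike, by running into the right end.\<close>
  have fin: "reaches M (a', int L, tp) (L + 2) (n, 0, tp)" if "a' = a \<or> a' = a + 3" for a'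
  proof -
    have 2: "reaches M (a', int L, tp) 1 (a + 2, int L - 1, tp)" unfolding M
      by (rule reaches_step) (use that TPrec.prems(3) rows enc_blank[OF e] in
        \<open>auto simp: tm_step_def move_def fun_eq_iff\<close>)
    have 3: "reaches M (a + 2, int L - 1, tp) (L + 1) (n, 0, tp)" unfolding M
      by (rule rewind_reaches[where \<delta> = \<delta>, OF rows(3) _ e]) (use \<open>a \<ge> 3\<close> in auto)
    show ?thesis using reaches_trans[OF 2 3] by simp
  qed
  show ?case
  proof (cases "s x = {}")
    case True
    have 1: "reaches M (a, 0, tp) L (a, int L, tp)" unfolding M
      by (rule scan_right_id)
        (use TPrec.prems(3) rows(1) enc_nonblank[OF e] enc_bit[OF e] True in auto)
    show ?thesis using reaches_trans[OF 1 fin[of a], of "2 * L + 4"] e True by auto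
  next
    case False
    then have ex: "\<exists>p. nat 0 \<le> p \<and> p < L \<and> p \<in> s x" using sub by auto
    have c: "\<delta> a (tp p) = (a, tp p, Right)" if "0 \<le> p" "p < int L" "nat p \<notin> s x" for p
      using that rows(1) enc_nonblank[OF e] enc_bit[OF e] by auto
    obtain p where p: "p < L" "p \<in> s x" "\<forall>p'<p. p' \<notin> s x" "reaches M (a, 0, tp) p (a, int p, tp)"
      using find_right[of a 0 L "\<lambda>p. p \<in> s x" \<delta> tp Q S, OF _ _ _ c ex] TPrec.prems(3,5)
      unfolding M by auto
    have 2: "reaches M (a, int p, tp) 1 (a + 3, int p + 1, tp)" unfolding M
      by (rule reaches_step) (use p TPrec.prems(3) rows(1) enc_nonblank[OF e, of "int p"]
         enc_bit[OF e, of "int p"] in \<open>auto simp: tm_step_def move_def fun_eq_iff\<close>)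
    have 12: "reaches M (a, 0, tp) (p + 1) (a + 3, int p + 1, tp)"
      using reaches_trans[OF p(4) 2] by simp
    show ?thesis
    proof (cases "\<exists>q\<in>s j. p < q")
      case True
      then have ex: "\<exists>q. nat (int p + 1) \<le> q \<and> q < L \<and> q \<in> s j"
        using sub(2) by (metis Suc_eq_plus1 Suc_leI lessThan_iff nat_int of_nat_1 of_nat_add subsetD)
      then have pL: "int p + 1 < int L" by auto
      have c': "\<delta> (a + 3) (tp q) = (a + 3, tp q, Right)"
        if "int p + 1 \<le> q" "q < int L" "nat q \<notin> s j" for q
        using that rows(4) enc_nonblank[OF e] enc_bit[OF e] by auto
      have nS: "nat (int p + 1) = Suc p" by simp
      obtain q where q: "p < q" "q < L" "q \<in> s j"
        "reaches M (a + 3, int p + 1, tp) (q - nat (int p + 1)) (a + 3, int q, tp)"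
        using find_right[of "a + 3" "int p + 1" L "\<lambda>p. p \<in> s j" \<delta> tp Q S, OF _ pL _ c' ex]
          TPrec.prems(3) nS unfolding M by (auto simp: Suc_le_eq)
      have 3: "reaches M (a + 3, int q, tp) 1 (a + 1, int q - 1, tp)" unfolding M
        by (rule reaches_step) (use q TPrec.prems(3) rows(4) enc_nonblank[OF e, of "int q"]
           enc_bit[OF e, of "int q"] in \<open>auto simp: tm_step_def move_def fun_eq_iff\<close>)
      have 4: "reaches M (a + 1, int q - 1, tp) (L + 1) (y, 0, tp)" unfolding M
        by (rule rewind_reaches[where \<delta> = \<delta>, OF rows(2) _ e]) (use q \<open>a \<ge> 3\<close> in auto)
      have "reaches M (a, 0, tp) (2 * L + 4) (y, 0, tp)"
        by (rule reaches_trans[OF 12 reaches_trans[OF q(4) reaches_trans[OF 3 4 order.refl] order.refl]])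
         (use q in auto)
      then show ?thesis using True p(2) e by auto
    next
      case False
      \<comment> \<open>As \<open>p\<close> is the least element of \<open>s x\<close>, it precedes
        an element of \<open>s j\<close> if any element of \<open>s x\<close> does.\<close>
      then have none: "\<not> (\<exists>p\<in>s x. \<exists>q\<in>s j. p < q)" using p(3) by (meson less_le_trans not_le_imp_less)
      have 3: "reaches M (a + 3, int p + 1, tp) (L - Suc p) (a + 3, int L, tp)" unfolding M
        by (rule scan_right_id)
          (use p TPrec.prems(3) rows(4) enc_nonblank[OF e] enc_bit[OF e] False in auto)
      have "reaches M (a, 0, tp) (2 * L + 4) (n, 0, tp)"
        by (rule reaches_trans[OF 12 reaches_trans[OF 3 fin order.refl]]) (use p in auto)
      then show ?thesis using none e by auto
    qed
  qed
next
  case (PIncl j x)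
  note e = PIncl.prems(4)
  show ?case
    by (simp, rule sweep_reaches[OF _ _ _ M e, where f = "\<lambda>c. if bit c x then set_bit j c else c"])
      (use PIncl.prems e in \<open>auto simp: enc_def bit_set_bit_iff subset_iff split: if_splits\<close>)
next
  case (PExcl j x)
  note e = PExcl.prems(4)
  show ?case
    by (simp, rule sweep_reaches[OF _ _ _ M e, where f = "\<lambda>c. if bit c x then unset_bit j c else c"])
      (use PExcl.prems e in \<open>auto simp: enc_def bit_unset_bit_iff subset_iff split: if_splits\<close>)
next
  case (Cond p q r)
  obtain b s' where r: "run L p s = (b, s')" by fastforce
  obtain tp1 where tp1: "reaches M (a, 0, tp) (cost L p)
      (if b then a + psize p else a + psize p + psize q, 0, tp1)" "enc L s' tp1"
    using Cond.IH(1)[of a "a + psize p" "a + psize p + psize q" s tp] Cond.prems r by auto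
  have s': "s' v = {}" if "v \<in> loop_vars q \<union> loop_vars r" for v
    using run_loop_var[of p v s L] Cond.prems loop_vars_ge r that by auto
  show ?case
  proof (cases b)
    case True
    obtain tp2 where "reaches M (a + psize p, 0, tp1) (cost L q) (if fst (run L q s') then y else n, 0, tp2)"
       "enc L (snd (run L q s')) tp2"
      using Cond.IH(2)[of "a + psize p" y n s' tp1] Cond.prems tp1(2) s' by auto
    note tp2 = this
    show ?thesis using reaches_trans[OF _ tp2(1), of "(a, 0, tp)" "cost L p" "cost L (Cond p q r)"] tp1(1)
        tp2(2) True r by (intro exI[of _ tp2]) auto
  next
    case False
    obtain tp2 where "reaches M (a + psize p + psize q, 0, tp1) (cost L r) (if fst (run L r s') then y else n, 0, tp2)"
       "enc L (snd (run L r s')) tp2"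
      using Cond.IH(3)[of "a + psize p + psize q" y n s' tp1] Cond.prems tp1(2) s' by (auto simp: add.assoc)
    note tp2 = this
    show ?thesis using reaches_trans[OF _ tp2(1), of "(a, 0, tp)" "cost L p" "cost L (Cond p q r)"] tp1(1)
        tp2(2) False r by (intro exI[of _ tp2]) auto
  qed
next
  case (Loop x p)
  let ?e = "a + 1 + psize p"
  have rows: "\<delta> ?e = (\<lambda>c. if bit c x then (?e + 1, unset_bit x c, Right) else (?e, c, Right))"
     "\<delta> (?e + 1) = (\<lambda>c. if c = 0 then (?e + 3, c, Left) else (?e + 2, set_bit x c, Left))"
     "\<delta> (?e + 2) = rewind (?e + 2) (a + 1)" "\<delta> (?e + 3) = rewind (?e + 3) y"
     "\<delta> (?e + 4) = (\<lambda>c. if bit c x then (?e + 5, unset_bit x c, Left) else (?e + 4, c, Right))"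
     "\<delta> (?e + 5) = rewind (?e + 5) n"
     and row0: "\<delta> a = (\<lambda>c. (a + 1, set_bit x c, Stay))"
     and code: "code_at \<delta> (a + 1) (compile p (a + 1) ?e (?e + 4))"
    using Loop.prems(2) by (simp_all add: Let_def numeral_eq_Suc fun_eq_iff)
  have x: "30 \<le> x" "wf_prog p" using Loop.prems(1) by auto
  define tp1 where "tp1 = tp(0 := set_bit x (tp 0))"
  have e1: "enc L (s(x := {0})) tp1"
    using enc_set_bit[OF Loop.prems(4), of 0 x] Loop.prems(5,6) x unfolding tp1_def by simp
  have 1: "reaches M (a, 0, tp) 1 (a + 1, 0, tp1)" unfolding M
    by (rule reaches_step) (use Loop.prems(3) row0 in \<open>auto simp: tm_step_def move_def tp1_def\<close>)
  have body: "\<exists>tp'. reaches M (a + 1, 0, tp) (cost L p) (if fst (run L p s) then ?e else ?e + 4, 0, tp') \<and>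
        enc L (snd (run L p s)) tp'" if "enc L s tp" "\<forall>v\<in>loop_vars p. s v = {}" for s tp
    by (rule Loop.IH[OF x(2) code _ that(1) Loop.prems(5) that(2)]) (use Loop.prems(3) in simp)
  have b': "3 \<le> a + 1" "3 \<le> ?e" using Loop.prems(3) by auto
  obtain tp2 where "reaches M (a + 1, 0, tp1) ((L - 0) * (cost L p + (2 * L + 6)))
      (if fst (loop x (run L p) [0..<L] s) then y else n, 0, tp2)"
      "enc L (snd (loop x (run L p) [0..<L] s)) tp2"
    using loop_reaches[OF body M b' Loop.prems(1) rows, of 0 s tp1] e1 b' Loop.prems(5,6)
    by simp blast
  then show ?case
    using reaches_trans[OF 1, of "L * (cost L p + (2 * L + 6))" _ "cost L (Loop x p)"]
    by (intro exI[of _ tp2]) auto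
qed

section \<open>From compiled code to a polynomial-time machine\<close>

lemma set_bit_less: "j < m \<Longrightarrow> c < 2 ^ m \<Longrightarrow> set_bit j c < (2::nat) ^ m"
  by (metis not_less take_bit_nat_eq_self_iff take_bit_set_bit_eq)

lemma unset_bit_less: "j < m \<Longrightarrow> c < 2 ^ m \<Longrightarrow> unset_bit j c < (2::nat) ^ m"
  by (metis not_less take_bit_nat_eq_self_iff take_bit_unset_bit_eq)

lemma psize_pos: "psize p > 0"
  by (induction p) auto

lemma compile_range:
  assumes "wf_prog p" "r \<in> set (compile p a y n)" "c < 2 ^ 60" "a + psize p \<le> Q" "y < Q" "n < Q"
  shows "case r c of (q', b, d) \<Rightarrow> q' < Q \<and> b < 2 ^ 60"
  using assms
proof (induction p arbitrary: r a y n)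
  case (Cond p q r')
  consider "r \<in> set (compile p a (a + psize p) (a + psize p + psize q))"
    | "r \<in> set (compile q (a + psize p) y n)" | "r \<in> set (compile r' (a + psize p + psize q) y n)"
    using Cond.prems(2) by auto
  then show ?case
  proof cases
    case 1
    \<comment> \<open>The exits of \<open>p\<close> are the start addresses of the other two blocks.
      They are states below \<open>Q\<close> because no block is empty.\<close>
    then show ?thesis by (rule Cond.IH(1)[rotated]) (use Cond.prems psize_pos[of q] psize_pos[of r'] in auto)
  next
    case 2
    then show ?thesis by (rule Cond.IH(2)[rotated]) (use Cond.prems in auto)
  next
    case 3
    then show ?thesis by (rule Cond.IH(3)[rotated]) (use Cond.prems in auto)
  qed
next
  case (Loop x p)
  consider "r \<in> set (compile p (a + 1) (a + 1 + psize p) (a + 1 + psize p + 4))"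
    | "r \<notin> set (compile p (a + 1) (a + 1 + psize p) (a + 1 + psize p + 4))" by blast
  then show ?case
  proof cases
    case 1
    then show ?thesis using Loop.IH[OF _ 1] Loop.prems by auto
  next
    case 2
    then show ?thesis using Loop.prems set_bit_less[of x 60 c] unset_bit_less[of x 60 c]
      by (auto simp: Let_def rewind_def split: if_splits)
  qed
next
  case (PIncl j x)
  then show ?case using set_bit_less[of j 60 c] by (auto simp: rewind_def split: if_splits)
next
  case (PExcl j x)
  then show ?case using unset_bit_less[of j 60 c] by (auto simp: rewind_def split: if_splits)
qed (auto simp: rewind_def split: if_splits)

text \<open>The program is fixed, so the degree may depend on it. A loop raises the exponent by 2:
  raising it by 1 makes the power dominate the linear overhead of an iteration, with
  \<open>2 * L + 6 \<le> 8 * L\<close> as origin of the 8, and the number of iterations contributes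
  another factor \<open>L\<close>.\<close>

lemma cost_poly: "\<exists>C e. \<forall>L\<ge>1. cost L p \<le> C * L ^ e"
proof (induction p)
  case (Ret b)
  show ?case by (rule exI[of _ 1], rule exI[of _ 0]) simp
next
  case (Cond p q r)
  obtain C1 e1 C2 e2 C3 e3 where *: "\<forall>L\<ge>1. cost L p \<le> C1 * L ^ e1" "\<forall>L\<ge>1. cost L q \<le> C2 * L ^ e2"
    "\<forall>L\<ge>1. cost L r \<le> C3 * L ^ e3" using Cond.IH by blast
  have "cost L (Cond p q r) \<le> (C1 + C2 + C3) * L ^ (e1 + e2 + e3)" if L: "L \<ge> 1" for L
  proof -
    have "C1 * L ^ e1 \<le> C1 * L ^ (e1 + e2 + e3)" "C2 * L ^ e2 \<le> C2 * L ^ (e1 + e2 + e3)"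
      "C3 * L ^ e3 \<le> C3 * L ^ (e1 + e2 + e3)" using L by (auto intro!: mult_left_mono power_increasing)
    moreover have "cost L p \<le> C1 * L ^ e1" "cost L q \<le> C2 * L ^ e2" "cost L r \<le> C3 * L ^ e3"
      using * L by auto
    ultimately show ?thesis unfolding cost.simps distrib_right by linarith
  qed
  then show ?case by blast
next
  case (Loop x p)
  then obtain C e where *: "\<forall>L\<ge>1. cost L p \<le> C * L ^ e" by blast
  have "cost L (Loop x p) \<le> (C + 9) * L ^ (e + 2)" if L: "L \<ge> 1" for L
  proof -
    have "cost L p + (2 * L + 6) \<le> C * L ^ (e + 1) + 8 * L ^ (e + 1)"
    proof -
      have "cost L p \<le> C * L ^ e" using * L by simp
      also have "\<dots> \<le> C * L ^ (e + 1)" using L by (intro mult_left_mono power_increasing) auto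
      finally have "cost L p \<le> C * L ^ (e + 1)" .
      moreover have "L ^ 1 \<le> L ^ (e + 1)" using L by (intro power_increasing) auto
      then have "L \<le> L ^ (e + 1)" by simp
      ultimately show ?thesis using L by linarith
    qed
    then have "L * (cost L p + (2 * L + 6)) \<le> L * (C * L ^ (e + 1) + 8 * L ^ (e + 1))" by simp
    also have "\<dots> = (C + 8) * L ^ (e + 2)" by (simp add: algebra_simps)
    finally show ?thesis using one_le_power[OF L, of "e + 2"] unfolding cost.simps distrib_right by linarith
  qed
  then show ?case by blast
qed (rule exI[of _ 6], rule exI[of _ 1], simp)+

lemma halting_stays: "fst c = 1 \<or> fst c = 2 \<Longrightarrow> (tm_step M ^^ k) c = c"
  by (induction k) (auto simp: tm_step_def split: prod.splits)

definition store_of :: "nat list \<Rightarrow> store" where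
  "store_of w = (\<lambda>j. {p. p < length w \<and> bit (w ! p) j})"

lemma bit_symbol:
  assumes "a \<in> {1, 2, 3::nat}"
  shows "bit a 0 \<longleftrightarrow> a \<noteq> 2" "bit a 1 \<longleftrightarrow> a \<noteq> 1" "bit a j \<Longrightarrow> j < 2"
proof -
  show "bit a 0 \<longleftrightarrow> a \<noteq> 2" "bit a 1 \<longleftrightarrow> a \<noteq> 1" using assms by (auto simp: bit_nat_def)
  have "a < 2 ^ 2" using assms by auto
  then show "bit a j \<Longrightarrow> j < 2"
    by (metis bit_take_bit_iff take_bit_nat_eq_self_iff)
qed

lemma enc_store_of:
  assumes "set w \<subseteq> {1, 2, 3}"
  shows "enc (length w) (store_of w) (\<lambda>i. if 0 \<le> i \<and> i < int (length w) then w ! nat i else 0)"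
proof -
  have "w ! p \<in> {1, 2, 3}" if "p < length w" for p using assms that by (metis nth_mem subsetD)
  then have "bit (w ! p) 0 \<or> bit (w ! p) 1" if "p < length w" for p
    using that bit_symbol(1,2)[of "w ! p"] by auto
  then show ?thesis unfolding enc_def store_of_def by auto
qed

text \<open>State 0 only jumps to the code, which begins at 3, behind the halting states that serve
  as its exits. The default \<open>(0, 0, Stay)\<close> keeps the function within the bounds of
  \<open>tm_wf\<close>.\<close>

definition machine :: "prog \<Rightarrow> tm" where
  "machine p = (3 + psize p, 2 ^ 60, \<lambda>q c. if q = 0 then (3, c, Stay)
     else if 3 \<le> q \<and> q < 3 + psize p then (compile p 3 1 2 ! (q - 3)) c else (0, 0, Stay))"

lemma tm_wf_machine:
  assumes "wf_prog p"
  shows "tm_wf (machine p)"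
proof -
  note pos = psize_pos[of p]
  have "case (compile p 3 1 2 ! (q - 3)) c of (q', b, d) \<Rightarrow> q' < 3 + psize p \<and> b < 2 ^ 60"
    if "3 \<le> q" "q < 3 + psize p" "c < 2 ^ 60" for q c
    by (rule compile_range[OF assms, of _ 3 1 2]) (use that pos in auto)
  then show ?thesis using pos unfolding tm_wf_def machine_def by auto
qed

text \<open>The run is inspected after an exact number of steps, whereas \<open>reaches\<close> only
  gives an upper bound; the difference is bridged by halting configurations being fixed points.
  Replacing \<open>C\<close> by \<open>C + 1\<close> pays for the jump out of state 0.\<close>

theorem machine_decides:
  assumes "wf_prog P"
  shows "\<exists>C e. \<forall>w. w \<noteq> [] \<and> set w \<subseteq> {1, 2, 3} \<longrightarrow>
     fst (tm_run (machine P) (C * length w ^ e + C) w) = (if fst (run (length w) P (store_of w)) then 1 else 2)"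
proof -
  obtain C e where C: "\<forall>L\<ge>1. cost L P \<le> C * L ^ e" using cost_poly by blast
  have "fst (tm_run (machine P) ((C + 1) * length w ^ e + (C + 1)) w) =
      (if fst (run (length w) P (store_of w)) then 1 else 2)"
    if w: "w \<noteq> []" "set w \<subseteq> {1, 2, 3}" for w
  proof -
    let ?T = "(C + 1) * length w ^ e + (C + 1)" and ?q = "if fst (run (length w) P (store_of w)) then 1 else 2 :: nat"
    have L: "length w \<ge> 1" using w(1) by (cases w) auto
    obtain Q S \<delta> where M: "machine P = (Q, S, \<delta>)" "\<delta> 0 = (\<lambda>c. (3, c, Stay))"
      and code: "code_at \<delta> 3 (compile P 3 1 2)"
      unfolding machine_def code_at_def by auto
    obtain c where c: "init_config w = (0, 0, c)" "enc (length w) (store_of w) c"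
      using enc_store_of[OF w(2)] unfolding init_config_def by blast
    have v: "\<forall>v\<in>loop_vars P. store_of w v = {}"
    proof
      fix v assume "v \<in> loop_vars P"
      then have "v \<ge> 30" using loop_vars_ge[OF assms] by simp
      moreover have "v < 2" if "p < length w" "bit (w ! p) v" for p
        using bit_symbol(3)[OF _ that(2)] w(2) nth_mem[OF that(1)] by blast
      ultimately show "store_of w v = {}" unfolding store_of_def by force
    qed
    have 1: "reaches (machine P) (init_config w) 1 (3, 0, c)"
      by (rule reaches_step) (simp_all add: c M tm_step_def move_def)
    obtain tp where 2: "reaches (machine P) (3, 0, c) (cost (length w) P) (?q, 0, tp)"
      using compile_correct[OF assms code _ c(2) L v M(1)] by auto
    have "1 + cost (length w) P \<le> ?T" using C[rule_format, OF L] by (simp add: algebra_simps)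
    from reaches_trans[OF 1 2 this] obtain t where
      t: "t \<le> ?T" "(tm_step (machine P) ^^ t) (init_config w) = (?q, 0, tp)"
      unfolding reaches_def by blast
    have "(tm_step (machine P) ^^ ?T) (init_config w) =
        (tm_step (machine P) ^^ (?T - t)) ((tm_step (machine P) ^^ t) (init_config w))"
      using t(1) by (metis comp_apply funpow_add le_add_diff_inverse2)
    also have "\<dots> = (?q, 0, tp)" unfolding t(2) by (rule halting_stays) auto
    finally show ?thesis unfolding tm_run_def by simp
  qed
  then show ?thesis by blast
qed

section \<open>First-order formulas and commands\<close>

text \<open>A second layer separates tests from assignments: a formula leaves the store unchanged
  and a command never fails, so both have a simpler semantics than \<open>prog\<close>.\<close>

datatype fm = Meet nat nat | Prec nat nat | Neg fm | Conj fm fm | All nat fm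

primrec sem :: "nat \<Rightarrow> fm \<Rightarrow> store \<Rightarrow> bool" where
  "sem L (Meet x y) s \<longleftrightarrow> s x \<inter> s y \<noteq> {}"
| "sem L (Prec x y) s \<longleftrightarrow> (\<exists>p\<in>s x. \<exists>q\<in>s y. p < q)"
| "sem L (Neg \<phi>) s \<longleftrightarrow> \<not> sem L \<phi> s"
| "sem L (Conj \<phi> \<psi>) s \<longleftrightarrow> sem L \<phi> s \<and> sem L \<psi> s"
| "sem L (All x \<phi>) s \<longleftrightarrow> (\<forall>k<L. sem L \<phi> (s(x := {k})))"

datatype cmd = Incl nat nat | Excl nat nat | Seq cmd cmd | Ite fm cmd cmd | For nat cmd

primrec exec :: "nat \<Rightarrow> cmd \<Rightarrow> store \<Rightarrow> store" where
  "exec L (Incl j x) s = s(j := s j \<union> s x)"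
| "exec L (Excl j x) s = s(j := s j - s x)"
| "exec L (Seq c d) s = exec L d (exec L c s)"
| "exec L (Ite \<phi> c d) s = (if sem L \<phi> s then exec L c s else exec L d s)"
| "exec L (For x c) s = (fold (\<lambda>k s. exec L c (s(x := {k}))) [0..<L] s)(x := {})"

primrec fm_prog :: "fm \<Rightarrow> prog" where
  "fm_prog (Meet x y) = TMeet x y"
| "fm_prog (Prec x y) = TPrec x y"
| "fm_prog (Neg \<phi>) = Cond (fm_prog \<phi>) (Ret False) (Ret True)"
| "fm_prog (Conj \<phi> \<psi>) = Cond (fm_prog \<phi>) (fm_prog \<psi>) (Ret False)"
| "fm_prog (All x \<phi>) = Loop x (fm_prog \<phi>)"

primrec cmd_prog :: "cmd \<Rightarrow> prog" where
  "cmd_prog (Incl j x) = PIncl j x"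
| "cmd_prog (Excl j x) = PExcl j x"
| "cmd_prog (Seq c d) = Cond (cmd_prog c) (cmd_prog d) (Ret True)"
| "cmd_prog (Ite \<phi> c d) = Cond (fm_prog \<phi>) (cmd_prog c) (cmd_prog d)"
| "cmd_prog (For x c) = Loop x (cmd_prog c)"

lemma upd_empty: "\<forall>v\<in>A. s v = {} \<Longrightarrow> x \<notin> A \<Longrightarrow> \<forall>v\<in>A. (s(x := B)) v = {}"
  by auto

text \<open>A quantifier becomes a loop that stops at the first counterexample. Its variable is
  empty on entry, so clearing it on exit restores the original store.\<close>

lemma run_fm:
  assumes "wf_prog (fm_prog \<phi>)" "\<forall>v\<in>loop_vars (fm_prog \<phi>). s v = {}"
  shows "run L (fm_prog \<phi>) s = (sem L \<phi> s, s)"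
  using assms
proof (induction \<phi> arbitrary: s)
  case (All x \<phi>)
  let ?p = "fm_prog \<phi>"
  have IH: "run L ?p (s(x := {k})) = (sem L \<phi> (s(x := {k})), s(x := {k}))"
    if "\<forall>v\<in>loop_vars ?p. s v = {}" for s k
    using All.IH[OF _ upd_empty[OF that], of x] All.prems(1) by (simp add: fun_upd_def)
  have "loop x (run L ?p) ks s = ((\<forall>k\<in>set ks. sem L \<phi> (s(x := {k}))), s(x := {}))"
    if "\<forall>v\<in>loop_vars ?p. s v = {}" for ks s
    using that
  proof (induction ks arbitrary: s)
    case (Cons k ks)
    have "\<forall>v\<in>loop_vars ?p. (s(x := {k})) v = {}"
      by (rule upd_empty[OF Cons.prems]) (use All.prems(1) in simp)
    from Cons.IH[of "s(x := {k})", OF this] show ?case using IH[OF Cons.prems, of k]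
      by (auto simp: fun_upd_def cong: if_cong)
  qed simp
  from this[of s "[0..<L]"] show ?case using All.prems(2) by (auto simp: fun_upd_idem)
qed auto

lemma run_cmd:
  assumes "wf_prog (cmd_prog c)" "\<forall>v\<in>loop_vars (cmd_prog c). s v = {}"
  shows "run L (cmd_prog c) s = (True, exec L c s)"
  using assms
proof (induction c arbitrary: s)
  case (Seq c d)
  have 1: "run L (cmd_prog c) s = (True, exec L c s)" using Seq by auto
  have "\<forall>v\<in>loop_vars (cmd_prog d). exec L c s v = {}"
    using run_loop_var[of "cmd_prog c" _ s L] 1 Seq.prems loop_vars_ge by auto
  then show ?case using Seq.IH(2)[of "exec L c s"] 1 Seq.prems by simp
next
  case (Ite \<phi> c d)
  then show ?case using run_fm[of \<phi> s L] by auto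
next
  case (For x c)
  let ?p = "cmd_prog c"
  have "loop x (run L ?p) ks s = (True, (fold (\<lambda>k s. exec L c (s(x := {k}))) ks s)(x := {}))"
    if "\<forall>v\<in>loop_vars ?p. s v = {}" for ks s
    using that
  proof (induction ks arbitrary: s)
    case (Cons k ks)
    have v: "\<forall>v\<in>loop_vars ?p. (s(x := {k})) v = {}"
      by (rule upd_empty[OF Cons.prems]) (use For.prems(1) in simp)
    have 1: "run L ?p (s(x := {k})) = (True, exec L c (s(x := {k})))"
      using For.IH[OF _ v] For.prems(1) by (simp add: fun_upd_def)
    have "\<forall>v\<in>loop_vars ?p. exec L c (s(x := {k})) v = {}"
    proof
      fix v' assume "v' \<in> loop_vars ?p"
      then show "exec L c (s(x := {k})) v' = {}"
        using run_loop_var[of ?p v' "s(x := {k})" L] v 1 For.prems(1) loop_vars_ge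
        by (metis snd_conv wf_prog.simps(7) cmd_prog.simps(5))
    qed
    from Cons.IH[of "exec L c (s(x := {k}))", OF this] show ?case using 1 by (simp add: fun_upd_def)
  qed simp
  from this[of s "[0..<L]"] show ?case using For.prems(2) by (simp add: fun_upd_def)
qed auto

theorem cmd_decides:
  assumes "wf_prog (cmd_prog c)" "wf_prog (fm_prog \<phi>)"
  shows "\<exists>M C e. tm_wf M \<and> (\<forall>w. w \<noteq> [] \<and> set w \<subseteq> {1, 2, 3} \<longrightarrow>
     fst (tm_run M (C * length w ^ e + C) w) =
       (if sem (length w) \<phi> (exec (length w) c (store_of w)) then 1 else 2))"
proof -
  let ?P = "Cond (cmd_prog c) (fm_prog \<phi>) (Ret False)"
  have wf: "wf_prog ?P" using assms by simp
  have *: "fst (run (length w) ?P (store_of w)) = sem (length w) \<phi> (exec (length w) c (store_of w))"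
    if w: "set w \<subseteq> {1, 2, 3}" for w
  proof -
    have v: "store_of w v = {}" if "v \<ge> 30" for v
    proof -
      have "v < 2" if "p < length w" "bit (w ! p) v" for p
        using bit_symbol(3)[OF _ that(2)] w nth_mem[OF that(1)] by blast
      then show ?thesis using that unfolding store_of_def by force
    qed
    have 1: "run (length w) (cmd_prog c) (store_of w) = (True, exec (length w) c (store_of w))"
      by (rule run_cmd) (use assms v loop_vars_ge in auto)
    have 2: "\<forall>v\<in>loop_vars (fm_prog \<phi>). exec (length w) c (store_of w) v = {}"
      using run_loop_var[OF assms(1), of _ "store_of w" "length w"] 1 v loop_vars_ge[OF assms(2)] by auto
    show ?thesis using 1 run_fm[OF assms(2) 2] by simp
  qed
  obtain C e where "\<forall>w. w \<noteq> [] \<and> set w \<subseteq> {1, 2, 3} \<longrightarrow>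
     fst (tm_run (machine ?P) (C * length w ^ e + C) w) = (if fst (run (length w) ?P (store_of w)) then 1 else 2)"
    using machine_decides[OF wf] by blast
  then show ?thesis using tm_wf_machine[OF wf] * 
    by (intro exI[of _ "machine ?P"] exI[of _ C] exI[of _ e]) auto
qed

section \<open>Slots of the input word\<close>

declare bits.simps [simp del]

lemma bits_0 [simp]: "bits 0 = []"
  by (simp add: bits.simps)

lemma bits_pos: "m > 0 \<Longrightarrow> bits m = (m mod 2 + 1) # bits (m div 2)"
  by (subst bits.simps) simp

lemma set_bits: "set (bits m) \<subseteq> {1, 2}"
proof (induction m rule: less_induct)
  case (less m)
  then show ?case by (cases "m = 0") (auto simp: bits_pos)
qed

text \<open>The symbol 2 stands for the bit 1. Hence the positions of the symbol 2 in a slot already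
  form a binary counter with the value of the number.\<close>

lemma bits_value: "(\<Sum>r | r < length (bits m) \<and> bits m ! r = 2. 2 ^ r) = m"
proof (induction m rule: less_induct)
  case (less m)
  show ?case
  proof (cases "m = 0")
    case False
    let ?A = "{r. r < length (bits (m div 2)) \<and> bits (m div 2) ! r = 2}"
    have split: "{r. r < length (bits m) \<and> bits m ! r = 2} = (if odd m then {0} else {}) \<union> Suc ` ?A"
    proof -
      have "r < length (bits m) \<and> bits m ! r = 2 \<longleftrightarrow>
          r \<in> (if odd m then {0} else {}) \<union> Suc ` ?A" for r
        using False by (cases r) (auto simp: bits_pos odd_iff_mod_2_eq_one)
      then show ?thesis by blast
    qed
    have "(\<Sum>r \<in> Suc ` ?A. 2 ^ r) = 2 * (\<Sum>r \<in> ?A. (2::nat) ^ r)"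
      by (simp add: sum.reindex sum_distrib_left)
    also have "(\<Sum>r \<in> ?A. (2::nat) ^ r) = m div 2" using less[of "m div 2"] False by simp
    finally have *: "(\<Sum>r \<in> Suc ` ?A. 2 ^ r) = 2 * (m div 2)" .
    have "(\<Sum>r | r < length (bits m) \<and> bits m ! r = 2. 2 ^ r) =
        (\<Sum>r\<in>(if odd m then {0} else {}). 2 ^ r) + (\<Sum>r \<in> Suc ` ?A. (2::nat) ^ r)"
      unfolding split by (rule sum.union_disjoint) auto
    also have "\<dots> = m" unfolding * by (auto simp: odd_two_times_div_two_succ)
    finally show ?thesis .
  qed simp
qed

text \<open>A counter is a set of positions, namely those of the 1-bits of a binary number whose least
  significant bit is at position a. Decrementing it flips the lowest 1-bit and all bits below.\<close>

definition val :: "nat \<Rightarrow> nat set \<Rightarrow> nat" where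
  "val a C = (\<Sum>p\<in>C. 2 ^ (p - a))"

definition dec :: "nat \<Rightarrow> nat \<Rightarrow> nat set \<Rightarrow> nat set" where
  "dec a b C = {p. a \<le> p \<and> p < b \<and> (p \<in> C \<longleftrightarrow> (\<exists>r\<in>C. r < p))}"

text \<open>With \<open>m\<close> the lowest 1-bit, the set loses the power for \<open>m\<close> and
  gains all lower powers, whose sum is one less.\<close>

lemma val_dec:
  assumes "C \<subseteq> {a..<b}" "C \<noteq> {}"
  shows "Suc (val a (dec a b C)) = val a C"
proof -
  have fin: "finite C" using assms(1) finite_subset by blast
  define m where "m = Min C"
  have m: "m \<in> C" "\<And>p. p \<in> C \<Longrightarrow> m \<le> p" using fin assms(2) by (auto simp: m_def)
  have am: "a \<le> m" "m < b" using m(1) assms(1) by auto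
  have dec: "dec a b C = {a..<m} \<union> (C - {m})"
  proof -
    have "(\<exists>r\<in>C. r < p) \<longleftrightarrow> m < p" for p using m by (meson le_less_trans)
    then show ?thesis using assms(1) am m(1) m(2) unfolding dec_def
      by (auto simp: subset_iff nat_less_le dest: m(2))
  qed
  have dis: "{a..<m} \<inter> (C - {m}) = {}" using m(2) by force
  have geo: "Suc (\<Sum>p\<in>{a..<m}. 2 ^ (p - a)) = 2 ^ (m - a)"
  proof -
    have "(\<Sum>p\<in>{a..<m}. 2 ^ (p - a)) = (\<Sum>r<m - a. (2::nat) ^ r)"
      by (rule sum.reindex_bij_witness[of _ "\<lambda>r. r + a" "\<lambda>p. p - a"]) auto
    moreover have "Suc (\<Sum>r<n. (2::nat) ^ r) = 2 ^ n" for n by (induction n) auto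
    ultimately show ?thesis by simp
  qed
  have "val a (dec a b C) = (\<Sum>p\<in>{a..<m}. 2 ^ (p - a)) + val a (C - {m})"
    unfolding val_def dec using fin by (intro sum.union_disjoint dis) auto
  moreover have "val a C = 2 ^ (m - a) + val a (C - {m})"
    unfolding val_def using fin m(1) by (simp add: sum.remove)
  ultimately show ?thesis using geo by simp
qed

lemma val_eq_0: "finite C \<Longrightarrow> val a C = 0 \<longleftrightarrow> C = {}"
  by (auto simp: val_def)

locale number_word =
  fixes ns :: "nat list"
begin

definition w where "w = concat (map enc_nat ns)"
text \<open>The i-th number occupies the positions from start i up to its terminator at pos i. Programs
  refer to a number by the position of its terminator.\<close>

definition L where "L = length w"
definition start where "start i = length (concat (map enc_nat (take i ns)))"
definition pos where "pos i = start i + length (bits (ns ! i))"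

lemma start_0 [simp]: "start 0 = 0"
  by (simp add: start_def)

lemma start_Suc: "i < length ns \<Longrightarrow> start (Suc i) = Suc (pos i)"
  by (simp add: start_def pos_def take_Suc_conv_app_nth enc_nat_def)

lemma start_length: "start (length ns) = L"
  by (simp add: start_def L_def w_def)

lemma start_mono: "i \<le> j \<Longrightarrow> j \<le> length ns \<Longrightarrow> start i \<le> start j"
  by (induction j rule: dec_induct) (auto simp: start_Suc pos_def)

lemma pos_less_L: "i < length ns \<Longrightarrow> pos i < L"
  using start_mono[of "Suc i" "length ns"] by (simp add: start_Suc start_length)

lemma pos_less_start: "i < j \<Longrightarrow> j \<le> length ns \<Longrightarrow> pos i < start j"
  using start_mono[of "Suc i" j] by (simp add: start_Suc)

lemma pos_less: "i < j \<Longrightarrow> j < length ns \<Longrightarrow> pos i < pos j"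
  using pos_less_start[of i j] by (simp add: pos_def)

lemma pos_inj: "i < length ns \<Longrightarrow> j < length ns \<Longrightarrow> pos i = pos j \<longleftrightarrow> i = j"
  by (metis linorder_neqE_nat nat_neq_iff pos_less)

lemma pos_le_imp: "i < length ns \<Longrightarrow> j < length ns \<Longrightarrow> pos i \<le> pos j \<Longrightarrow> i \<le> j"
  by (metis leD linorder_le_less_linear pos_less)

lemma w_nth:
  assumes "i < length ns" "r \<le> length (bits (ns ! i))"
  shows "w ! (start i + r) = (bits (ns ! i) @ [3]) ! r"
proof -
  have "map enc_nat ns = map enc_nat (take i ns @ ns ! i # drop (Suc i) ns)"
    using id_take_nth_drop[OF assms(1)] by simp
  then have "w = concat (map enc_nat (take i ns)) @ enc_nat (ns ! i) @ concat (map enc_nat (drop (Suc i) ns))"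
    unfolding w_def by simp
  then have "w ! (start i + r) = (enc_nat (ns ! i) @ concat (map enc_nat (drop (Suc i) ns))) ! r"
    unfolding start_def by (simp only: nth_append_length_plus)
  then show ?thesis using assms(2) unfolding enc_nat_def by (simp add: nth_append)
qed

lemma w_pos: "i < length ns \<Longrightarrow> w ! pos i = 3"
  using w_nth[of i "length (bits (ns ! i))"] unfolding pos_def by (simp add: nth_append)

lemma slot_exists:
  assumes "p < L"
  shows "\<exists>i<length ns. start i \<le> p \<and> p \<le> pos i"
proof -
  have "p < start m \<Longrightarrow> m \<le> length ns \<Longrightarrow> \<exists>i<m. start i \<le> p \<and> p \<le> pos i" for m
  proof (induction m)
    case (Suc m)
    show ?case
    proof (cases "p < start m")
      case True
      then show ?thesis using Suc by (meson Suc_leD less_Suc_eq)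
    next
      case False
      then show ?thesis using Suc.prems by (auto simp: start_Suc intro!: exI[of _ m])
    qed
  qed simp
  then show ?thesis using assms start_length by auto
qed

lemma w_bit:
  assumes "i < length ns" "start i \<le> p" "p < pos i"
  shows "w ! p \<in> {1, 2}" "w ! p = 2 \<longleftrightarrow> bits (ns ! i) ! (p - start i) = 2"
proof -
  have r: "p - start i < length (bits (ns ! i))" using assms by (simp add: pos_def)
  then have "w ! p = bits (ns ! i) ! (p - start i)"
    using w_nth[of i "p - start i"] assms by (simp add: nth_append)
  then show "w ! p \<in> {1, 2}" "w ! p = 2 \<longleftrightarrow> bits (ns ! i) ! (p - start i) = 2"
    using set_bits nth_mem[OF r] by auto
qed

lemma set_w: "set w \<subseteq> {1, 2, 3}"
  by (auto simp: w_def enc_nat_def dest: subsetD[OF set_bits])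

lemma w_eq_3: "p < L \<and> w ! p = 3 \<longleftrightarrow> (\<exists>i<length ns. p = pos i)"
proof
  assume p: "p < L \<and> w ! p = 3"
  then obtain i where i: "i < length ns" "start i \<le> p" "p \<le> pos i" using slot_exists by blast
  then have "p = pos i" using w_bit(1)[OF i(1,2)] p by fastforce
  then show "\<exists>i<length ns. p = pos i" using i by blast
qed (use pos_less_L w_pos in blast)

section \<open>Reading the input tracks\<close>

definition inp :: "store \<Rightarrow> bool" where
  "inp s \<longleftrightarrow> s 0 = store_of w 0 \<and> s 1 = store_of w 1"

lemma w_symbol: "p < L \<Longrightarrow> w ! p \<in> {1, 2, 3}"
  using set_w unfolding L_def by (meson nth_mem subsetD)

lemma store_of_w:
  "p \<in> store_of w 0 \<longleftrightarrow> p < L \<and> w ! p \<noteq> 2" "p \<in> store_of w 1 \<longleftrightarrow> p < L \<and> w ! p \<noteq> 1"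
  using bit_symbol(1,2)[OF w_symbol, of p] unfolding store_of_def L_def mem_Collect_eq by blast+

text \<open>The symbol 3 is binary 11, so the terminators are the positions on both input tracks; in
  the same way the symbol 2 is the one that lies on track 1 alone.\<close>

lemma inp_term: "inp s \<Longrightarrow> p \<in> s 0 \<and> p \<in> s 1 \<longleftrightarrow> (\<exists>i<length ns. p = pos i)"
  unfolding inp_def w_eq_3[symmetric] using store_of_w[of p] w_symbol[of p] by fastforce

lemma inp_one: "inp s \<Longrightarrow> p \<in> s 1 \<and> p \<notin> s 0 \<longleftrightarrow> p < L \<and> w ! p = 2"
  unfolding inp_def using store_of_w[of p] w_symbol[of p] by fastforce

definition nxt :: "nat \<Rightarrow> nat \<Rightarrow> bool" where
  "nxt p q \<longleftrightarrow> p < q \<and> (\<exists>i<length ns. q = pos i) \<and> (\<forall>i<length ns. \<not> (p < pos i \<and> pos i < q))"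

text \<open>The \<open>Suc\<close> admits one position in front of the slot: the preceding
  terminator also has \<open>pos i\<close> as its next terminator. Programs that describe the digits
  of a slot by \<open>nxt\<close> must exclude it separately.\<close>

lemma nxt_pos: "i < length ns \<Longrightarrow> nxt p (pos i) \<longleftrightarrow> start i \<le> Suc p \<and> p < pos i"
proof -
  assume i: "i < length ns"
  show ?thesis
  proof
    assume n: "nxt p (pos i)"
    show "start i \<le> Suc p \<and> p < pos i"
    proof (cases i)
      case (Suc j)
      then have "\<not> p < pos j" using n i pos_less[of j i] unfolding nxt_def by auto
      then show ?thesis using n Suc i start_Suc[of j] unfolding nxt_def by auto
    qed (use n in \<open>auto simp: nxt_def\<close>)
  next
    assume p: "start i \<le> Suc p \<and> p < pos i"
    have "\<not> (p < pos j \<and> pos j < pos i)" if "j < length ns" for j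
    proof
      assume j: "p < pos j \<and> pos j < pos i"
      then have "j < i" using i that by (metis leD linorder_le_less_linear nat_less_le pos_less)
      then have "pos j < start i" using pos_less_start i by simp
      then show False using p j by simp
    qed
    then show "nxt p (pos i)" using p i unfolding nxt_def by blast
  qed
qed

lemma nxt_from_pos: "i < length ns \<Longrightarrow> nxt (pos i) q \<longleftrightarrow> Suc i < length ns \<and> q = pos (Suc i)"
proof -
  assume i: "i < length ns"
  show ?thesis
  proof
    assume n: "nxt (pos i) q"
    then obtain j where j: "j < length ns" "q = pos j" "pos i < pos j" unfolding nxt_def by blast
    then have ij: "i < j" using i pos_le_imp[of i j] by (metis less_imp_le nat_less_le)
    then have "\<not> Suc i < j" using n j i pos_less[of i "Suc i"] pos_less[of "Suc i" j]
      unfolding nxt_def by auto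
    then have "j = Suc i" using ij by simp
    then show "Suc i < length ns \<and> q = pos (Suc i)" using j by simp
  next
    assume "Suc i < length ns \<and> q = pos (Suc i)"
    then show "nxt (pos i) q" using i by (simp add: nxt_pos start_Suc pos_less)
  qed
qed

text \<open>The counter lives on the digit cells of the slot from which it was loaded. It is only
  ever decremented, so this width suffices.\<close>

definition cnt :: "nat \<Rightarrow> nat set \<Rightarrow> nat \<Rightarrow> bool" where
  "cnt i C v \<longleftrightarrow> C \<subseteq> {start i..<pos i} \<and> val (start i) C = v"

lemma cnt_finite: "cnt i C v \<Longrightarrow> finite C"
  unfolding cnt_def using finite_subset by blast

lemma cnt_empty: "cnt i C v \<Longrightarrow> C = {} \<longleftrightarrow> v = 0"
  using val_eq_0[OF cnt_finite] unfolding cnt_def by metis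

lemma cnt_dec:
  assumes "cnt i C v" "v > 0"
  shows "cnt i (dec (start i) (pos i) C) (v - 1)"
  using val_dec[of C "start i" "pos i"] cnt_empty[OF assms(1)] assms unfolding cnt_def
  by (auto simp: dec_def)

lemma cnt_load:
  assumes "i < length ns"
  shows "cnt i {p. p < L \<and> w ! p = 2 \<and> nxt p (pos i)} (ns ! i)"
proof -
  have eq: "{p. p < L \<and> w ! p = 2 \<and> nxt p (pos i)} = {p. start i \<le> p \<and> p < pos i \<and> w ! p = 2}"
  proof -
    \<comment> \<open>The extra position that \<open>nxt_pos\<close> admits is a terminator, hence
      carries the symbol 3 and not 2.\<close>
    have "start i \<le> p" if "start i \<le> Suc p" "p < pos i" "w ! p = 2" for p
    proof (rule ccontr)
      assume "\<not> start i \<le> p"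
      then have s: "start i = Suc p" using that by simp
      then obtain j where j: "i = Suc j" by (cases i) auto
      then have "p = pos j" using start_Suc[of j] assms s by simp
      then show False using w_pos[of j] assms that j by simp
    qed
    then show ?thesis using nxt_pos[OF assms] pos_less_L[OF assms] by auto
  qed
  have "val (start i) {p. start i \<le> p \<and> p < pos i \<and> w ! p = 2} =
      (\<Sum>r | r < length (bits (ns ! i)) \<and> bits (ns ! i) ! r = 2. 2 ^ r)"
    unfolding val_def
    by (rule sum.reindex_bij_witness[of _ "\<lambda>r. r + start i" "\<lambda>p. p - start i"])
      (use w_bit(2)[OF assms] in \<open>auto simp: pos_def\<close>)
  then show ?thesis using bits_value unfolding cnt_def eq by auto
qed

end

section \<open>The program\<close>

primrec fm_names :: "fm \<Rightarrow> nat set" where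
  "fm_names (Meet x y) = {x, y}"
| "fm_names (Prec x y) = {x, y}"
| "fm_names (Neg \<phi>) = fm_names \<phi>"
| "fm_names (Conj \<phi> \<psi>) = fm_names \<phi> \<union> fm_names \<psi>"
| "fm_names (All x \<phi>) = insert x (fm_names \<phi>)"

lemma sem_cong: "\<forall>v\<in>fm_names \<phi>. s v = s' v \<Longrightarrow> sem L \<phi> s \<longleftrightarrow> sem L \<phi> s'"
proof (induction \<phi> arbitrary: s s')
  case (All x \<phi>)
  have "sem L \<phi> (s(x := {k})) = sem L \<phi> (s'(x := {k}))" for k
    by (rule All.IH) (use All.prems in auto)
  then show ?case by simp
next
  case (Conj \<phi> \<psi>)
  then show ?case by (metis UnCI fm_names.simps(4) sem.simps(4))
qed auto

text \<open>\<open>Incl j j\<close> counts as writing nothing, which gives \<open>skip\<close> an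
  empty set.\<close>

primrec cmd_writes :: "cmd \<Rightarrow> nat set" where
  "cmd_writes (Incl j x) = (if j = x then {} else {j})"
| "cmd_writes (Excl j x) = {j}"
| "cmd_writes (Seq c d) = cmd_writes c \<union> cmd_writes d"
| "cmd_writes (Ite \<phi> c d) = cmd_writes c \<union> cmd_writes d"
| "cmd_writes (For x c) = insert x (cmd_writes c)"

lemma exec_For:
  assumes "I 0 s" "\<And>k s. k < L \<Longrightarrow> I k s \<Longrightarrow> I (Suc k) (exec L c (s(x := {k})))"
  shows "\<exists>s'. I L s' \<and> exec L (For x c) s = s'(x := {})"
proof -
  have "m \<le> L \<Longrightarrow> I m (fold (\<lambda>k s. exec L c (s(x := {k}))) [0..<m] s)" for m
    by (induction m) (use assms in auto)
  then show ?thesis by auto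
qed

lemma exec_frame: "v \<notin> cmd_writes c \<Longrightarrow> exec L c s v = s v"
proof (induction c arbitrary: s)
  case (For x c)
  obtain s' where "s' v = s v" "exec L (For x c) s = s'(x := {})"
    using exec_For[of "\<lambda>_ s'. s' v = s v" s L c x] For by auto
  then show ?case using For.prems by simp
qed (auto split: if_splits)

definition skip :: cmd where "skip = Incl 2 2"
definition copy :: "nat \<Rightarrow> nat \<Rightarrow> cmd" where "copy j x = Seq (Excl j j) (Incl j x)"

lemma skip [simp]: "exec L skip s = s" "cmd_writes skip = {}"
  by (simp_all add: skip_def)

lemma copy [simp]:
  "j \<noteq> x \<Longrightarrow> exec L (copy j x) s = s(j := s x)" "j \<noteq> x \<Longrightarrow> cmd_writes (copy j x) = {j}"
  by (simp_all add: copy_def fun_eq_iff)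

text \<open>The loop variable 58 is the position ranged over in an assignment, 59 is the only variable
  bound in a formula.\<close>

definition asg :: "nat \<Rightarrow> fm \<Rightarrow> cmd" where
  "asg j \<phi> = Seq (Excl j j) (For 58 (Ite \<phi> (Incl j 58) skip))"

lemma writes_asg [simp]: "cmd_writes (asg j \<phi>) = {j, 58}"
  by (auto simp: asg_def)

text \<open>The set is built in place while \<open>\<phi>\<close> is evaluated in the intermediate
  stores, so \<open>j\<close> must not occur in \<open>\<phi>\<close>. Updates that depend on the
  old value go through \<open>tTmp\<close>.\<close>

lemma exec_asg:
  assumes "j \<notin> fm_names \<phi>" "j \<noteq> 58"
  shows "exec L (asg j \<phi>) s j = {p. p < L \<and> sem L \<phi> (s(58 := {p}))}"
proof -
  let ?I = "\<lambda>k s'. s' j = {p. p < k \<and> sem L \<phi> (s(58 := {p}))} \<and> (\<forall>v. v \<noteq> j \<longrightarrow> v \<noteq> 58 \<longrightarrow> s' v = s v)"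
  have step: "?I (Suc k) (exec L (Ite \<phi> (Incl j 58) skip) (s'(58 := {k})))" if I: "?I k s'" for k s'
  proof -
    have "sem L \<phi> (s'(58 := {k})) = sem L \<phi> (s(58 := {k}))"
      by (rule sem_cong) (use I assms in auto)
    then show ?thesis using I assms by (auto simp: less_Suc_eq)
  qed
  obtain s' where "?I L s'" "exec L (For 58 (Ite \<phi> (Incl j 58) skip)) (s(j := {})) = s'(58 := {})"
    using exec_For[of ?I "s(j := {})" L "Ite \<phi> (Incl j 58) skip" 58] step by auto
  then show ?thesis unfolding asg_def using assms by simp
qed

definition f_term :: "nat \<Rightarrow> fm" where "f_term x = Conj (Meet x 0) (Meet x 1)"
definition f_one :: "nat \<Rightarrow> fm" where "f_one x = Conj (Meet x 1) (Neg (Meet x 0))"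
definition f_next :: "nat \<Rightarrow> nat \<Rightarrow> fm" where
  "f_next x y = Conj (Prec x y) (Conj (f_term y)
     (All 59 (Neg (Conj (Prec x 59) (Conj (Prec 59 y) (f_term 59))))))"
definition f_iff :: "fm \<Rightarrow> fm \<Rightarrow> fm" where
  "f_iff \<phi> \<psi> = Conj (Neg (Conj \<phi> (Neg \<psi>))) (Neg (Conj \<psi> (Neg \<phi>)))"
definition f_first :: "nat \<Rightarrow> fm" where
  "f_first x = All 59 (Neg (Prec 59 x))"
definition f_succ :: "nat \<Rightarrow> nat \<Rightarrow> fm" where
  "f_succ x y = Conj (Prec x y) (All 59 (Neg (Conj (Prec x 59) (Prec 59 y))))"

lemma names [simp]:
  "fm_names (f_term x) = {x, 0, 1}" "fm_names (f_one x) = {x, 0, 1}"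
  "fm_names (f_next x y) = {x, y, 0, 1, 59}" "fm_names (f_iff \<phi> \<psi>) = fm_names \<phi> \<union> fm_names \<psi>"
  "fm_names (f_first x) = {59, x}" "fm_names (f_succ x y) = {x, y, 59}"
  by (auto simp: f_term_def f_one_def f_next_def f_iff_def f_first_def f_succ_def)

lemma sem_f_iff [simp]: "sem L (f_iff \<phi> \<psi>) s \<longleftrightarrow> (sem L \<phi> s \<longleftrightarrow> sem L \<psi> s)"
  by (auto simp: f_iff_def)

text \<open>Roles of the tracks: C and V are the counter and the result when a number is converted to
  a position, Ptr, Y, Z point to slots, E and T hold the slots of the first end of each edge and of
  each target, D is the remaining distance, R and N the ball under construction and its
  neighbourhood, W the first end of an edge. A holds the slots of the targets not yet dropped, K
  the remaining budget, F is nonempty once the budget is exceeded, S holds the candidate points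
  and Cand those of them lying in all balls met so far, the slots of which are in Hit. KX points to
  the slot of k, and Acc collects the successful choices of x.\<close>

abbreviation "tC \<equiv> 2 :: nat"
abbreviation "tV \<equiv> 3 :: nat"
abbreviation "tTmp \<equiv> 4 :: nat"
abbreviation "tPtr \<equiv> 5 :: nat"
abbreviation "tE \<equiv> 6 :: nat"
abbreviation "tT \<equiv> 7 :: nat"
abbreviation "tD \<equiv> 8 :: nat"
abbreviation "tR \<equiv> 9 :: nat"
abbreviation "tN \<equiv> 10 :: nat"
abbreviation "tW \<equiv> 11 :: nat"
abbreviation "tY \<equiv> 12 :: nat"
abbreviation "tZ \<equiv> 13 :: nat"
abbreviation "tA \<equiv> 14 :: nat"
abbreviation "tK \<equiv> 15 :: nat"
abbreviation "tF \<equiv> 16 :: nat"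
abbreviation "tCand \<equiv> 17 :: nat"
abbreviation "tHit \<equiv> 18 :: nat"
abbreviation "tAcc \<equiv> 19 :: nat"
abbreviation "tS \<equiv> 20 :: nat"
abbreviation "tKX \<equiv> 21 :: nat"

definition load :: "nat \<Rightarrow> nat \<Rightarrow> cmd" where
  "load C X = asg C (Conj (f_one 58) (f_next 58 X))"

text \<open>The membership condition of \<open>dec\<close> speaks only about the order of positions,
  so a single first-order assignment performs the whole borrow, without propagating it cell by
  cell.\<close>

definition decr :: "nat \<Rightarrow> nat \<Rightarrow> cmd" where
  "decr C X = Seq (asg tTmp (Conj (Neg (f_term 58)) (Conj (f_next 58 X)
     (f_iff (Meet 58 C) (Prec C 58))))) (copy C tTmp)"

text \<open>The range of \<open>x\<close> merely bounds the number of rounds: \<open>c\<close> is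
  executed once per unit of the counter, but at most \<open>L\<close> times. Thus the loop stays
  polynomial even for a number with many digits.\<close>

definition down :: "nat \<Rightarrow> nat \<Rightarrow> nat \<Rightarrow> cmd \<Rightarrow> cmd" where
  "down x C X c = For x (Ite (Meet C C) (Seq (decr C X) c) skip)"

definition eval_num :: "nat \<Rightarrow> cmd" where
  "eval_num X = Seq (load tC X) (Seq (asg tV (f_first 58))
     (down 57 tC X (Seq (asg tTmp (f_succ tV 58)) (copy tV tTmp))))"

text \<open>On entry \<open>tPtr\<close> points to the slot in front of the length of the list, on
  exit to the last slot read. Only the slots of first components are collected, as the second
  component of a pair is always in the next slot.\<close>

definition parse_list :: "nat \<Rightarrow> cmd" where
  "parse_list J = Seq (asg tY (f_next tPtr 58)) (Seq (load tC tY) (Seq (copy tPtr tY) (Seq (Excl J J)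
     (down 56 tC tY (Seq (asg tZ (f_next tPtr 58)) (Seq (Incl J tZ) (asg tPtr (f_next tZ 58))))))))"

definition edge :: cmd where
  "edge = Seq (eval_num 54) (Seq (copy tW tV) (Seq (asg tZ (f_next 54 58)) (Seq (eval_num tZ)
     (Seq (Ite (Meet tR tW) (Incl tN tV) skip) (Ite (Meet tR tV) (Incl tN tW) skip)))))"

text \<open>New vertices go to \<open>tN\<close> while the edges are tested against
  \<open>tR\<close>, so that one call extends the radius by one, whatever the order of the
  edges.\<close>

definition expand :: cmd where
  "expand = Seq (copy tN tR) (Seq (For 54 (Ite (Meet 54 tE) edge skip)) (copy tR tN))"

text \<open>A ball is recomputed at every use: a track holds one set of positions, and the number of
  tracks is fixed independently of the number of targets.\<close>

definition ball :: "nat \<Rightarrow> cmd" where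
  "ball X = Seq (eval_num X) (Seq (copy tR tV) (Seq (asg tY (f_next X 58)) (Seq (load tD tY)
     (down 55 tD tY expand))))"

definition inter :: "nat \<Rightarrow> nat \<Rightarrow> cmd" where
  "inter j x = Seq (copy tTmp j) (Seq (Excl tTmp x) (Excl j tTmp))"

definition pick_cmd :: cmd where
  "pick_cmd = Seq (copy tCand tS) (Seq (Excl tHit tHit) (Seq
     (For 53 (Ite (Meet 53 tA) (Seq (ball 53) (Ite (Meet tR tS) (Seq (inter tCand tR) (Incl tHit 53)) skip)) skip))
     (Ite (Conj (Meet tCand tCand) (Meet tHit tHit))
       (Seq (Excl tA tHit) (Ite (Meet tK tK) (decr tK tKX) (Incl tF tHit))) skip)))"

definition pass_cmd :: cmd where
  "pass_cmd = For 51 (Ite (Meet 51 tA) (Seq (ball 51) (Seq (copy tS tR) pick_cmd)) skip)"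

definition attempt :: cmd where
  "attempt = Seq (copy tA tT) (Seq (load tK tKX) (Seq (Excl tF tF) (Seq (copy tS 52) (Seq pick_cmd
     (Seq (For 50 pass_cmd)
     (Ite (Conj (Neg (Meet tA tA)) (Neg (Meet tF tF))) (Incl tAcc 52) skip))))))"

definition main :: cmd where
  "main = Seq (asg tPtr (Conj (f_term 58) (All 59 (Neg (Conj (f_term 59) (Prec 59 58))))))
     (Seq (parse_list tE) (Seq (parse_list tT) (Seq (asg tKX (f_next tPtr 58)) (For 52 attempt))))"

lemma writes [simp]:
  "cmd_writes (load C X) = {C, 58}"
  "C \<noteq> tTmp \<Longrightarrow> cmd_writes (decr C X) = {tTmp, C, 58}"
  "C \<noteq> tTmp \<Longrightarrow> cmd_writes (down x C X c) = {tTmp, C, 58, x} \<union> cmd_writes c"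
  "cmd_writes (eval_num X) = {tC, tV, tTmp, 57, 58}"
  "J \<noteq> tZ \<Longrightarrow> cmd_writes (parse_list J) = {J, tC, tY, tZ, tTmp, tPtr, 56, 58}"
  "cmd_writes edge = {tC, tV, tTmp, tW, tZ, tN, 57, 58}"
  "cmd_writes expand = {tC, tV, tTmp, tW, tZ, tN, tR, 54, 57, 58}"
  "cmd_writes (ball X) = {tC, tV, tTmp, tW, tZ, tN, tR, tY, tD, 54, 55, 57, 58}"
  "j \<noteq> tTmp \<Longrightarrow> cmd_writes (inter j x) = {tTmp, j}"
  "cmd_writes pick_cmd = {tC, tV, tTmp, tW, tZ, tN, tR, tY, tD, 53, 54, 55, 57, 58, tCand, tHit, tA, tK, tF}"
  "cmd_writes pass_cmd =
     {tC, tV, tTmp, tW, tZ, tN, tR, tY, tD, 51, 53, 54, 55, 57, 58, tCand, tHit, tA, tK, tF, tS}"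
  unfolding load_def decr_def down_def eval_num_def parse_list_def edge_def expand_def ball_def
    inter_def pick_cmd_def pass_cmd_def
  by (simp_all, blast+)

lemma wf_main: "wf_prog (cmd_prog main)" "wf_prog (fm_prog (Meet tAcc tAcc))"
  by (simp_all add: main_def attempt_def pass_cmd_def pick_cmd_def inter_def ball_def expand_def edge_def
    parse_list_def eval_num_def down_def decr_def load_def f_term_def f_one_def f_next_def f_iff_def
    f_first_def f_succ_def asg_def copy_def skip_def)

section \<open>Effect of the commands on encoded inputs\<close>

context number_word
begin

lemma sem_f_term:
  assumes "inp s" "s x = {p}"
  shows "sem L (f_term x) s \<longleftrightarrow> (\<exists>i<length ns. p = pos i)"
  using inp_term[OF assms(1), of p] assms(2) by (auto simp: f_term_def)

lemma sem_f_one: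
  assumes "inp s" "s x = {p}"
  shows "sem L (f_one x) s \<longleftrightarrow> p < L \<and> w ! p = 2"
  using inp_one[OF assms(1), of p] assms(2) by (auto simp: f_one_def)

lemma inp_upd: "inp s \<Longrightarrow> 2 \<le> v \<Longrightarrow> inp (s(v := A))"
  by (simp add: inp_def)

lemma sem_f_next:
  assumes "inp s" "s x = {p}" "s y = {q}" "x \<noteq> 59" "y \<noteq> 59"
  shows "sem L (f_next x y) s \<longleftrightarrow> nxt p q"
proof -
  have "sem L (f_term 59) (s(59 := {k})) \<longleftrightarrow> (\<exists>i<length ns. k = pos i)" for k
    by (rule sem_f_term) (use assms in \<open>auto simp: inp_upd\<close>)
  moreover have "(\<forall>k<L. \<not> (p < k \<and> k < q \<and> (\<exists>i<length ns. k = pos i))) \<longleftrightarrow>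
      (\<forall>i<length ns. \<not> (p < pos i \<and> pos i < q))" using pos_less_L by blast
  ultimately show ?thesis using sem_f_term[OF assms(1,3)] assms(2-5) unfolding f_next_def nxt_def by simp
qed

lemma inp_frame: "inp s \<Longrightarrow> {0, 1} \<inter> cmd_writes c = {} \<Longrightarrow> inp (exec L c s)"
  by (simp add: inp_def exec_frame)

lemma exec_next:
  assumes "inp s" "s X = {pos i}" "Suc i < length ns" "X < 58" "j \<noteq> X" "2 \<le> j" "j < 58"
  shows "exec L (asg j (f_next X 58)) s j = {pos (Suc i)}"
proof -
  have "sem L (f_next X 58) (s(58 := {p})) \<longleftrightarrow> nxt (pos i) p" for p
    by (rule sem_f_next) (use assms in \<open>auto simp: inp_upd\<close>)
  then show ?thesis using assms nxt_from_pos[of i] pos_less_L[of "Suc i"] by (subst exec_asg) auto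
qed

lemma exec_load:
  assumes "inp s" "s X = {pos i}" "i < length ns" "X < 58" "C \<noteq> X" "2 \<le> C" "C < 58"
  shows "cnt i (exec L (load C X) s C) (ns ! i)"
proof -
  have "sem L (f_next 58 X) (s(58 := {p})) \<longleftrightarrow> nxt p (pos i)" for p
    by (rule sem_f_next) (use assms in \<open>auto simp: inp_upd\<close>)
  moreover have "sem L (f_one 58) (s(58 := {p})) \<longleftrightarrow> p < L \<and> w ! p = 2" for p
    by (rule sem_f_one) (use assms in \<open>auto simp: inp_upd\<close>)
  ultimately have "exec L (load C X) s C = {p. p < L \<and> w ! p = 2 \<and> nxt p (pos i)}"
    unfolding load_def using assms by (subst exec_asg) auto
  then show ?thesis using cnt_load[OF assms(3)] by simp
qed

lemma exec_decr:
  assumes "inp s" "s X = {pos i}" "i < length ns" "X < 58" "C \<noteq> X" "2 \<le> C" "C < 58" "C \<noteq> tTmp" "X \<noteq> tTmp"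
  shows "exec L (decr C X) s C = dec (start i) (pos i) (s C)"
proof -
  have n: "sem L (f_next 58 X) (s(58 := {p})) \<longleftrightarrow> nxt p (pos i)" for p
    by (rule sem_f_next) (use assms in \<open>auto simp: inp_upd\<close>)
  have t: "sem L (f_term 58) (s(58 := {p})) \<longleftrightarrow> (\<exists>i<length ns. p = pos i)" for p
    by (rule sem_f_term) (use assms in \<open>auto simp: inp_upd\<close>)
  \<comment> \<open>Excluding terminators removes the extra position of \<open>nxt_pos\<close> and
    leaves exactly the digit cells of the slot.\<close>
  have e: "\<not> (\<exists>i<length ns. p = pos i) \<and> nxt p (pos i) \<longleftrightarrow> start i \<le> p \<and> p < pos i" for p
  proof
    assume p: "\<not> (\<exists>i<length ns. p = pos i) \<and> nxt p (pos i)"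
    then have s: "start i \<le> Suc p" "p < pos i" using nxt_pos[OF assms(3)] by auto
    have "start i \<noteq> Suc p"
    proof
      assume s: "start i = Suc p"
      then obtain j where j: "i = Suc j" by (cases i) auto
      then have "p = pos j" using start_Suc[of j] assms(3) s by simp
      then show False using p j assms(3) by (auto dest: Suc_lessD)
    qed
    then show "start i \<le> p \<and> p < pos i" using s by simp
  next
    assume p: "start i \<le> p \<and> p < pos i"
    then have "w ! p \<noteq> 3" using w_bit(1)[OF assms(3), of p] by auto
    then show "\<not> (\<exists>i<length ns. p = pos i) \<and> nxt p (pos i)"
      using w_eq_3 nxt_pos[OF assms(3)] p by auto
  qed
  let ?f = "Conj (Neg (f_term 58)) (Conj (f_next 58 X) (f_iff (Meet 58 C) (Prec C 58)))"
  have "sem L ?f (s(58 := {p})) \<longleftrightarrow>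
      (\<not> (\<exists>i<length ns. p = pos i) \<and> nxt p (pos i)) \<and> (p \<in> s C \<longleftrightarrow> (\<exists>r\<in>s C. r < p))" for p
    using assms(7) by (simp add: n t conj_assoc)
  then have f: "p < L \<and> sem L ?f (s(58 := {p})) \<longleftrightarrow>
      start i \<le> p \<and> p < pos i \<and> (p \<in> s C \<longleftrightarrow> (\<exists>r\<in>s C. r < p))" for p
    using pos_less_L[OF assms(3)] unfolding e by (meson less_trans)
  have "tTmp \<notin> fm_names ?f" using assms(8,9) by simp
  from exec_asg[OF this, of L s] have "exec L (asg tTmp ?f) s tTmp = dec (start i) (pos i) (s C)"
    unfolding f dec_def by simp
  then show ?thesis unfolding decr_def using assms(8) by simp
qed

text \<open>\<open>P j\<close> describes the store after \<open>j\<close> executions of the body. It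
  has to be insensitive to the counter, to \<open>tTmp\<close> and to the two loop variables,
  because the bookkeeping between executions changes these.\<close>

lemma exec_down:
  assumes "inp s" "s X = {pos i}" "i < length ns" "cnt i (s C) v" "P 0 s"
    and tr: "X < 58" "C \<noteq> X" "2 \<le> C" "C < 58" "C \<noteq> tTmp" "X \<noteq> tTmp" "x \<notin> {C, X}" "2 \<le> x"
    and body: "{0, 1, X, C} \<inter> cmd_writes c = {}"
    and step: "\<And>j s. j < v \<Longrightarrow> inp s \<Longrightarrow> s X = {pos i} \<Longrightarrow> P j s \<Longrightarrow> P (Suc j) (exec L c s)"
    and indep: "\<And>j s s'. P j s \<Longrightarrow> \<forall>u. u \<notin> {C, tTmp, 58, x} \<longrightarrow> s' u = s u \<Longrightarrow> P j s'"
  shows "P (min v L) (exec L (down x C X c) s)"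
proof -
  \<comment> \<open>Truncated subtraction and \<open>min\<close> also describe the idle rounds after
    the counter has reached 0.\<close>
  let ?I = "\<lambda>k s. inp s \<and> s X = {pos i} \<and> cnt i (s C) (v - k) \<and> P (min v k) s"
  let ?c = "Ite (Meet C C) (Seq (decr C X) c) skip"
  have "?I (Suc k) (exec L ?c (s(x := {k})))" if I: "?I k s" for k s
  proof -
    let ?s = "s(x := {k})"
    have s: "inp ?s" "?s X = {pos i}" "cnt i (?s C) (v - k)" "P (min v k) ?s"
      using I tr indep[of "min v k" s ?s] by (auto simp: inp_upd)
    show ?thesis
    proof (cases "k < v")
      case True
      let ?d = "exec L (decr C X) ?s"
      have "?s C \<noteq> {}" using cnt_empty[OF s(3)] True by simp
      then have ex: "exec L ?c ?s = exec L c ?d" by simp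
      have d: "inp ?d" "?d X = {pos i}" "cnt i (?d C) (v - Suc k)"
      proof -
        show "inp ?d" using s(1) tr by (intro inp_frame) auto
        show "?d X = {pos i}" using s(2) tr by (subst exec_frame) auto
        show "cnt i (?d C) (v - Suc k)"
          unfolding exec_decr[OF s(1,2) assms(3) tr(1-6)] using cnt_dec[OF s(3)] True by simp
      qed
      have "P k ?d" using indep[OF s(4), of ?d] True tr by (auto simp: exec_frame)
      then have "P (Suc k) (exec L c ?d)" by (rule step[OF True d(1,2)])
      moreover have "inp (exec L c ?d)" by (rule inp_frame[OF d(1)]) (use body in auto)
      ultimately show ?thesis unfolding ex using d body True by (auto simp: exec_frame)
    next
      case False
      then have "?s C = {}" using cnt_empty[OF s(3)] by simp
      then have "exec L ?c ?s = ?s" by simp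
      then show ?thesis using s False by simp
    qed
  qed
  then obtain s' where s': "?I L s'" "exec L (down x C X c) s = s'(x := {})"
    unfolding down_def using exec_For[of ?I s L ?c x] assms by auto
  then show ?thesis using indep[of "min v L" s'] by auto
qed

text \<open>The position is reached from 0 by \<open>ns ! i\<close> successor steps. The bound
  \<open>ns ! i < L\<close> keeps it on the input cells and makes \<open>L\<close> rounds
  enough.\<close>

lemma exec_eval_num:
  assumes "inp s" "s X = {pos i}" "i < length ns" "ns ! i < L" "X < 57" "X \<notin> {tC, tV, tTmp}"
  shows "exec L (eval_num X) s tV = {ns ! i}"
proof -
  define s1 where "s1 = exec L (load tC X) s"
  define s2 where "s2 = exec L (asg tV (f_first 58)) s1"
  have s1: "inp s1" "s1 X = {pos i}" "cnt i (s1 tC) (ns ! i)"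
    using exec_load[OF assms(1-3)] inp_frame[OF assms(1), of "load tC X"] assms unfolding s1_def
    by (auto simp: exec_frame)
  have s2: "inp s2" "s2 X = {pos i}" "cnt i (s2 tC) (ns ! i)" "s2 tV = {0}"
  proof -
    show "s2 tV = {0}" unfolding s2_def using assms(4) by (subst exec_asg) (auto simp: f_first_def, metis less_trans gr0I)
  qed (use s1 assms inp_frame[OF s1(1), of "asg tV (f_first 58)"] in \<open>auto simp: s2_def exec_frame\<close>)
  let ?c = "Seq (asg tTmp (f_succ tV 58)) (copy tV tTmp)"
  have "exec L (down 57 tC X ?c) s2 tV = {min (ns ! i) L}"
  proof (rule exec_down[OF s2(1,2) assms(3) s2(3)])
    fix j s assume "j < ns ! i" "s tV = {j}"
    then show "exec L ?c s tV = {Suc j}" using assms(4)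
      by (simp, subst exec_asg) (auto simp: f_succ_def, metis Suc_lessI lessI less_trans)
  qed (use assms s2 in auto)
  then show ?thesis unfolding eval_num_def using assms(4) by (simp add: s1_def s2_def)
qed

lemma length_le_L: "length ns \<le> L"
proof -
  have "i \<le> length ns \<Longrightarrow> i \<le> start i" for i
    by (induction i) (auto simp: start_Suc pos_def)
  from this[of "length ns"] show ?thesis by (simp add: start_length)
qed

lemma exec_parse_list:
  assumes "inp s" "s tPtr = {pos c}" "Suc c + 2 * ns ! Suc c < length ns" "J = tE \<or> J = tT"
  shows "exec L (parse_list J) s tPtr = {pos (Suc c + 2 * ns ! Suc c)}"
    "exec L (parse_list J) s J = (\<lambda>j. pos (c + 2 * j + 2)) ` {..<ns ! Suc c}"
proof -
  let ?v = "ns ! Suc c"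
  let ?P = "\<lambda>j s. s tPtr = {pos (Suc c + 2 * j)} \<and> s J = (\<lambda>j. pos (c + 2 * j + 2)) ` {..<j}"
  have c: "Suc c < length ns" using assms(3) by simp
  define s1 where "s1 = exec L (asg tY (f_next tPtr 58)) s"
  have s1: "inp s1" "s1 tY = {pos (Suc c)}"
    using exec_next[OF assms(1,2) c, of tY] inp_frame[OF assms(1)] by (auto simp: s1_def)
  define s2 where "s2 = exec L (load tC tY) s1"
  have s2: "inp s2" "s2 tY = {pos (Suc c)}" "cnt (Suc c) (s2 tC) ?v"
    using exec_load[OF s1 c, of tC] inp_frame[OF s1(1)] s1 by (auto simp: s2_def exec_frame)
  define s3 where "s3 = s2(tPtr := s2 tY, J := {})"
  have s3: "inp s3" "s3 tY = {pos (Suc c)}" "cnt (Suc c) (s3 tC) ?v" "?P 0 s3"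
    using s2 assms(4) by (auto simp: s3_def inp_upd)
  let ?c = "Seq (asg tZ (f_next tPtr 58)) (Seq (Incl J tZ) (asg tPtr (f_next tZ 58)))"
  have "?P (min ?v L) (exec L (down 56 tC tY ?c) s3)"
  proof (rule exec_down[where P = ?P, OF s3(1,2) c s3(3,4)])
    fix j s assume j: "j < ?v" "inp s" "?P j s"
    define t1 where "t1 = exec L (asg tZ (f_next tPtr 58)) s"
    have l: "Suc (Suc c + 2 * j) < length ns" "Suc (Suc (Suc c + 2 * j)) < length ns"
      using j(1) assms(3) by auto
    have t1: "inp t1" "t1 tZ = {pos (Suc (Suc c + 2 * j))}" "t1 J = s J"
      using exec_next[OF j(2) _ l(1), of tPtr tZ] inp_frame[OF j(2)] j(3) assms(4)
      by (auto simp: t1_def exec_frame)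
    define t2 where "t2 = t1(J := t1 J \<union> t1 tZ)"
    have t2: "inp t2" "t2 tZ = {pos (Suc (Suc c + 2 * j))}" "t2 J = (\<lambda>j. pos (c + 2 * j + 2)) ` {..<Suc j}"
      using t1 j(3) assms(4) by (auto simp: t2_def inp_upd lessThan_Suc)
    have "exec L (asg tPtr (f_next tZ 58)) t2 tPtr = {pos (Suc (Suc (Suc c + 2 * j)))}"
      by (rule exec_next[OF t2(1,2) l(2)]) auto
    moreover have "exec L (asg tPtr (f_next tZ 58)) t2 J = t2 J" using assms(4) by (auto simp: exec_frame)
    ultimately show "?P (Suc j) (exec L ?c s)" using t2(3) unfolding t2_def t1_def by simp
  qed (use assms(4) in auto)
  moreover have "min ?v L = ?v" using assms(3) length_le_L by simp
  moreover have "exec L (parse_list J) s = exec L (down 56 tC tY ?c) s3"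
    unfolding parse_list_def s3_def s2_def s1_def using assms(4) by auto
  ultimately show "exec L (parse_list J) s tPtr = {pos (Suc c + 2 * ns ! Suc c)}"
    "exec L (parse_list J) s J = (\<lambda>j. pos (c + 2 * j + 2)) ` {..<ns ! Suc c}" by auto
qed

lemma exec_edge:
  assumes "inp s" "s 54 = {pos i}" "Suc i < length ns" "ns ! i < L" "ns ! Suc i < L"
  shows "exec L edge s tN = s tN \<union> (if ns ! i \<in> s tR then {ns ! Suc i} else {}) \<union>
     (if ns ! Suc i \<in> s tR then {ns ! i} else {})"
proof -
  have i: "i < length ns" using assms(3) by simp
  define s1 where "s1 = exec L (eval_num 54) s"
  have s1: "inp s1" "s1 54 = {pos i}" "s1 tV = {ns ! i}" "s1 tR = s tR" "s1 tN = s tN"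
    using exec_eval_num[OF assms(1,2) i assms(4)] inp_frame[OF assms(1)] assms(2)
    by (auto simp: s1_def exec_frame)
  define s2 where "s2 = s1(tW := s1 tV)"
  have s2: "inp s2" "s2 54 = {pos i}" "s2 tW = {ns ! i}" "s2 tR = s tR" "s2 tN = s tN"
    using s1 by (auto simp: s2_def inp_upd)
  define s3 where "s3 = exec L (asg tZ (f_next 54 58)) s2"
  have s3: "inp s3" "s3 tZ = {pos (Suc i)}" "s3 tW = {ns ! i}" "s3 tR = s tR" "s3 tN = s tN"
    using exec_next[OF s2(1,2) assms(3), of tZ] inp_frame[OF s2(1)] s2
    by (auto simp: s3_def exec_frame)
  define s4 where "s4 = exec L (eval_num tZ) s3"
  have s4: "s4 tV = {ns ! Suc i}" "s4 tW = {ns ! i}" "s4 tR = s tR" "s4 tN = s tN"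
    using exec_eval_num[OF s3(1,2) assms(3,5)] s3 by (auto simp: s4_def exec_frame)
  have "exec L edge s = exec L (Seq (Ite (Meet tR tW) (Incl tN tV) skip) (Ite (Meet tR tV) (Incl tN tW) skip)) s4"
    unfolding edge_def s4_def s3_def s2_def s1_def by simp
  then show ?thesis using s4 by auto
qed

definition nbrs :: "nat set \<Rightarrow> nat set \<Rightarrow> nat set" where
  "nbrs EI R = R \<union> {v. \<exists>i\<in>EI. ns ! i \<in> R \<and> v = ns ! Suc i \<or> ns ! Suc i \<in> R \<and> v = ns ! i}"

lemma exec_expand:
  assumes "inp s" "s tE = pos ` EI" "\<forall>i\<in>EI. Suc i < length ns \<and> ns ! i < L \<and> ns ! Suc i < L"
  shows "exec L expand s tR = nbrs EI (s tR)"
proof -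
  let ?c = "Ite (Meet 54 tE) edge skip"
  let ?N = "\<lambda>k. {v. \<exists>i\<in>EI. pos i < k \<and> (ns ! i \<in> s tR \<and> v = ns ! Suc i \<or> ns ! Suc i \<in> s tR \<and> v = ns ! i)}"
  let ?I = "\<lambda>k s'. inp s' \<and> s' tE = pos ` EI \<and> s' tR = s tR \<and> s' tN = s tR \<union> ?N k"
  have "?I (Suc k) (exec L ?c (s'(54 := {k})))" if I: "?I k s'" for k s'
  proof -
    let ?s = "s'(54 := {k})"
    have fr: "inp (exec L ?c ?s)" "exec L ?c ?s tE = pos ` EI" "exec L ?c ?s tR = s tR"
      using I inp_frame[of ?s ?c] by (auto simp: inp_upd exec_frame simp del: exec.simps)
    show ?thesis
    proof (cases "k \<in> pos ` EI")
      case True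
      then obtain i where i: "i \<in> EI" "k = pos i" by blast
      have ii: "Suc i < length ns" "ns ! i < L" "ns ! Suc i < L" using i assms(3) by auto
      have "?N (Suc k) = ?N k \<union> {v. ns ! i \<in> s tR \<and> v = ns ! Suc i \<or> ns ! Suc i \<in> s tR \<and> v = ns ! i}"
      proof -
        have "pos j = k \<longleftrightarrow> j = i" if "j \<in> EI" for j using that assms(3) i pos_inj Suc_lessD by metis
        then show ?thesis using i by (auto simp: less_Suc_eq)
      qed
      moreover have "exec L edge ?s tN = ?s tN \<union> (if ns ! i \<in> ?s tR then {ns ! Suc i} else {}) \<union>
          (if ns ! Suc i \<in> ?s tR then {ns ! i} else {})"
        by (rule exec_edge[OF _ _ ii]) (use I i in \<open>auto simp: inp_upd\<close>)
      moreover have "exec L ?c ?s = exec L edge ?s" using True I by simp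
      ultimately show ?thesis using fr I by auto
    next
      case False
      then have "?N (Suc k) = ?N k" by (auto simp: less_Suc_eq)
      moreover have "exec L ?c ?s = ?s" using False I by simp
      ultimately show ?thesis using fr I by simp
    qed
  qed
  then obtain s' where s': "?I L s'" "exec L (For 54 ?c) (s(tN := s tR)) = s'(54 := {})"
    using exec_For[of ?I "s(tN := s tR)" L ?c 54] assms by (auto simp: inp_upd)
  have "exec L expand s tR = s' tN" unfolding expand_def using s'(2) by simp
  also have "\<dots> = nbrs EI (s tR)"
  proof -
    have "pos i < L" if "i \<in> EI" for i using that assms(3) pos_less_L Suc_lessD by blast
    then show ?thesis using s'(1) unfolding nbrs_def by auto
  qed
  finally show ?thesis .
qed

lemma exec_ball:
  assumes "inp s" "s X = {pos t}" "Suc t < length ns" "ns ! t < L" "s tE = pos ` EI"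
    "\<forall>i\<in>EI. Suc i < length ns \<and> ns ! i < L \<and> ns ! Suc i < L" "X = 51 \<or> X = 53"
  shows "exec L (ball X) s tR = (nbrs EI ^^ min (ns ! Suc t) L) {ns ! t}"
proof -
  have t: "t < length ns" using assms(3) by simp
  define s1 where "s1 = exec L (eval_num X) s"
  have s1: "inp s1" "s1 X = {pos t}" "s1 tV = {ns ! t}" "s1 tE = pos ` EI"
    using exec_eval_num[OF assms(1,2) t assms(4)] inp_frame[OF assms(1)] assms(2,5,7)
    by (auto simp: s1_def exec_frame)
  define s2 where "s2 = s1(tR := s1 tV)"
  have s2: "inp s2" "s2 X = {pos t}" "s2 tR = {ns ! t}" "s2 tE = pos ` EI"
    using s1 assms(7) by (auto simp: s2_def inp_upd)
  define s3 where "s3 = exec L (asg tY (f_next X 58)) s2"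
  have s3: "inp s3" "s3 tY = {pos (Suc t)}" "s3 tR = {ns ! t}" "s3 tE = pos ` EI"
    using exec_next[OF s2(1,2) assms(3), of tY] inp_frame[OF s2(1)] s2 assms(7)
    by (auto simp: s3_def exec_frame)
  define s4 where "s4 = exec L (load tD tY) s3"
  let ?P = "\<lambda>j s. s tE = pos ` EI \<and> s tR = (nbrs EI ^^ j) {ns ! t}"
  have s4: "inp s4" "s4 tY = {pos (Suc t)}" "cnt (Suc t) (s4 tD) (ns ! Suc t)" "?P 0 s4"
    using exec_load[OF s3(1,2) assms(3), of tD] inp_frame[OF s3(1)] s3
    by (auto simp: s4_def exec_frame)
  have "?P (min (ns ! Suc t) L) (exec L (down 55 tD tY expand) s4)"
  proof (rule exec_down[where P = ?P, OF s4(1,2) assms(3) s4(3,4)])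
    fix j s assume "inp s" "?P j s"
    then show "?P (Suc j) (exec L expand s)"
      using exec_expand[of s EI] assms(6) by (auto simp: exec_frame)
  qed auto
  moreover have "exec L (ball X) s = exec L (down 55 tD tY expand) s4"
    unfolding ball_def s4_def s3_def s2_def s1_def by simp
  ultimately show ?thesis by simp
qed

end

section \<open>The greedy algorithm\<close>

type_synonym greedy = "nat set \<times> nat \<times> bool"

text \<open>In a state (A, k, f), the flag f records that the truncated subtraction k - 1 has been
  applied to 0.\<close>

definition pick :: "(nat \<Rightarrow> nat set) \<Rightarrow> nat set \<Rightarrow> greedy \<Rightarrow> greedy" where
  "pick B S = (\<lambda>(A, k, f). let H = {q \<in> A. B q \<inter> S \<noteq> {}} in
     if S \<inter> (\<Inter>q\<in>H. B q) \<noteq> {} \<and> H \<noteq> {} then (A - H, k - 1, f \<or> k = 0) else (A, k, f))"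

definition pick_alive :: "(nat \<Rightarrow> nat set) \<Rightarrow> nat \<Rightarrow> greedy \<Rightarrow> greedy" where
  "pick_alive B t st = (if t \<in> fst st then pick B (B t) st else st)"

definition pass :: "(nat \<Rightarrow> nat set) \<Rightarrow> nat \<Rightarrow> greedy \<Rightarrow> greedy" where
  "pass B L = fold (pick_alive B) [0..<L]"

text \<open>With the singleton of \<open>x\<close> as candidate set, the common-point test of
  \<open>pick\<close> succeeds as soon as some ball contains \<open>x\<close>, so the initial choice
  is one more instance of \<open>pick\<close>, and it is free if no ball contains \<open>x\<close>.
  The number of passes is \<open>L\<close> because a pass is to drop at least one ball while any
  remains.\<close>

definition attempt_result :: "(nat \<Rightarrow> nat set) \<Rightarrow> nat \<Rightarrow> nat set \<Rightarrow> nat \<Rightarrow> nat \<Rightarrow> greedy" where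
  "attempt_result B L A k x = (pass B L ^^ L) (pick B {x} (A, k, False))"

definition accepts :: "(nat \<Rightarrow> nat set) \<Rightarrow> nat \<Rightarrow> nat set \<Rightarrow> nat \<Rightarrow> bool" where
  "accepts B L A k \<longleftrightarrow> (\<exists>x<L. case attempt_result B L A k x of (A', k', f) \<Rightarrow> A' = {} \<and> \<not> f)"

lemma fst_pick: "fst (pick B S st) \<subseteq> fst st"
  by (auto simp: pick_def Let_def split: prod.splits if_splits)

lemma exec_inter:
  assumes "j \<noteq> tTmp" "x \<noteq> tTmp" "j \<noteq> x"
  shows "exec L (inter j x) s j = s j \<inter> s x"
  using assms by (auto simp: inter_def)

section \<open>The program computes the greedy algorithm\<close>

context number_word
begin

text \<open>Balls are indexed by terminator positions, since these are what the tracks contain;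
  \<open>inv_into\<close> recovers the index of the slot.\<close>

definition ball_at :: "nat set \<Rightarrow> nat \<Rightarrow> nat set" where
  "ball_at EI p = (let t = inv_into {..<length ns} pos p in (nbrs EI ^^ min (ns ! Suc t) L) {ns ! t})"

lemma ball_at_pos: "t < length ns \<Longrightarrow> ball_at EI (pos t) = (nbrs EI ^^ min (ns ! Suc t) L) {ns ! t}"
  unfolding ball_at_def by (subst inv_into_f_f) (auto simp: inj_on_def pos_inj)

definition ctx :: "nat set \<Rightarrow> nat set \<Rightarrow> nat \<Rightarrow> store \<Rightarrow> bool" where
  "ctx EI TI kx s \<longleftrightarrow> inp s \<and> s tE = pos ` EI \<and> s tT = pos ` TI \<and> s tKX = {pos kx}"

definition slots_ok :: "nat set \<Rightarrow> nat set \<Rightarrow> nat \<Rightarrow> bool" where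
  "slots_ok EI TI kx \<longleftrightarrow> (\<forall>i\<in>EI. Suc i < length ns \<and> ns ! i < L \<and> ns ! Suc i < L) \<and>
     (\<forall>i\<in>TI. Suc i < length ns \<and> ns ! i < L) \<and> kx < length ns"

definition abs_rel :: "nat set \<Rightarrow> nat \<Rightarrow> store \<Rightarrow> greedy \<Rightarrow> bool" where
  "abs_rel TI kx s = (\<lambda>(A, k, f). s tA = A \<and> A \<subseteq> pos ` TI \<and> cnt kx (s tK) k \<and> (s tF \<noteq> {}) = f)"

lemma ctx_frame: "ctx EI TI kx s \<Longrightarrow> {0, 1, tE, tT, tKX} \<inter> cmd_writes c = {} \<Longrightarrow> ctx EI TI kx (exec L c s)"
  by (simp add: ctx_def inp_frame exec_frame)

lemma ctx_upd: "ctx EI TI kx s \<Longrightarrow> v \<notin> {0, 1, tE, tT, tKX} \<Longrightarrow> ctx EI TI kx (s(v := A))"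
  by (simp add: ctx_def inp_def)

lemma exec_ball_at:
  assumes "slots_ok EI TI kx" "ctx EI TI kx s" "s X = {p}" "p \<in> pos ` TI" "X = 51 \<or> X = 53"
  shows "exec L (ball X) s tR = ball_at EI p"
proof -
  obtain t where t: "t \<in> TI" "p = pos t" using assms(4) by blast
  then have "Suc t < length ns" "ns ! t < L" using assms(1) unfolding slots_ok_def by auto
  then show ?thesis
    using exec_ball[of s X t EI] assms t ball_at_pos[of t EI] unfolding ctx_def slots_ok_def by auto
qed

lemma exec_pick_loop:
  fixes EI
  defines "B \<equiv> ball_at EI"
  defines "c \<equiv> Ite (Meet 53 tA) (Seq (ball 53) (Ite (Meet tR tS) (Seq (inter tCand tR) (Incl tHit 53)) skip)) skip"
  assumes good: "slots_ok EI TI kx" and s: "ctx EI TI kx s" "s tA \<subseteq> pos ` TI" "s tHit = {}" "s tCand = s tS"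
  shows "exec L (For 53 c) s tHit = {q \<in> s tA. B q \<inter> s tS \<noteq> {}}"
    "exec L (For 53 c) s tCand = s tS \<inter> (\<Inter>q\<in>{q \<in> s tA. B q \<inter> s tS \<noteq> {}}. B q)"
proof -
  let ?H = "\<lambda>k. {q \<in> s tA. q < k \<and> B q \<inter> s tS \<noteq> {}}"
  let ?I = "\<lambda>k s'. ctx EI TI kx s' \<and> s' tA = s tA \<and> s' tS = s tS \<and> s' tHit = ?H k \<and>
    s' tCand = s tS \<inter> (\<Inter>q\<in>?H k. B q)"
  have step: "?I (Suc k) (exec L c (s'(53 := {k})))" if I: "?I k s'" for k s'
  proof -
    let ?s = "s'(53 := {k})"
    have s': "ctx EI TI kx ?s" using I by (auto intro: ctx_upd)
    have fr: "ctx EI TI kx (exec L c ?s)" "exec L c ?s tA = s tA" "exec L c ?s tS = s tS"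
      using I s' by (auto simp: c_def exec_frame simp del: exec.simps intro!: ctx_frame)
    show ?thesis
    proof (cases "k \<in> s tA")
      case False
      then have "?H (Suc k) = ?H k" by (auto simp: less_Suc_eq)
      moreover have "exec L c ?s = ?s" using False I unfolding c_def by simp
      ultimately show ?thesis using I fr by simp
    next
      case True
      let ?t = "exec L (ball 53) ?s"
      have R: "?t tR = B k" unfolding B_def
        by (rule exec_ball_at[OF good s']) (use True s(2) in auto)
      have t: "?t 53 = {k}" "?t tS = s tS" "?t tHit = ?H k" "?t tCand = s tS \<inter> (\<Inter>q\<in>?H k. B q)"
        using I by (auto simp: exec_frame)
      show ?thesis
      proof (cases "B k \<inter> s tS = {}")
        case empty: True
        have "exec L c ?s = ?t" using True empty I R t unfolding c_def by simp
        moreover have "?H (Suc k) = ?H k" using empty by (auto simp: less_Suc_eq)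
        ultimately show ?thesis using t fr by simp
      next
        case False
        have e: "exec L c ?s = (exec L (inter tCand tR) ?t)(tHit := ?H k \<union> {k})"
          using True False I R t unfolding c_def by (simp add: exec_frame)
        have "?H (Suc k) = ?H k \<union> {k}" using True False by (auto simp: less_Suc_eq)
        moreover from this have "s tS \<inter> (\<Inter>q\<in>?H (Suc k). B q) = (s tS \<inter> (\<Inter>q\<in>?H k. B q)) \<inter> B k"
          by auto
        moreover have "exec L (inter tCand tR) ?t tCand = ?t tCand \<inter> ?t tR" by (rule exec_inter) auto
        ultimately show ?thesis using fr R t(4) unfolding e by simp
      qed
    qed
  qed
  have 0: "?I 0 s" using s by simp
  obtain s' where s': "?I L s'" "exec L (For 53 c) s = s'(53 := {})"
    using exec_For[of ?I s L c 53, OF 0 step] by blast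
  have "?H L = {q \<in> s tA. B q \<inter> s tS \<noteq> {}}"
  proof -
    have "q < L" if q: "q \<in> s tA" for q
    proof -
      obtain t where "t \<in> TI" "q = pos t" using q s(2) by blast
      then show ?thesis using good pos_less_L[of t] unfolding slots_ok_def by auto
    qed
    then show ?thesis by auto
  qed
  then show "exec L (For 53 c) s tHit = {q \<in> s tA. B q \<inter> s tS \<noteq> {}}"
    "exec L (For 53 c) s tCand = s tS \<inter> (\<Inter>q\<in>{q \<in> s tA. B q \<inter> s tS \<noteq> {}}. B q)"
    using s' by auto
qed

lemma exec_pick:
  assumes good: "slots_ok EI TI kx" and s: "ctx EI TI kx s" "abs_rel TI kx s st"
  shows "abs_rel TI kx (exec L pick_cmd s) (pick (ball_at EI) (s tS) st)"
proof -
  obtain A k f where st: "st = (A, k, f)" by (cases st)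
  let ?B = "ball_at EI" and ?S = "s tS"
  define H where "H = {q \<in> A. ?B q \<inter> ?S \<noteq> {}}"
  have a: "s tA = A" "A \<subseteq> pos ` TI" "cnt kx (s tK) k" "(s tF \<noteq> {}) = f"
    using s(2) unfolding st abs_rel_def by auto
  define s1 where "s1 = s(tCand := s tS, tHit := {})"
  have s1: "ctx EI TI kx s1" "s1 tA \<subseteq> pos ` TI" "s1 tHit = {}" "s1 tCand = s1 tS" "s1 tA = A" "s1 tS = ?S"
    using s(1) a by (auto simp: s1_def intro!: ctx_upd)
  let ?c = "Ite (Meet 53 tA) (Seq (ball 53) (Ite (Meet tR tS) (Seq (inter tCand tR) (Incl tHit 53)) skip)) skip"
  define s2 where "s2 = exec L (For 53 ?c) s1"
  have s2: "s2 tHit = H" "s2 tCand = ?S \<inter> (\<Inter>q\<in>H. ?B q)"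
    using exec_pick_loop[OF good s1(1-4)] s1(5,6) unfolding s2_def H_def by auto
  have s2': "s2 tA = A" "s2 tK = s tK" "s2 tF = s tF" "ctx EI TI kx s2"
    using s1(5) ctx_frame[OF s1(1), of "For 53 ?c"]
    by (auto simp: s2_def s1_def exec_frame simp del: exec.simps)
  let ?d = "Ite (Conj (Meet tCand tCand) (Meet tHit tHit))
       (Seq (Excl tA tHit) (Ite (Meet tK tK) (decr tK tKX) (Incl tF tHit))) skip"
  have e: "exec L pick_cmd s = exec L ?d s2"
    unfolding pick_cmd_def s2_def s1_def by simp
  show ?thesis
  proof (cases "?S \<inter> (\<Inter>q\<in>H. ?B q) \<noteq> {} \<and> H \<noteq> {}")
    case False
    then have "exec L ?d s2 = s2" using s2 by auto
    moreover have "pick ?B ?S st = st" using False unfolding st pick_def H_def Let_def by auto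
    ultimately show ?thesis using s2' a unfolding e st abs_rel_def by simp
  next
    case True
    let ?s3 = "s2(tA := A - H)"
    have p: "pick ?B ?S st = (A - H, k - 1, f \<or> k = 0)"
      using True unfolding st pick_def H_def Let_def by auto
    have e3: "exec L ?d s2 = exec L (Ite (Meet tK tK) (decr tK tKX) (Incl tF tHit)) ?s3"
      using True s2 s2' by simp
    have c3: "ctx EI TI kx ?s3" using s2'(4) by (auto intro: ctx_upd)
    have K: "cnt kx (?s3 tK) k" using s2' a by simp
    show ?thesis
    proof (cases "k = 0")
      case k: True
      then have "s2 tK = {}" using cnt_empty[OF K] by simp
      \<comment> \<open>The set in \<open>tHit\<close> is nonempty here, so adding it to
        \<open>tF\<close> raises the flag.\<close>
      then show ?thesis unfolding e e3 p abs_rel_def using k True K a s2' s2 by auto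
    next
      case False
      then have "s2 tK \<noteq> {}" using cnt_empty[OF K] by simp
      then have e4: "exec L ?d s2 = exec L (decr tK tKX) ?s3" unfolding e3 by simp
      have "exec L (decr tK tKX) ?s3 tK = dec (start kx) (pos kx) (?s3 tK)"
        by (rule exec_decr) (use c3 good in \<open>auto simp: ctx_def slots_ok_def\<close>)
      then have "cnt kx (exec L (decr tK tKX) ?s3 tK) (k - 1)" using cnt_dec[OF K] False by simp
      then show ?thesis unfolding e e4 p abs_rel_def using False a s2' by (auto simp: exec_frame)
    qed
  qed
qed

lemma exec_pass:
  assumes good: "slots_ok EI TI kx" and s: "ctx EI TI kx s" "abs_rel TI kx s st"
  shows "abs_rel TI kx (exec L pass_cmd s) (pass (ball_at EI) L st)"
proof -
  let ?B = "ball_at EI"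
  let ?c = "Ite (Meet 51 tA) (Seq (ball 51) (Seq (copy tS tR) pick_cmd)) skip"
  let ?I = "\<lambda>k s'. ctx EI TI kx s' \<and> abs_rel TI kx s' (fold (pick_alive ?B) [0..<k] st)"
  have step: "?I (Suc k) (exec L ?c (s'(51 := {k})))" if I: "?I k s'" for k s'
  proof -
    let ?s = "s'(51 := {k})" and ?st = "fold (pick_alive ?B) [0..<k] st"
    have s': "ctx EI TI kx ?s" "abs_rel TI kx ?s ?st"
      using I by (auto simp: abs_rel_def split: prod.splits intro: ctx_upd)
    have A: "?s tA = fst ?st" "fst ?st \<subseteq> pos ` TI" using s'(2) unfolding abs_rel_def by (auto split: prod.splits)
    have fr: "ctx EI TI kx (exec L ?c ?s)"
      by (rule ctx_frame[OF s'(1)]) auto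
    show ?thesis
    proof (cases "k \<in> fst ?st")
      case False
      then have "exec L ?c ?s = ?s" using A by simp
      then show ?thesis using False s' fr by (simp add: pick_alive_def)
    next
      case True
      let ?t = "exec L (ball 51) ?s"
      have R: "?t tR = ?B k"
        by (rule exec_ball_at[OF good s'(1)]) (use True A in auto)
      let ?u = "?t(tS := ?B k)"
      have "ctx EI TI kx ?t" by (rule ctx_frame[OF s'(1)]) auto
      then have u: "ctx EI TI kx ?u" by (auto intro: ctx_upd)
      have v: "abs_rel TI kx ?u ?st" using s'(2) by (auto simp: abs_rel_def exec_frame split: prod.splits)
      have "exec L ?c ?s = exec L pick_cmd ?u" using True A R by simp
      then show ?thesis using exec_pick[OF good u v] fr True by (simp add: pick_alive_def)
    qed
  qed
  have 0: "?I 0 s" using s by simp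
  obtain s' where "?I L s'" "exec L pass_cmd s = s'(51 := {})"
    using exec_For[of ?I s L ?c 51, OF 0 step] unfolding pass_cmd_def by blast
  then show ?thesis unfolding pass_def abs_rel_def by (auto split: prod.splits)
qed

lemma exec_attempt:
  assumes good: "slots_ok EI TI kx" and s: "ctx EI TI kx s" "s 52 = {x}"
  shows "exec L attempt s tAcc = s tAcc \<union>
    (case attempt_result (ball_at EI) L (pos ` TI) (ns ! kx) x of (A, k, f) \<Rightarrow> if A = {} \<and> \<not> f then {x} else {})"
proof -
  let ?B = "ball_at EI"
  define s1 where "s1 = exec L (load tK tKX) (s(tA := s tT))"
  have c0: "ctx EI TI kx (s(tA := s tT))" using s(1) by (auto intro: ctx_upd)
  then have K: "cnt kx (s1 tK) (ns ! kx)"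
    unfolding s1_def by (intro exec_load) (use good in \<open>auto simp: ctx_def slots_ok_def\<close>)
  have c1: "ctx EI TI kx s1" unfolding s1_def by (rule ctx_frame[OF c0]) auto
  have s1: "s1 tA = pos ` TI" "s1 52 = {x}" "s1 tAcc = s tAcc"
    using s by (auto simp: s1_def exec_frame ctx_def)
  define s2 where "s2 = s1(tF := {}, tS := {x})"
  have c2: "ctx EI TI kx s2" unfolding s2_def using c1 by (auto intro!: ctx_upd)
  have a2: "abs_rel TI kx s2 (pos ` TI, ns ! kx, False)"
    using K s1 by (auto simp: abs_rel_def s2_def)
  define s3 where "s3 = exec L pick_cmd s2"
  have c3: "ctx EI TI kx s3" unfolding s3_def by (rule ctx_frame[OF c2]) auto
  have a3: "abs_rel TI kx s3 (pick ?B {x} (pos ` TI, ns ! kx, False))"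
    using exec_pick[OF good c2 a2] by (simp add: s3_def s2_def)
  let ?st = "pick ?B {x} (pos ` TI, ns ! kx, False)"
  let ?I = "\<lambda>k s'. ctx EI TI kx s' \<and> abs_rel TI kx s' ((pass ?B L ^^ k) ?st)"
  have step: "?I (Suc k) (exec L pass_cmd (s'(50 := {k})))" if I: "?I k s'" for k s'
  proof -
    have c: "ctx EI TI kx (s'(50 := {k}))" using I by (auto intro: ctx_upd)
    have a: "abs_rel TI kx (s'(50 := {k})) ((pass ?B L ^^ k) ?st)" 
      using I by (auto simp: abs_rel_def split: prod.splits)
    have "ctx EI TI kx (exec L pass_cmd (s'(50 := {k})))" by (rule ctx_frame[OF c]) auto
    then show ?thesis using exec_pass[OF good c a] by simp
  qed
  have 0: "?I 0 s3" using c3 a3 by simp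
  obtain s4 where s4: "?I L s4" "exec L (For 50 pass_cmd) s3 = s4(50 := {})"
    using exec_For[of ?I s3 L pass_cmd 50, OF 0 step] by blast
  define s5 where "s5 = exec L (For 50 pass_cmd) s3"
  have a5: "abs_rel TI kx s5 (attempt_result ?B L (pos ` TI) (ns ! kx) x)"
    using s4 unfolding s5_def attempt_result_def abs_rel_def by (auto split: prod.splits)
  have s5: "s5 52 = {x}" "s5 tAcc = s tAcc"
    using s1 unfolding s5_def s3_def s2_def by (auto simp: exec_frame simp del: exec.simps)
  have "exec L attempt s = exec L (Ite (Conj (Neg (Meet tA tA)) (Neg (Meet tF tF))) (Incl tAcc 52) skip) s5"
    unfolding attempt_def s5_def s3_def s2_def s1_def using s(2) 
    by (simp add: exec_frame del: exec.simps(5))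
  then show ?thesis using s5 a5 unfolding abs_rel_def by (auto split: prod.splits)
qed

lemma exec_attempts:
  assumes good: "slots_ok EI TI kx" and s: "ctx EI TI kx s" "s tAcc = {}"
  shows "exec L (For 52 attempt) s tAcc \<noteq> {} \<longleftrightarrow> accepts (ball_at EI) L (pos ` TI) (ns ! kx)"
proof -
  let ?ok = "\<lambda>x. case attempt_result (ball_at EI) L (pos ` TI) (ns ! kx) x of (A, k, f) \<Rightarrow> A = {} \<and> \<not> f"
  let ?I = "\<lambda>k s'. ctx EI TI kx s' \<and> s' tAcc = {x. x < k \<and> ?ok x}"
  have step: "?I (Suc k) (exec L attempt (s'(52 := {k})))" if I: "?I k s'" for k s'
  proof -
    have c: "ctx EI TI kx (s'(52 := {k}))" by (rule ctx_upd[OF conjunct1[OF I]]) simp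
    have "ctx EI TI kx (exec L attempt (s'(52 := {k})))"
      by (rule ctx_frame[OF c]) (auto simp: attempt_def)
    moreover have "exec L attempt (s'(52 := {k})) tAcc = {x. x < k \<and> ?ok x} \<union> (if ?ok k then {k} else {})"
      using exec_attempt[OF good c, of k] I by (auto split: prod.splits)
    ultimately show ?thesis by (auto simp: less_Suc_eq)
  qed
  have 0: "?I 0 s" using s by simp
  obtain s' where "?I L s'" "exec L (For 52 attempt) s = s'(52 := {})"
    using exec_For[of ?I s L attempt 52, OF 0 step] by blast
  then show ?thesis unfolding accepts_def by auto
qed

text \<open>The index sets follow the layout of the slots: 0 holds \<open>n\<close>, 1 holds
  \<open>m\<close>, the edges fill 2 to \<open>2 * m + 1\<close>, slot \<open>2 * m + 2\<close>
  holds \<open>l\<close>, the targets follow in pairs, and the last slot holds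
  \<open>k\<close>.\<close>

lemma exec_main:
  assumes "ns = n # m # es @ l # ts @ [k]" "length es = 2 * m" "length ts = 2 * l"
    "\<forall>u\<in>set es. u < L" "\<forall>j<l. ts ! (2 * j) < L"
  defines "EI \<equiv> (\<lambda>j. 2 * j + 2) ` {..<m}"
    and "TI \<equiv> (\<lambda>j. 2 * m + 2 * j + 3) ` {..<l}"
    and "kx \<equiv> 2 * m + 2 * l + 3"
  shows "sem L (Meet tAcc tAcc) (exec L main (store_of w)) \<longleftrightarrow> accepts (ball_at EI) L (pos ` TI) k"
proof -
  have len: "length ns = 2 * m + 2 * l + 4" using assms(1-3) by simp
  have n1: "ns ! 1 = m" using assms(1) by simp
  have ne: "ns ! (j + 2) = es ! j" if "j < 2 * m" for j using that assms(1,2) by (simp add: nth_append)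
  have nl: "ns ! (2 * m + 2) = l" using assms(1,2) by (simp add: nth_append)
  have nt: "ns ! (2 * m + j + 3) = ts ! j" if "j < 2 * l" for j 
    using that assms(1-3) by (simp add: nth_append numeral_3_eq_3)
  have nk: "ns ! kx = k" using assms(1-3) unfolding kx_def by (simp add: nth_append numeral_3_eq_3)
  have good: "slots_ok EI TI kx"
  proof -
    have "ns ! (2 * j + 2) < L \<and> ns ! Suc (2 * j + 2) < L" if "j < m" for j
      using ne[of "2 * j"] ne[of "2 * j + 1"] that assms(2,4) by auto
    moreover have "ns ! (2 * m + 2 * j + 3) < L" if "j < l" for j
      using nt[of "2 * j"] that assms(5) by simp
    ultimately show ?thesis using len unfolding slots_ok_def EI_def TI_def kx_def by auto
  qed
  have L0: "pos 0 < L" using pos_less_L[of 0] len by simp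
  let ?s = "store_of w"
  have i0: "inp ?s" by (simp add: inp_def)
  let ?f = "Conj (f_term 58) (All 59 (Neg (Conj (f_term 59) (Prec 59 58))))"
  define s1 where "s1 = exec L (asg tPtr ?f) ?s"
  have i1: "inp s1" unfolding s1_def by (rule inp_frame[OF i0]) auto
  have p1: "s1 tPtr = {pos 0}"
  proof -
    have "sem L (f_term 58) (?s(58 := {p})) \<longleftrightarrow> (\<exists>i<length ns. p = pos i)" for p
      by (rule sem_f_term) (use i0 in \<open>auto simp: inp_upd\<close>)
    moreover have "sem L (f_term 59) (?s(58 := {p}, 59 := {q})) \<longleftrightarrow> (\<exists>i<length ns. q = pos i)" for p q
      by (rule sem_f_term) (use i0 in \<open>auto simp: inp_upd\<close>)
    ultimately have "sem L ?f (?s(58 := {p})) \<longleftrightarrow> (\<exists>i<length ns. p = pos i) \<and>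
        (\<forall>q<L. \<not> ((\<exists>i<length ns. q = pos i) \<and> q < p))" for p by simp
    moreover have "(\<exists>i<length ns. p = pos i) \<and>
        (\<forall>q<L. \<not> ((\<exists>i<length ns. q = pos i) \<and> q < p)) \<longleftrightarrow> p = pos 0" for p
    proof
      assume p: "(\<exists>i<length ns. p = pos i) \<and> (\<forall>q<L. \<not> ((\<exists>i<length ns. q = pos i) \<and> q < p))"
      then obtain i where i: "i < length ns" "p = pos i" by blast
      have "\<exists>i<length ns. pos 0 = pos i" using len by (intro exI[of _ 0]) simp
      then have "\<not> pos 0 < p" using p L0 by blast
      then show "p = pos 0" using i pos_less[of 0 i] by (cases "i = 0") auto
    next
      assume p: "p = pos 0"
      have "\<not> pos i < pos 0" if "i < length ns" for i using pos_less[of 0 i] that by (cases "i = 0") auto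
      then show "(\<exists>i<length ns. p = pos i) \<and> (\<forall>q<L. \<not> ((\<exists>i<length ns. q = pos i) \<and> q < p))"
        using p len by (auto intro!: exI[of _ 0])
    qed
    ultimately have "sem L ?f (?s(58 := {p})) \<longleftrightarrow> p = pos 0" for p by blast
    moreover have "tPtr \<notin> fm_names ?f" by simp
    ultimately show ?thesis unfolding s1_def using exec_asg[of tPtr ?f L ?s] L0 by auto
  qed
  define s2 where "s2 = exec L (parse_list tE) s1"
  have p2: "s2 tPtr = {pos (2 * m + 1)}" "s2 tE = pos ` EI"
    using exec_parse_list[OF i1 p1, of tE] n1 len unfolding s2_def EI_def by (auto simp: image_image)
  have i2: "inp s2" unfolding s2_def by (rule inp_frame[OF i1]) auto
  define s3 where "s3 = exec L (parse_list tT) s2"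
  have p3: "s3 tPtr = {pos (2 * m + 2 * l + 2)}" "s3 tT = pos ` TI"
    using exec_parse_list[OF i2 p2(1), of tT] nl len unfolding s3_def TI_def
    by (simp_all add: image_image algebra_simps numeral_3_eq_3)
  have i3: "inp s3" unfolding s3_def by (rule inp_frame[OF i2]) auto
  have e3: "s3 tE = pos ` EI" using p2 unfolding s3_def by (simp add: exec_frame)
  define s4 where "s4 = exec L (asg tKX (f_next tPtr 58)) s3"
  have p4: "s4 tKX = {pos kx}"
    using exec_next[OF i3 p3(1), of tKX] len unfolding s4_def kx_def by (simp add: numeral_3_eq_3)
  have i4: "inp s4" unfolding s4_def by (rule inp_frame[OF i3]) auto
  have "s4 tAcc = ?s tAcc" unfolding s4_def s3_def s2_def s1_def by (simp add: exec_frame)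
  moreover have "?s tAcc = {}"
  proof -
    have "\<not> bit (w ! p) tAcc" if "p < length w" for p
      using bit_symbol(3)[OF w_symbol, of p tAcc] that unfolding L_def by auto
    then show ?thesis unfolding store_of_def by auto
  qed
  ultimately have acc: "s4 tAcc = {}" by simp
  have c: "ctx EI TI kx s4" using i4 p4 p3(2) e3 unfolding ctx_def by (auto simp: s4_def exec_frame)
  have "exec L main ?s = exec L (For 52 attempt) s4"
    unfolding main_def s4_def s3_def s2_def s1_def by (simp del: exec.simps(5))
  then show ?thesis using exec_attempts[OF good c acc] nk by (simp del: exec.simps(5))
qed

end

section \<open>Correctness of the greedy algorithm\<close>

text \<open>If \<open>B q\<close> is nonempty, the case \<open>q' = q\<close> places
  \<open>v\<close> in \<open>B q\<close> itself, so \<open>v\<close> passes the common-point test of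
  \<open>pick\<close>.\<close>

definition simplicial :: "(nat \<Rightarrow> nat set) \<Rightarrow> nat set \<Rightarrow> bool" where
  "simplicial B A \<longleftrightarrow> (\<exists>q\<in>A. \<exists>v. \<forall>q'\<in>A. B q' \<inter> B q \<noteq> {} \<longrightarrow> v \<in> B q')"

definition sound_inv :: "(nat \<Rightarrow> nat set) \<Rightarrow> nat set \<Rightarrow> nat \<Rightarrow> greedy \<Rightarrow> bool" where
  "sound_inv B A0 k = (\<lambda>(A, k', f). A \<subseteq> A0 \<and>
     (\<not> f \<longrightarrow> (\<exists>P. finite P \<and> card P + k' \<le> k \<and> (\<forall>q\<in>A0 - A. B q \<inter> P \<noteq> {}))))"

text \<open>The test in \<open>pick\<close> yields a point common to all balls dropped. Adding it to
  \<open>P\<close> costs at most one element, which the decrement of the budget pays for.\<close>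

lemma sound_pick:
  assumes "sound_inv B A0 k st"
  shows "sound_inv B A0 k (pick B S st)"
proof -
  obtain A k' f where st: "st = (A, k', f)" by (cases st)
  have A: "A \<subseteq> A0" using assms unfolding st sound_inv_def by auto
  define H where "H = {q \<in> A. B q \<inter> S \<noteq> {}}"
  show ?thesis
  proof (cases "S \<inter> (\<Inter>q\<in>H. B q) \<noteq> {} \<and> H \<noteq> {}")
    case True
    then obtain v where v: "\<forall>q\<in>H. v \<in> B q" by blast
    have p: "pick B S st = (A - H, k' - 1, f \<or> k' = 0)"
      using True unfolding st pick_def H_def Let_def by auto
    show ?thesis
    proof (cases "f \<or> k' = 0")
      case False
      then obtain P where P: "finite P" "card P + k' \<le> k" "\<forall>q\<in>A0 - A. B q \<inter> P \<noteq> {}"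
        using assms unfolding st sound_inv_def by auto
      have "card (insert v P) + (k' - 1) \<le> k" using P(1,2) False by (auto simp: card_insert_if)
      moreover have "\<forall>q\<in>A0 - (A - H). B q \<inter> insert v P \<noteq> {}" using P(3) v by auto
      ultimately show ?thesis using A P(1) unfolding p sound_inv_def
        by (auto intro!: exI[of _ "insert v P"])
    next
      case True
      then show ?thesis using A unfolding p sound_inv_def by auto
    qed
  next
    case False
    then have "pick B S st = st" unfolding st pick_def H_def Let_def by auto
    then show ?thesis using assms by simp
  qed
qed

lemma sound_pass: "sound_inv B A0 k st \<Longrightarrow> sound_inv B A0 k (pass B L st)"
  unfolding pass_def
  by (rule fold_invariant[where Q = "\<lambda>_. True" and P = "sound_inv B A0 k"])
    (auto simp: pick_alive_def sound_pick)

lemma accepts_sound: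
  assumes "accepts B L A k" "\<forall>q\<in>A. B q \<subseteq> V"
  shows "\<exists>P\<subseteq>V. card P \<le> k \<and> (\<forall>q\<in>A. B q \<inter> P \<noteq> {})"
proof -
  obtain x where "case attempt_result B L A k x of (A', k', f) \<Rightarrow> A' = {} \<and> \<not> f"
    using assms(1) unfolding accepts_def by (elim exE conjE)
  moreover obtain A' k' f where e: "attempt_result B L A k x = (A', k', f)" by (rule prod_cases3)
  ultimately have x: "attempt_result B L A k x = ({}, k', False)" by simp
  have "sound_inv B A k (A, k, False)" 
    unfolding sound_inv_def by (simp, intro exI[of _ "{}"]) simp
  then have "sound_inv B A k ((pass B L ^^ j) (pick B {x} (A, k, False)))" for j
    by (induction j) (auto simp: sound_pick sound_pass)
  from this[of L] obtain P where P: "finite P" "card P + k' \<le> k" "\<forall>q\<in>A. B q \<inter> P \<noteq> {}"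
    using x unfolding attempt_result_def sound_inv_def by auto
  \<comment> \<open>The invariant does not confine \<open>P\<close> to \<open>V\<close>; points
    outside \<open>V\<close> hit no ball and can be removed.\<close>
  have "card (P \<inter> V) \<le> card P" using P(1) by (intro card_mono) auto
  then show ?thesis using P assms(2) by (intro exI[of _ "P \<inter> V"]) auto
qed

section \<open>Completeness of the greedy choice\<close>

definition complete_inv :: "(nat \<Rightarrow> nat set) \<Rightarrow> nat set \<Rightarrow> greedy \<Rightarrow> bool" where
  "complete_inv B A0 = (\<lambda>(A, k, f). A \<subseteq> A0 \<and> \<not> f \<and>
     (\<exists>P. finite P \<and> card P \<le> k \<and> (\<forall>q\<in>A. B q \<inter> P \<noteq> {})))"

text \<open>Let \<open>p\<close> be a point of \<open>P\<close> in \<open>B t\<close>. Every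
  remaining ball through \<open>p\<close> meets \<open>B t\<close> and is dropped, so
  \<open>P - {p}\<close> still hits the others. Since \<open>P\<close> is nonempty, the budget was
  positive and the flag stays unset.\<close>

lemma complete_pick_alive:
  assumes "complete_inv B A0 st"
  shows "complete_inv B A0 (pick_alive B t st)"
proof -
  obtain A k f where st: "st = (A, k, f)" by (cases st)
  obtain P where P: "finite P" "card P \<le> k" "\<forall>q\<in>A. B q \<inter> P \<noteq> {}" "\<not> f" "A \<subseteq> A0"
    using assms unfolding st complete_inv_def by auto
  define H where "H = {q \<in> A. B q \<inter> B t \<noteq> {}}"
  show ?thesis
  proof (cases "t \<in> A \<and> B t \<inter> (\<Inter>q\<in>H. B q) \<noteq> {} \<and> H \<noteq> {}")
    case True
    then obtain p where p: "p \<in> B t" "p \<in> P" using P(3) by blast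
    have e: "pick_alive B t st = (A - H, k - 1, f \<or> k = 0)"
      using True unfolding st pick_alive_def pick_def H_def Let_def by auto
    have c: "card (P - {p}) \<le> k - 1" "k \<noteq> 0" using P(1,2) p(2) card_gt_0_iff[of P] by auto
    have "\<forall>q\<in>A - H. B q \<inter> (P - {p}) \<noteq> {}" using P(3) p(1) unfolding H_def by blast
    then show ?thesis using c P unfolding e complete_inv_def by (auto intro!: exI[of _ "P - {p}"])
  next
    case False
    then have "pick_alive B t st = st" unfolding st pick_alive_def pick_def H_def Let_def by auto
    then show ?thesis using assms by simp
  qed
qed

text \<open>A successful \<open>pick\<close> removes a nonempty set of balls, so an unchanged set
  shows that nothing was paid either.\<close>

lemma pick_alive_stuck:
  assumes "fst (pick_alive B t st) = fst st"
  shows "pick_alive B t st = st"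
proof -
  obtain A k f where "st = (A, k, f)" by (cases st)
  then show ?thesis using assms unfolding pick_alive_def pick_def Let_def by (auto split: if_splits)
qed

lemma fst_pick_alive: "fst (pick_alive B t st) \<subseteq> fst st"
  using fst_pick by (simp add: pick_alive_def)

lemma fst_fold_pick_alive: "fst (fold (pick_alive B) ts st) \<subseteq> fst st"
proof (induction ts arbitrary: st)
  case (Cons t ts)
  then show ?case using fst_pick_alive[of B t st] by (metis fold_simps(2) subset_trans)
qed simp

text \<open>The sets only shrink along the fold, hence equality at its end forces equality at every
  step.\<close>

lemma fold_stuck:
  assumes "fst (fold (pick_alive B) ts st) = fst st"
  shows "\<forall>t\<in>set ts. pick_alive B t st = st"
  using assms
proof (induction ts arbitrary: st)
  case (Cons t ts)
  have "fst (fold (pick_alive B) ts (pick_alive B t st)) = fst st" using Cons.prems by simp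
  then have "fst (pick_alive B t st) = fst st"
    using fst_fold_pick_alive[of B ts "pick_alive B t st"] fst_pick_alive[of B t st] by simp
  then have "pick_alive B t st = st" by (rule pick_alive_stuck)
  then show ?case using Cons by simp
qed simp

text \<open>After the choice of a point \<open>x\<close> of \<open>P\<close>, only balls avoiding
  \<open>x\<close> remain, and \<open>simp\<close> finds a simplicial one in any nonempty subfamily.
  A pass that changed nothing would have rejected this ball, so every pass makes progress and
  \<open>L\<close> passes remove all balls, of which there are at most \<open>L\<close>.\<close>

lemma accepts_complete:
  assumes L: "A0 \<subseteq> {..<L}" "L \<ge> 1"
    and P: "P \<subseteq> {..<L}" "card P \<le> k" "\<forall>q\<in>A0. B q \<inter> P \<noteq> {}"
    and simp: "\<And>A x. x \<in> P \<Longrightarrow> A \<subseteq> {q \<in> A0. x \<notin> B q} \<Longrightarrow> A \<noteq> {} \<Longrightarrow> simplicial B A"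
  shows "accepts B L A0 k"
proof -
  \<comment> \<open>An empty \<open>P\<close> hits no ball, so there are none then, and position 0
    serves as a default for \<open>x\<close>.\<close>
  define x where "x = (if P = {} then 0 else SOME x. x \<in> P)"
  have x: "x < L" "P \<noteq> {} \<Longrightarrow> x \<in> P"
    using L(2) P(1) some_in_eq[of P] unfolding x_def by auto
  have finP: "finite P" using P(1) finite_subset by blast
  define A1 where "A1 = {q \<in> A0. x \<notin> B q}"
  define st where "st = pick B {x} (A0, k, False)"
  have st: "complete_inv B A1 st"
  proof (cases "A0 = A1")
    case True
    then have "{q \<in> A0. B q \<inter> {x} \<noteq> {}} = {}" unfolding A1_def by auto
    then have "st = (A0, k, False)" unfolding st_def pick_def Let_def by auto
    then show ?thesis using True finP P unfolding complete_inv_def by auto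
  next
    case False
    then have H: "{q \<in> A0. B q \<inter> {x} \<noteq> {}} \<noteq> {}" unfolding A1_def by auto
    then have ne: "P \<noteq> {}" using P(3) by auto
    then have k: "k \<noteq> 0" using P(2) finP by auto
    have st: "st = (A1, k - 1, False)"
      using H k unfolding st_def pick_def Let_def A1_def by auto
    have "card (P - {x}) \<le> k - 1" using x(2)[OF ne] P(2) finP by simp
    moreover have "\<forall>q\<in>A1. B q \<inter> (P - {x}) \<noteq> {}" using P(3) unfolding A1_def by blast
    ultimately show ?thesis unfolding st complete_inv_def using finP by (auto intro!: exI[of _ "P - {x}"])
  qed
  have finA1: "finite A1" "card A1 \<le> L"
  proof -
    have "A1 \<subseteq> {..<L}" using L(1) unfolding A1_def by auto
    then show "finite A1" "card A1 \<le> L" using finite_subset card_mono[of "{..<L}" A1] by auto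
  qed
  have pass: "complete_inv B A1 (pass B L st)" if "complete_inv B A1 st" for st
    unfolding pass_def using that
    by (intro fold_invariant[where Q = "\<lambda>_. True" and P = "complete_inv B A1"])
      (auto simp: complete_pick_alive)
  have progress: "fst (pass B L st) \<subset> fst st" if st: "complete_inv B A1 st" "fst st \<noteq> {}" for st
  proof (rule ccontr)
    assume "\<not> fst (pass B L st) \<subset> fst st"
    then have "fst (pass B L st) = fst st" 
      using fst_fold_pick_alive[of B "[0..<L]" st] unfolding pass_def by blast
    then have stuck: "\<forall>t\<in>{..<L}. pick_alive B t st = st" 
      using fold_stuck[of B "[0..<L]" st] by (simp add: pass_def atLeast0LessThan)
    obtain A k f where e: "st = (A, k, f)" by (cases st)
    have A: "A \<subseteq> A1" "A \<noteq> {}" "\<forall>q\<in>A. B q \<noteq> {}" using st unfolding e complete_inv_def by auto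
    have ne: "P \<noteq> {}" using A(1,2) P(3) unfolding A1_def by blast
    obtain q v where q: "q \<in> A" "\<forall>q'\<in>A. B q' \<inter> B q \<noteq> {} \<longrightarrow> v \<in> B q'"
      using simp[OF x(2)[OF ne] _ A(2)] A(1) unfolding A1_def simplicial_def by blast
    let ?H = "{q' \<in> A. B q' \<inter> B q \<noteq> {}}"
    have H: "q \<in> ?H" using q(1) A(3) by auto
    then have "v \<in> B q \<inter> (\<Inter>q\<in>?H. B q)" using q(2) by auto
    then have "fst (pick_alive B q st) = A - ?H"
      using H q(1) unfolding pick_alive_def e pick_def Let_def by auto
    moreover have "q < L" using q(1) A(1) L(1) unfolding A1_def by auto
    ultimately have "A = A - ?H" using stuck unfolding e by (metis fst_conv lessThan_iff)
    then show False using H by blast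
  qed
  have "complete_inv B A1 ((pass B L ^^ j) st) \<and> card (fst ((pass B L ^^ j) st)) \<le> L - j" for j
  proof (induction j)
    case 0
    have "fst st \<subseteq> A1" using st unfolding complete_inv_def by (auto split: prod.splits)
    then show ?case using st finA1 card_mono[of A1 "fst st"] by simp
  next
    case (Suc j)
    let ?s = "(pass B L ^^ j) st"
    have "fst ?s \<subseteq> A1" using Suc unfolding complete_inv_def by (auto split: prod.splits)
    then have fin: "finite (fst ?s)" using finA1(1) finite_subset by blast
    have "card (fst (pass B L ?s)) \<le> L - Suc j"
    proof (cases "fst ?s = {}")
      case True
      then show ?thesis using fst_fold_pick_alive[of B "[0..<L]" ?s] unfolding pass_def by simp
    next
      case False
      then have "card (fst (pass B L ?s)) < card (fst ?s)"
        using progress Suc fin by (intro psubset_card_mono) auto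
      then show ?thesis using Suc by linarith
    qed
    then show ?case using Suc pass by simp
  qed
  from this[of L] have fin: "complete_inv B A1 (attempt_result B L A0 k x)"
    "card (fst (attempt_result B L A0 k x)) = 0"
    unfolding attempt_result_def st_def by auto
  then have "fst (attempt_result B L A0 k x) = {}"
    using finite_subset[OF _ finA1(1)] unfolding complete_inv_def by (auto split: prod.splits)
  then show ?thesis using fin(1) x(1) unfolding accepts_def complete_inv_def
    by (intro exI[of _ x]) (auto split: prod.splits)
qed

section \<open>Balls in trees and cycles\<close>

definition nb :: "(nat \<times> nat) set \<Rightarrow> nat set \<Rightarrow> nat set" where
  "nb E R = R \<union> E `` R"

definition gball :: "(nat \<times> nat) set \<Rightarrow> nat \<Rightarrow> nat \<Rightarrow> nat set" where
  "gball E j v = (nb E ^^ j) {v}"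

lemma gball_Suc: "gball E (Suc j) v = gball E j v \<union> E `` gball E j v"
  by (simp add: gball_def nb_def)

lemma gball_0 [simp]: "gball E 0 v = {v}"
  by (simp add: gball_def)

lemma gball_mono: "i \<le> j \<Longrightarrow> gball E i v \<subseteq> gball E j v"
  by (induction j rule: dec_induct) (auto simp: gball_Suc)

lemma gball_center: "v \<in> gball E j v"
  using gball_mono[of 0 j E v] by simp

lemma gball_subset: "v \<in> V \<Longrightarrow> E \<subseteq> V \<times> V \<Longrightarrow> gball E j v \<subseteq> V"
  by (induction j) (auto simp: gball_Suc)

text \<open>Once a step adds no vertex the ball is stable, and this happens within \<open>n\<close>
  steps. Cutting a large radius off at \<open>L\<close> therefore leaves the ball unchanged.\<close>

lemma gball_saturates:
  assumes "v < n" "E \<subseteq> {..<n} \<times> {..<n}" "n \<le> L"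
  shows "gball E (min d L) v = gball E d v"
proof (cases "d \<le> L")
  case False
  have sub: "gball E j v \<subseteq> {..<n}" for j using gball_subset assms by auto
  \<comment> \<open>Without a stable step, each step adds a vertex to the initial one. For
    \<open>j = n\<close> this would give more than \<open>n\<close> vertices.\<close>
  have "(\<exists>i<j. gball E (Suc i) v = gball E i v) \<or> j < card (gball E j v)" for j
  proof (induction j)
    case (Suc j)
    show ?case
    proof (cases "\<exists>i<Suc j. gball E (Suc i) v = gball E i v")
      case False
      then have "gball E j v \<subset> gball E (Suc j) v" "j < card (gball E j v)"
        using gball_mono[of j "Suc j" E v] Suc by (auto simp: less_Suc_eq)
      moreover have "finite (gball E (Suc j) v)" using sub finite_subset by blast
      ultimately have "j < card (gball E j v)" "card (gball E j v) < card (gball E (Suc j) v)"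
        by (auto intro: psubset_card_mono)
      then show ?thesis by linarith
    qed blast
  qed simp
  moreover have "card (gball E n v) \<le> n" using card_mono[OF _ sub[of n]] by simp
  ultimately obtain i where i: "i < n" "gball E (Suc i) v = gball E i v" by (metis leD)
  have "gball E (i + k) v = gball E i v" for k
    by (induction k) (use i(2) in \<open>auto simp: gball_Suc\<close>)
  from this[of "L - i"] this[of "d - i"] show ?thesis using i(1) assms(3) False by (simp add: min_def)
qed (simp add: min_def)

lemma gball_connected: "p \<in> gball E j v \<Longrightarrow> (v, p) \<in> (E \<inter> gball E j v \<times> gball E j v)\<^sup>*"
proof (induction j arbitrary: p)
  case (Suc j)
  let ?B = "gball E j v" and ?B' = "gball E (Suc j) v"
  have mono: "(E \<inter> ?B \<times> ?B)\<^sup>* \<subseteq> (E \<inter> ?B' \<times> ?B')\<^sup>*"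
    by (rule rtrancl_mono) (auto simp: gball_Suc)
  show ?case
  proof (cases "p \<in> ?B")
    case True
    then show ?thesis using Suc.IH mono by blast
  next
    case False
    then obtain r where r: "r \<in> ?B" "(r, p) \<in> E" using Suc.prems by (auto simp: gball_Suc)
    then have "(r, p) \<in> E \<inter> ?B' \<times> ?B'" by (auto simp: gball_Suc)
    then show ?thesis using Suc.IH[OF r(1)] mono by (meson rtrancl.rtrancl_into_rtrancl subsetD)
  qed
qed simp

text \<open>Balls enter the graph-theoretic part only as nonempty connected vertex sets, that is, as
  subtrees of a tree or arcs of a cycle; centres and radii are forgotten.\<close>

definition connected_in :: "(nat \<times> nat) set \<Rightarrow> nat set \<Rightarrow> bool" where
  "connected_in E B \<longleftrightarrow> (\<forall>p\<in>B. \<forall>q\<in>B. (p, q) \<in> (E \<inter> B \<times> B)\<^sup>*)"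

lemma connected_gball:
  assumes "sym E"
  shows "connected_in E (gball E j v)"
proof -
  have "sym (E \<inter> gball E j v \<times> gball E j v)" using assms by (auto simp: sym_def)
  then have s: "sym ((E \<inter> gball E j v \<times> gball E j v)\<^sup>*)" by (rule sym_rtrancl)
  show ?thesis unfolding connected_in_def
    using gball_connected symD[OF s] by (meson rtrancl_trans)
qed

text \<open>The vertex \<open>y\<close> is the one after the last visit to \<open>v\<close>.\<close>

lemma last_exit:
  assumes "(v, w) \<in> S\<^sup>*" "w \<noteq> v"
  shows "\<exists>y. (v, y) \<in> S \<and> y \<noteq> v \<and> (y, w) \<in> {(a, b) \<in> S. a \<noteq> v \<and> b \<noteq> v}\<^sup>*"
  using assms
proof (induction rule: rtrancl_induct)
  case (step b c)
  show ?case
  proof (cases "b = v")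
    case False
    then obtain y where "(v, y) \<in> S" "y \<noteq> v" "(y, b) \<in> {(a, b) \<in> S. a \<noteq> v \<and> b \<noteq> v}\<^sup>*"
      using step.IH by blast
    moreover have "(b, c) \<in> {(a, b) \<in> S. a \<noteq> v \<and> b \<noteq> v}" using step False by simp
    ultimately show ?thesis by (meson rtrancl.rtrancl_into_rtrancl)
  qed (use step in blast)
qed simp

lemma simple_path:
  assumes "(y, p) \<in> R\<^sup>*"
  shows "\<exists>xs. xs \<noteq> [] \<and> distinct xs \<and> hd xs = y \<and> last xs = p \<and> successively (\<lambda>a b. (a, b) \<in> R) xs"
  using assms
proof (induction rule: converse_rtrancl_induct)
  case base
  show ?case by (rule exI[of _ "[p]"]) simp
next
  case (step y z)
  then obtain xs where xs: "xs \<noteq> []" "distinct xs" "hd xs = z" "last xs = p"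
    "successively (\<lambda>a b. (a, b) \<in> R) xs" by blast
  show ?case
  proof (cases "y \<in> set xs")
    case True
    then obtain us vs where "xs = us @ y # vs" by (meson split_list)
    then show ?thesis using xs by (intro exI[of _ "y # vs"]) (auto simp: successively_append_iff)
  next
    case False
    then show ?thesis using xs step(1) by (intro exI[of _ "y # xs"]) (auto simp: successively_Cons)
  qed
qed

definition edges :: "(nat \<times> nat) list \<Rightarrow> (nat \<times> nat) set" where
  "edges es = {(u, v). adj es u v}"

lemma sym_edges: "sym (edges es)"
  by (auto simp: edges_def adj_def sym_def)

text \<open>Shorten the walk from \<open>y\<close> to \<open>p\<close> to a simple path; it avoids
  \<open>v\<close>, and \<open>v\<close> closes it to a cycle. As \<open>y\<close> and
  \<open>p\<close> differ, the cycle has at least three vertices.\<close>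

lemma cycle_through:
  assumes "(v, y) \<in> edges es" "(p, v) \<in> edges es" "y \<noteq> p" "y \<noteq> v"
    "(y, p) \<in> {(a, b) \<in> edges es. a \<noteq> v \<and> b \<noteq> v}\<^sup>*"
  shows "has_cycle es"
proof -
  let ?R = "{(a, b) \<in> edges es. a \<noteq> v \<and> b \<noteq> v}"
  obtain xs where xs: "xs \<noteq> []" "distinct xs" "hd xs = y" "last xs = p"
    "successively (\<lambda>a b. (a, b) \<in> ?R) xs" using simple_path[OF assms(5)] by blast
  have nth: "(xs ! i, xs ! Suc i) \<in> ?R" if "Suc i < length xs" for i
    using xs(5) that by (simp add: successively_conv_nth)
  have len: "length xs \<ge> 2"
  proof (rule ccontr)
    assume "\<not> length xs \<ge> 2"
    then have "length xs = 1" using xs(1) by (simp flip: length_greater_0_conv)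
    then have "y = p" using xs by (metis One_nat_def diff_Suc_1 hd_conv_nth last_conv_nth)
    then show False using assms(3) by simp
  qed
  have "v \<notin> set xs"
  proof
    assume "v \<in> set xs"
    then obtain i where i: "i < length xs" "xs ! i = v" by (meson in_set_conv_nth)
    show False
    proof (cases i)
      case 0
      then show False using i xs assms(4) by (simp add: hd_conv_nth)
    next
      case (Suc j)
      then show False using nth[of j] i by auto
    qed
  qed
  moreover have "adj es ((v # xs) ! i) ((v # xs) ! (Suc i mod length (v # xs)))" if "i < length (v # xs)" for i
  proof (cases "i = length xs")
    case True
    then have "(v # xs) ! i = p" using xs by (cases xs) (auto simp: last_conv_nth)
    then show ?thesis using True assms(2) by (simp add: edges_def)
  next
    case False
    then have m: "Suc i mod length (v # xs) = Suc i" using that by simp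
    show ?thesis
    proof (cases i)
      case 0
      then show ?thesis using m assms(1) xs by (simp add: edges_def hd_conv_nth)
    next
      case (Suc j)
      then have "(xs ! j, xs ! Suc j) \<in> ?R" using nth[of j] that False by simp
      then show ?thesis using m Suc by (simp add: edges_def)
    qed
  qed
  ultimately show ?thesis using len xs(2) unfolding has_cycle_def
    by (intro exI[of _ "v # xs"]) auto
qed

text \<open>If the top vertex v of the deepest ball B were missing from a ball B' meeting B, then the
  walk inside B' from the common point to the top of B' and on to the root would avoid v. It would
  join the parent of v to a neighbour of v in B without passing through v, closing a cycle.\<close>

lemma tree_simplicial:
  assumes acyclic: "\<not> has_cycle es"
    and reach: "\<And>u. u \<in> V \<Longrightarrow> \<exists>k. u \<in> gball (edges es) k r"
    and E: "edges es \<subseteq> V \<times> V"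
    and A: "finite A" "A \<noteq> {}"
    and B: "\<And>q. q \<in> A \<Longrightarrow> B q \<noteq> {} \<and> B q \<subseteq> V \<and> connected_in (edges es) (B q)"
  shows "simplicial B A"
proof -
  let ?E = "edges es"
  define depth where "depth u = (LEAST k. u \<in> gball ?E k r)" for u
  have depth: "u \<in> gball ?E (depth u) r" if "u \<in> V" for u
    unfolding depth_def using reach[OF that] by (rule LeastI_ex)
  have depth_le: "depth u \<le> k" if "u \<in> gball ?E k r" for u k
    unfolding depth_def using that by (rule Least_le)
  have parent: "\<exists>p\<in>V. (p, u) \<in> ?E \<and> depth p < depth u" if u: "u \<in> V" "u \<noteq> r" for u
  proof (cases "depth u")
    case 0
    then show ?thesis using depth[OF u(1)] u(2) by simp
  next
    case (Suc k)
    have "u \<notin> gball ?E k r" using depth_le[of u k] Suc by auto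
    then obtain p where p: "p \<in> gball ?E k r" "(p, u) \<in> ?E"
      using depth[OF u(1)] Suc by (auto simp: gball_Suc)
    then show ?thesis using depth_le[OF p(1)] Suc E by auto
  qed
  let ?Ev = "\<lambda>v. {(a, b) \<in> ?E. a \<noteq> v \<and> b \<noteq> v}"
  \<comment> \<open>All proper ancestors of \<open>u\<close> have smaller depth than
    \<open>u\<close>, hence smaller depth than \<open>v\<close>, so the way up from \<open>u\<close>
    cannot meet \<open>v\<close>.\<close>
  have to_root: "(u, r) \<in> (?Ev v)\<^sup>*" if "u \<in> V" "depth u \<le> depth v" "u \<noteq> v" for u v
    using that
  proof (induction "depth u" arbitrary: u rule: less_induct)
    case less
    show ?case
    proof (cases "u = r")
      case False
      then obtain p where p: "p \<in> V" "(p, u) \<in> ?E" "depth p < depth u" using parent less.prems by blast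
      then have pv: "p \<noteq> v" using less.prems by auto
      then have "(p, r) \<in> (?Ev v)\<^sup>*" using less p by auto
      moreover have "(u, p) \<in> ?Ev v" using p(2) pv less.prems sym_edges[of es] by (auto dest: symD)
      ultimately show ?thesis by (meson converse_rtrancl_into_rtrancl)
    qed simp
  qed
  define top where "top q = (ARG_MIN depth u. u \<in> B q)" for q
  have top: "top q \<in> B q" "\<And>u. u \<in> B q \<Longrightarrow> depth (top q) \<le> depth u" if "q \<in> A" for q
    using arg_min_nat_lemma[of "\<lambda>u. u \<in> B q" _ depth] B[OF that] unfolding top_def by blast+
  obtain q where q: "q \<in> A" "\<And>q'. q' \<in> A \<Longrightarrow> depth (top q') \<le> depth (top q)"
  proof -
    have fin: "finite ((\<lambda>q. depth (top q)) ` A)" "(\<lambda>q. depth (top q)) ` A \<noteq> {}" using A by auto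
    obtain q where "q \<in> A" "depth (top q) = Max ((\<lambda>q. depth (top q)) ` A)"
      using Max_in[OF fin] by fastforce
    then show ?thesis using that[of q] Max_ge[OF fin(1)] by simp
  qed
  let ?v = "top q"
  have "?v \<in> B q'" if q': "q' \<in> A" "B q' \<inter> B q \<noteq> {}" for q'
  proof (rule ccontr)
    assume nv: "?v \<notin> B q'"
    obtain w where w: "w \<in> B q" "w \<in> B q'" using q' by blast
    let ?v' = "top q'"
    have v': "?v' \<in> B q'" "?v' \<noteq> ?v" "?v' \<in> V" "depth ?v' \<le> depth ?v"
      using top(1)[OF q'(1)] nv B[OF q'(1)] q(2)[OF q'(1)] by auto
    have vV: "?v \<in> V" "?v \<in> B q" using top(1)[OF q(1)] B[OF q(1)] by auto
    \<comment> \<open>If \<open>?v\<close> were the root, its depth 0 would be maximal among the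
      tops, making \<open>?v'\<close> the root as well.\<close>
    have "?v \<noteq> r"
    proof
      assume "?v = r"
      then have "depth ?v = 0" using depth_le[of r 0] by simp
      then have "depth ?v' = 0" using v'(4) by simp
      then have "?v' = r" using depth[OF v'(3)] by simp
      then show False using \<open>?v = r\<close> v'(2) by simp
    qed
    then obtain p where p: "p \<in> V" "(p, ?v) \<in> ?E" "depth p < depth ?v" using parent[OF vV(1)] by blast
    have pB: "p \<notin> B q" using top(2)[OF q(1), of p] p(3) by auto
    have "(w, ?v') \<in> (?E \<inter> B q' \<times> B q')\<^sup>*"
      using B[OF q'(1)] w(2) v'(1) unfolding connected_in_def by blast
    moreover have "(?E \<inter> B q' \<times> B q')\<^sup>* \<subseteq> (?Ev ?v)\<^sup>*" by (rule rtrancl_mono) (use nv in auto)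
    ultimately have 1: "(w, ?v') \<in> (?Ev ?v)\<^sup>*" by blast
    have 2: "(?v', r) \<in> (?Ev ?v)\<^sup>*" using to_root v' by blast
    have "sym (?Ev ?v)" using sym_edges[of es] by (auto simp: sym_def)
    then have s: "sym ((?Ev ?v)\<^sup>*)" by (rule sym_rtrancl)
    have "(p, r) \<in> (?Ev ?v)\<^sup>*" using p by (intro to_root) auto
    then have 3: "(r, p) \<in> (?Ev ?v)\<^sup>*" by (rule symD[OF s])
    have "(?v, w) \<in> (?E \<inter> B q \<times> B q)\<^sup>*"
      using B[OF q(1)] w(1) vV(2) unfolding connected_in_def by blast
    then obtain y where y: "(?v, y) \<in> ?E \<inter> B q \<times> B q" "y \<noteq> ?v"
      "(y, w) \<in> {(a, b) \<in> ?E \<inter> B q \<times> B q. a \<noteq> ?v \<and> b \<noteq> ?v}\<^sup>*"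
      using last_exit[of ?v w] w nv by blast
    have "{(a, b) \<in> ?E \<inter> B q \<times> B q. a \<noteq> ?v \<and> b \<noteq> ?v}\<^sup>* \<subseteq> (?Ev ?v)\<^sup>*"
      by (rule rtrancl_mono) auto
    then have "(y, w) \<in> (?Ev ?v)\<^sup>*" using y(3) by blast
    \<comment> \<open>The walk leads from \<open>y\<close> through \<open>w\<close>,
      \<open>?v'\<close> and \<open>r\<close> to the parent \<open>p\<close>. Its ends differ
      because \<open>y\<close> lies in \<open>B q\<close> and \<open>p\<close>, being less deep than
      the top, does not.\<close>
    then have "(y, p) \<in> (?Ev ?v)\<^sup>*" using 1 2 3 by (meson rtrancl_trans)
    then have "has_cycle es" using cycle_through[of ?v y es p] y p(2) pB by auto
    then show False using acyclic by simp
  qed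
  then show ?thesis unfolding simplicial_def using q(1) by blast
qed

text \<open>Upward jumps along an edge have size at most one, so a walk cannot pass over the value
  \<open>m\<close>.\<close>

lemma discrete_ivt:
  assumes "(a, z) \<in> (E \<inter> B \<times> B)\<^sup>*" "a \<in> B" "f a \<le> m" "m \<le> f z"
    "\<And>u v. (u, v) \<in> E \<Longrightarrow> u \<in> B \<Longrightarrow> v \<in> B \<Longrightarrow> f v \<le> Suc (f u)"
  shows "\<exists>u\<in>B. f u = (m::nat)"
  using assms(1,4)
proof (induction rule: rtrancl_induct)
  case base
  then show ?case using assms(2,3) by (intro bexI[of _ a]) auto
next
  case (step b c)
  show ?case
  proof (cases "m \<le> f b")
    case False
    then have "f c = m" using assms(5)[of b c] step by auto
    then show ?thesis using step by auto
  qed (use step in blast)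
qed

text \<open>Under \<open>f\<close> connected sets become intervals. If \<open>B q\<close> has the
  smallest right end and \<open>B q'\<close> meets it, then \<open>B q'\<close> contains values on
  both sides of that end, hence the end itself, and injectivity makes it the same vertex.\<close>

lemma interval_simplicial:
  assumes f: "inj_on f W" "\<And>u v. (u, v) \<in> E \<Longrightarrow> u \<in> W \<Longrightarrow> v \<in> W \<Longrightarrow> f v \<le> Suc (f u)"
    and A: "finite A" "A \<noteq> {}" "finite W"
    and B: "\<And>q. q \<in> A \<Longrightarrow> B q \<noteq> {} \<and> B q \<subseteq> W \<and> connected_in E (B q)"
  shows "simplicial B A"
proof -
  define top where "top q = Max (f ` B q)" for q
  have fin: "finite (f ` B q)" "f ` B q \<noteq> {}" if "q \<in> A" for q
    using B[OF that] A(3) finite_subset by auto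
  have top: "top q \<in> f ` B q" if "q \<in> A" for q
    unfolding top_def using Max_in[OF fin[OF that]] .
  have top_ge: "f u \<le> top q" if "q \<in> A" "u \<in> B q" for q u
    unfolding top_def using Max_ge[OF fin(1)[OF that(1)]] that by simp
  obtain q where q: "q \<in> A" "\<And>q'. q' \<in> A \<Longrightarrow> top q \<le> top q'"
  proof -
    have "finite (top ` A)" "top ` A \<noteq> {}" using A by auto
    then show ?thesis using that Min_in[of "top ` A"] Min_le[of "top ` A"] by fastforce
  qed
  obtain v where v: "v \<in> B q" "f v = top q" using top[OF q(1)] by auto
  have "v \<in> B q'" if q': "q' \<in> A" "B q' \<inter> B q \<noteq> {}" for q'
  proof -
    obtain a where a: "a \<in> B q" "a \<in> B q'" using q' by blast
    obtain z where z: "z \<in> B q'" "f z = top q'" using top[OF q'(1)] by auto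
    have "\<exists>u\<in>B q'. f u = f v"
    proof (rule discrete_ivt[of a z E])
      show "(a, z) \<in> (E \<inter> B q' \<times> B q')\<^sup>*" using B[OF q'(1)] a z unfolding connected_in_def by blast
      show "f a \<le> f v" using top_ge[OF q(1) a(1)] v by simp
      show "f v \<le> f z" using q(2)[OF q'(1)] v z by simp
    qed (use a B[OF q'(1)] f(2) in blast)+
    then obtain u where "u \<in> B q'" "f u = f v" by blast
    then have "u = v" using f(1) B[OF q'(1)] B[OF q(1)] v(1) by (auto dest: inj_onD)
    then show ?thesis using \<open>u \<in> B q'\<close> by simp
  qed
  then show ?thesis unfolding simplicial_def using q(1) by blast
qed

section \<open>Distances and balls\<close>

lemma walk_in_gball: "is_walk es p u v \<Longrightarrow> u \<in> gball (edges es) (length p - 1) v"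
proof (induction p arbitrary: u)
  case (Cons a p)
  show ?case
  proof (cases "p = []")
    case True
    then show ?thesis using Cons.prems by (simp add: is_walk_def)
  next
    case False
    then have w: "is_walk es p (hd p) v"
      using Cons.prems unfolding is_walk_def by (auto dest: spec[of _ "Suc _"])
    have "adj es u (hd p)" using Cons.prems False spec[of _ 0] unfolding is_walk_def
      by (auto simp: hd_conv_nth)
    then have "(hd p, u) \<in> edges es" by (auto simp: edges_def adj_def)
    moreover have "length p = Suc (length p - 1)" using False by simp
    ultimately show ?thesis using Cons.IH[OF w] gball_Suc[of "edges es" "length p - 1" v] by auto
  qed
qed (simp add: is_walk_def)

lemma gball_walk: "u \<in> gball (edges es) k v \<Longrightarrow> \<exists>p. is_walk es p u v \<and> length p \<le> Suc k"
proof (induction k arbitrary: u)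
  case 0
  then show ?case by (intro exI[of _ "[v]"]) (auto simp: is_walk_def)
next
  case (Suc k)
  show ?case
  proof (cases "u \<in> gball (edges es) k v")
    case True
    then show ?thesis using Suc.IH by (meson le_SucI)
  next
    case False
    then obtain r where r: "r \<in> gball (edges es) k v" "(r, u) \<in> edges es"
      using Suc.prems by (auto simp: gball_Suc)
    obtain p where p: "is_walk es p r v" "length p \<le> Suc k" using Suc.IH[OF r(1)] by blast
    have "is_walk es (u # p) u v"
      using p(1) r(2) unfolding is_walk_def edges_def adj_def
      by (auto simp: nth_Cons hd_conv_nth split: nat.splits)
    then show ?thesis using p(2) by (intro exI[of _ "u # p"]) auto
  qed
qed

lemma dist_le_iff: "dist es u v \<le> enat d \<longleftrightarrow> u \<in> gball (edges es) d v"
proof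
  assume d: "dist es u v \<le> enat d"
  have "\<exists>p. is_walk es p u v \<and> length p - 1 \<le> d"
  proof (rule ccontr)
    assume "\<not> ?thesis"
    then have "enat (Suc d) \<le> dist es u v" unfolding dist_def
      by (intro INF_greatest) (auto simp: not_le Suc_le_eq)
    then have "enat (Suc d) \<le> enat d" using d by (rule order_trans)
    then show False by simp
  qed
  then show "u \<in> gball (edges es) d v" using walk_in_gball gball_mono by blast
next
  assume "u \<in> gball (edges es) d v"
  then obtain p where p: "is_walk es p u v" "length p \<le> Suc d" using gball_walk by blast
  then have "dist es u v \<le> enat (length p - 1)" unfolding dist_def by (intro INF_lower) simp
  also have "\<dots> \<le> enat d" using p(2) by simp
  finally show "dist es u v \<le> enat d" .
qed

section \<open>The decision procedure\<close>

definition flat :: "(nat \<times> nat) list \<Rightarrow> nat list" where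
  "flat xs = concat (map (\<lambda>(a, b). [a, b]) xs)"

lemma length_flat [simp]: "length (flat xs) = 2 * length xs"
  by (induction xs) (auto simp: flat_def)

lemma flat_nth:
  "j < length xs \<Longrightarrow> flat xs ! (2 * j) = fst (xs ! j)"
  "j < length xs \<Longrightarrow> flat xs ! Suc (2 * j) = snd (xs ! j)"
proof (induction xs arbitrary: j)
  case (Cons x xs)
  { case 1 then show ?case using Cons(1)[of "j - 1"] by (cases x; cases j) (auto simp: flat_def) }
  { case 2 then show ?case using Cons(2)[of "j - 1"] by (cases x; cases j) (auto simp: flat_def) }
qed simp_all

lemma set_flat: "set (flat xs) = fst ` set xs \<union> snd ` set xs"
  by (induction xs) (auto simp: flat_def)

definition numbers :: "nat \<Rightarrow> (nat \<times> nat) list \<Rightarrow> (nat \<times> nat) list \<Rightarrow> nat \<Rightarrow> nat list" where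
  "numbers n es ts k = n # length es # flat es @ length ts # flat ts @ [k]"

lemma encode_numbers: "encode n es ts k = number_word.w (numbers n es ts k)"
proof -
  have "concat (map (\<lambda>(a, b). enc_nat a @ enc_nat b) xs) = concat (map enc_nat (flat xs))" for xs
    by (induction xs) (auto simp: flat_def)
  then show ?thesis
    by (simp add: encode_def enc_pairs_def numbers_def number_word.w_def)
qed

lemma length_encode: "2 * length es + 4 \<le> length (encode n es ts k)"
  using number_word.length_le_L[of "numbers n es ts k"]
  unfolding encode_numbers number_word.L_def[symmetric] by (simp add: numbers_def)

lemma edges_subset: "wf_instance n es ts \<Longrightarrow> edges es \<subseteq> {..<n} \<times> {..<n}"
  by (auto simp: wf_instance_def edges_def adj_def)

text \<open>The graph class enters only through the bound on \<open>n\<close> and through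
  \<open>simp\<close>, which speaks of arbitrary connected sets avoiding a vertex. This is what
  trees and cycles have to provide.\<close>

lemma main_correct:
  assumes wf: "wf_instance n es ts" and n: "n \<le> length (encode n es ts k)"
    and simp: "\<And>A B x. x < n \<Longrightarrow> finite A \<Longrightarrow> A \<noteq> {} \<Longrightarrow>
      (\<And>q. q \<in> A \<Longrightarrow> B q \<noteq> {} \<and> B q \<subseteq> {..<n} - {x} \<and> connected_in (edges es) (B q)) \<Longrightarrow> simplicial B A"
  defines "w \<equiv> encode n es ts k"
  shows "sem (length w) (Meet tAcc tAcc) (exec (length w) main (store_of w)) \<longleftrightarrow> yes_instance n es ts k"
proof -
  interpret W: number_word "numbers n es ts k" .
  let ?m = "length es" and ?l = "length ts" and ?ns = "numbers n es ts k" and ?E = "edges es"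
  have w: "w = W.w" "length w = W.L" unfolding w_def encode_numbers W.L_def by auto
  define EI where "EI = (\<lambda>j. 2 * j + 2) ` {..<?m}"
  define TI where "TI = (\<lambda>j. 2 * ?m + 2 * j + 3) ` {..<?l}"
  define A0 where "A0 = W.pos ` TI"
  let ?B = "W.ball_at EI"
  have len: "length ?ns = 2 * ?m + 2 * ?l + 4" by (simp add: numbers_def)
  have E: "?E \<subseteq> {..<n} \<times> {..<n}" by (rule edges_subset[OF wf])
  have nL: "n \<le> W.L" using n w unfolding w_def by simp
  have e_nth: "?ns ! (2 * j + 2) = fst (es ! j)" "?ns ! Suc (2 * j + 2) = snd (es ! j)" if "j < ?m" for j
    using that flat_nth[OF that] by (auto simp: numbers_def nth_append)
  have t_nth: "?ns ! (2 * ?m + 2 * j + 3) = fst (ts ! j)" "?ns ! Suc (2 * ?m + 2 * j + 3) = snd (ts ! j)"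
    if "j < ?l" for j
    using that flat_nth[OF that] by (auto simp: numbers_def nth_append numeral_3_eq_3)
  have nbrs: "W.nbrs EI = nb ?E"
  proof
    fix R
    have "(\<exists>i\<in>EI. ?ns ! i \<in> R \<and> v = ?ns ! Suc i \<or> ?ns ! Suc i \<in> R \<and> v = ?ns ! i) \<longleftrightarrow>
        (\<exists>j<?m. fst (es ! j) \<in> R \<and> v = snd (es ! j) \<or> snd (es ! j) \<in> R \<and> v = fst (es ! j))" for v
      unfolding EI_def using e_nth by auto
    also have "\<dots> v \<longleftrightarrow> (\<exists>e\<in>set es. fst e \<in> R \<and> v = snd e \<or> snd e \<in> R \<and> v = fst e)" for v
      by (metis in_set_conv_nth)
    also have "\<dots> v \<longleftrightarrow> v \<in> ?E `` R" for v
      unfolding edges_def adj_def by force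
    finally show "W.nbrs EI R = nb ?E R" unfolding W.nbrs_def nb_def by blast
  qed
  have t_lt: "fst (ts ! j) < n" if "j < ?l" for j
    using wf nth_mem[OF that] unfolding wf_instance_def by (cases "ts ! j") auto
  have ball: "?B (W.pos (2 * ?m + 2 * j + 3)) = gball ?E (snd (ts ! j)) (fst (ts ! j))" if "j < ?l" for j
    using gball_saturates[OF t_lt[OF that] E nL, of "snd (ts ! j)"] t_nth[OF that] that len
    by (subst W.ball_at_pos) (auto simp: nbrs gball_def)
  have A0: "A0 = (\<lambda>j. W.pos (2 * ?m + 2 * j + 3)) ` {..<?l}"
    unfolding A0_def TI_def by (simp add: image_image)
  have cover: "(\<forall>q\<in>A0. ?B q \<inter> P \<noteq> {}) \<longleftrightarrow> (\<forall>(t, d)\<in>set ts. \<exists>p\<in>P. dist es p t \<le> enat d)" for P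
  proof -
    have "(\<forall>q\<in>A0. ?B q \<inter> P \<noteq> {}) \<longleftrightarrow> (\<forall>j<?l. gball ?E (snd (ts ! j)) (fst (ts ! j)) \<inter> P \<noteq> {})"
      unfolding A0 using ball by auto
    also have "\<dots> \<longleftrightarrow> (\<forall>e\<in>set ts. gball ?E (snd e) (fst e) \<inter> P \<noteq> {})"
      by (metis in_set_conv_nth)
    also have "\<dots> \<longleftrightarrow> (\<forall>(t, d)\<in>set ts. \<exists>p\<in>P. dist es p t \<le> enat d)"
      unfolding dist_le_iff by fastforce
    finally show ?thesis .
  qed
  have sub: "?B q \<subseteq> {..<n}" "connected_in ?E (?B q)" "?B q \<noteq> {}" if "q \<in> A0" for q
  proof -
    obtain j where j: "j < ?l" "q = W.pos (2 * ?m + 2 * j + 3)" using \<open>q \<in> A0\<close> unfolding A0 by blast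
    have B: "?B q = gball ?E (snd (ts ! j)) (fst (ts ! j))" using ball j by simp
    show "?B q \<subseteq> {..<n}" unfolding B using gball_subset[of _ "{..<n}"] t_lt[OF j(1)] E by blast
    show "connected_in ?E (?B q)" unfolding B by (rule connected_gball[OF sym_edges])
    show "?B q \<noteq> {}" unfolding B using gball_center by fast
  qed
  have "sem W.L (Meet tAcc tAcc) (exec W.L main (store_of W.w)) \<longleftrightarrow> accepts ?B W.L A0 k"
    unfolding EI_def A0_def TI_def
  proof (rule W.exec_main[where es = "flat es" and ts = "flat ts" and n = n])
    show "\<forall>u\<in>set (flat es). u < W.L"
      using wf nL unfolding set_flat wf_instance_def by fastforce
    show "\<forall>j<?l. flat ts ! (2 * j) < W.L" using flat_nth t_lt nL by (metis less_le_trans)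
  qed (auto simp: numbers_def)
  also have "\<dots> \<longleftrightarrow> yes_instance n es ts k"
  proof
    assume "accepts ?B W.L A0 k"
    from accepts_sound[OF this, of "{..<n}"] sub(1) obtain P where
      "P \<subseteq> {..<n}" "card P \<le> k" "\<forall>q\<in>A0. ?B q \<inter> P \<noteq> {}" by blast
    then show "yes_instance n es ts k"
      unfolding yes_instance_def covering_placement_def cover by (auto simp: atLeast0LessThan)
  next
    assume "yes_instance n es ts k"
    then obtain P where P: "P \<subseteq> {..<n}" "card P \<le> k" "\<forall>q\<in>A0. ?B q \<inter> P \<noteq> {}"
      unfolding yes_instance_def covering_placement_def cover by (auto simp: atLeast0LessThan)
    show "accepts ?B W.L A0 k"
    proof (rule accepts_complete)
      show "A0 \<subseteq> {..<W.L}" unfolding A0 using len W.pos_less_L by auto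
      show "W.L \<ge> 1" using W.length_le_L len by simp
      show "P \<subseteq> {..<W.L}" using P(1) nL by auto
      fix A x assume x: "x \<in> P" "A \<subseteq> {q \<in> A0. x \<notin> ?B q}" "A \<noteq> {}"
      have fin: "finite A" using x(2) finite_subset[of A A0] unfolding A0 by auto
      show "simplicial ?B A"
      proof (rule simp[OF _ fin x(3)])
        show "x < n" using x(1) P(1) by auto
        fix q assume "q \<in> A"
        then have "q \<in> A0" "x \<notin> ?B q" using x(2) by auto
        then show "?B q \<noteq> {} \<and> ?B q \<subseteq> {..<n} - {x} \<and> connected_in ?E (?B q)" using sub by blast
      qed
    qed (use P in auto)
  qed
  finally show ?thesis unfolding w(2) unfolding w(1) .
qed

text \<open>The number \<open>n\<close> is encoded in binary, but a vertex with a neighbour is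
  itself an entry of the edge list, and every entry occupies at least one cell.\<close>

lemma vertex_count:
  assumes "\<And>v. v < n \<Longrightarrow> \<exists>u. adj es v u"
  shows "n \<le> length (encode n es ts k)"
proof -
  have "{..<n} \<subseteq> set (flat es)" using assms unfolding set_flat adj_def by force
  then have "n \<le> length (flat es)"
    using card_mono[of "set (flat es)" "{..<n}"] card_length[of "flat es"] by simp
  then show ?thesis using length_encode[of es n ts k] by simp
qed

lemma tree_correct:
  fixes k :: nat
  assumes "wf_instance n es ts" "is_tree n es"
  defines "w \<equiv> encode n es ts k"
  shows "sem (length w) (Meet tAcc tAcc) (exec (length w) main (store_of w)) \<longleftrightarrow> yes_instance n es ts k"
  unfolding w_def
proof (rule main_correct[OF assms(1)])
  have t: "0 < n" "connected n es" "\<not> has_cycle es" using assms(2) unfolding is_tree_def by auto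
  show "n \<le> length (encode n es ts k)"
  \<comment> \<open>A single vertex has no edges; here the four numbers present in every encoding
    are enough.\<close>
  proof (cases "n = 1")
    case True
    then show ?thesis using length_encode[of es n ts k] by simp
  next
    case False
    show ?thesis
    proof (rule vertex_count)
      fix v assume v: "v < n"
      define u where "u = (if v = 0 then 1 else 0 :: nat)"
      have u: "u < n" "u \<noteq> v" using False t(1) v unfolding u_def by auto
      obtain p where p: "is_walk es p v u" using t(2) v u(1) unfolding connected_def by blast
      have "length p \<noteq> 1"
      proof
        assume "length p = 1"
        then obtain a where "p = [a]" by (cases p) auto
        then show False using p u(2) unfolding is_walk_def by simp
      qed
      then have "Suc 0 < length p" using p unfolding is_walk_def by (cases p) auto
      then have "adj es (p ! 0) (p ! Suc 0)" using p unfolding is_walk_def by blast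
      then show "\<exists>u. adj es v u" using p unfolding is_walk_def by (auto simp: hd_conv_nth)
    qed
  qed
  fix A :: "nat set" and B :: "nat \<Rightarrow> nat set" and x
  assume A: "finite A" "A \<noteq> {}"
    and B: "\<And>q. q \<in> A \<Longrightarrow> B q \<noteq> {} \<and> B q \<subseteq> {..<n} - {x} \<and> connected_in (edges es) (B q)"
  show "simplicial B A"
  proof (rule tree_simplicial[OF t(3) _ edges_subset[OF assms(1)] A])
    fix u assume "u \<in> {..<n}"
    then obtain p where "is_walk es p u 0" using t(1,2) unfolding connected_def by blast
    then show "\<exists>k. u \<in> gball (edges es) k 0" using walk_in_gball by blast
  qed (use B in blast)
qed

text \<open>Removing \<open>x\<close> turns the cycle into a path. The numbering \<open>f\<close>
  runs along it, so \<open>interval_simplicial\<close> applies to the sets that avoid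
  \<open>x\<close>.\<close>

lemma cycle_correct:
  fixes k :: nat
  assumes "wf_instance n es ts" "is_cycle_graph n es"
  defines "w \<equiv> encode n es ts k"
  shows "sem (length w) (Meet tAcc tAcc) (exec (length w) main (store_of w)) \<longleftrightarrow> yes_instance n es ts k"
  unfolding w_def
proof (rule main_correct[OF assms(1)])
  obtain c where n: "3 \<le> n" and c: "length c = n" "set c = {0..<n}" "distinct c"
    and adj: "\<And>u v. adj es u v \<longleftrightarrow> (\<exists>i<n. {u, v} = {c ! i, c ! (Suc i mod n)})"
    using assms(2) unfolding is_cycle_graph_def by blast
  show "n \<le> length (encode n es ts k)"
  proof (rule vertex_count)
    fix v assume "v < n"
    then obtain i where "i < n" "c ! i = v" using c by (metis atLeastLessThan_iff in_set_conv_nth zero_le)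
    then show "\<exists>u. adj es v u" unfolding adj by blast
  qed
  fix A :: "nat set" and B :: "nat \<Rightarrow> nat set" and x
  assume A: "x < n" "finite A" "A \<noteq> {}"
    and B: "\<And>q. q \<in> A \<Longrightarrow> B q \<noteq> {} \<and> B q \<subseteq> {..<n} - {x} \<and> connected_in (edges es) (B q)"
  define idx where "idx u = inv_into {..<n} ((!) c) u" for u
  have img: "(!) c ` {..<n} = {..<n}" using c by (metis atLeast0LessThan nth_image order_refl take_all_iff)
  have idx: "idx u < n" "c ! idx u = u" if "u < n" for u
    using that inv_into_into[of u "(!) c" "{..<n}"] f_inv_into_f[of u "(!) c" "{..<n}"]
    unfolding idx_def img by auto
  have idx_nth: "idx (c ! i) = i" if "i < n" for i
    unfolding idx_def using c that by (intro inv_into_f_f) (auto simp: inj_on_def nth_eq_iff_index_eq)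
  \<comment> \<open>the distance from x in the direction of c\<close>
  define f where "f u = (if idx x \<le> idx u then idx u - idx x else idx u + n - idx x)" for u
  show "simplicial B A"
  proof (rule interval_simplicial[where f = f and W = "{..<n} - {x}" and E = "edges es"])
    show "inj_on f ({..<n} - {x})"
    proof (rule inj_onI)
      fix u v assume uv: "u \<in> {..<n} - {x}" "v \<in> {..<n} - {x}" "f u = f v"
      then have "idx u < n" "idx v < n" "idx x < n" using idx A(1) by auto
      then have "idx u = idx v" using uv(3) unfolding f_def by (auto split: if_splits)
      then show "u = v" using idx(2) uv(1,2) by (metis DiffD1 lessThan_iff)
    qed
    fix u v assume uv: "(u, v) \<in> edges es" "u \<in> {..<n} - {x}" "v \<in> {..<n} - {x}"
    then obtain i where i: "i < n" "{u, v} = {c ! i, c ! (Suc i mod n)}"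
      unfolding edges_def using adj by auto
    have ne: "idx u \<noteq> idx x" "idx v \<noteq> idx x" using idx(2) A(1) uv by (metis DiffE insertI1 lessThan_iff)+
    have x: "idx x < n" using idx A(1) by simp
    define i' where "i' = Suc i mod n"
    have i': "i' < n" "i' = (if Suc i = n then 0 else Suc i)" using i(1) n unfolding i'_def by auto
    have "idx u = i \<and> idx v = i' \<or> idx u = i' \<and> idx v = i"
      using i(2) idx_nth[OF i(1)] idx_nth[OF i'(1)] unfolding i'_def[symmetric] by (auto simp: doubleton_eq_iff)
    \<comment> \<open>The jump of \<open>idx\<close> from \<open>n - 1\<close> to 0 is compensated
      in \<open>f\<close>; the jump of \<open>f\<close> itself lies at \<open>x\<close>, which
      \<open>ne\<close> rules out as an end of the edge.\<close>
    then show "f v \<le> Suc (f u)"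
      using i(1) i' x ne unfolding f_def by (auto split: if_splits)
  qed (use A B in auto)
qed

theorem theorem3:
  shows "poly_time_decidable_on is_tree \<and> poly_time_decidable_on is_cycle_graph"
proof -
  obtain M C e where M: "tm_wf M" "\<And>w. w \<noteq> [] \<Longrightarrow> set w \<subseteq> {1, 2, 3} \<Longrightarrow>
     fst (tm_run M (C * length w ^ e + C) w) =
       (if sem (length w) (Meet tAcc tAcc) (exec (length w) main (store_of w)) then 1 else 2)"
    using cmd_decides[OF wf_main] by blast
  have w: "encode n es ts k \<noteq> []" "set (encode n es ts k) \<subseteq> {1, 2, 3}" for n es ts k
    using length_encode[of es n ts k] number_word.set_w[of "numbers n es ts k"]
    unfolding encode_numbers by fastforce+
  have "poly_time_decidable_on G"
    if "\<And>n es ts k. wf_instance n es ts \<Longrightarrow> G n es \<Longrightarrow>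
      sem (length (encode n es ts k)) (Meet tAcc tAcc)
        (exec (length (encode n es ts k)) main (store_of (encode n es ts k))) \<longleftrightarrow> yes_instance n es ts k" for G
    unfolding poly_time_decidable_on_def
  proof (rule exI[of _ M], rule exI[of _ C], rule exI[of _ e], intro conjI allI impI)
    fix n es ts k assume "wf_instance n es ts \<and> G n es"
    then have "yes_instance n es ts k \<longleftrightarrow> sem (length (encode n es ts k)) (Meet tAcc tAcc)
        (exec (length (encode n es ts k)) main (store_of (encode n es ts k)))"
      using that by blast
    then show "let w = encode n es ts k; q = fst (tm_run M (C * length w ^ e + C) w)
       in (q = 1 \<or> q = 2) \<and> (q = 1 \<longleftrightarrow> yes_instance n es ts k)"
      unfolding Let_def M(2)[OF w] by (simp del: sem.simps)
  qed (rule M(1))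
  then show ?thesis using tree_correct cycle_correct by blast
qed

end
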